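(* Let $\mathcal{A}$ be a multiarrangement of linear hyperplanes in $\mathbb{C}^n$ with a fixed total order on its hyperplanes, and let $\mathcal{B}$ be the set of bases of $\mathcal{A}$ (equivalently, of the matroid of $\mathcal{A}$). For $H\in\mathcal{A}$ let $\alpha_H$ be a homogeneous linear form with zero set $H$ (unique up to a nonzero scalar). Then the set $$M_{\mathcal{A}}=\bigcup_{B\in\mathcal{B}}\left\{\prod_{e\in E}\alpha_e\times\prod_{i\in I}d\alpha_i\times\prod_{s\in S}\alpha_s\times\prod_{t\in T}d\alpha_t\ :\ \begin{array}{c}E=EP_{\mathcal{A}}(B),\ I\subseteq IP_{\mathcal{A}}(B),\\ S,T\subseteq IA_{\mathcal{A}}(B),\ S\cap T=\varnothing\end{array}\right\}$$ is a basis of the complex vector space $I_{\mathcal{A}}^{\perp}$, the Macaulay inverse system of the superspace ideal $I_{\mathcal{A}}\subseteq\Omega_n$.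
   Context: Superspace: $\Omega_n=\mathbb{C}[x_1,\dots,x_n]\otimes\wedge\{\theta_1,\dots,\theta_n\}$, where the $x_i$ commute and the $\theta_i$ anticommute. The Euler operator is $df=\sum_{i=1}^n(\partial f/\partial x_i)\cdot\theta_i$ (with $\theta$-variables treated as constants). In particular, $d(a_1x_1+\cdots+a_nx_n)=a_1\theta_1+\cdots+a_n\theta_n$. Let $\partial_i=\partial/\partial x_i$ act on the polynomial factor, and let the contraction $\partial_i^\theta$ act on the exterior factor by $\partial_i^\theta(\theta_{j_1}\cdots\theta_{j_r})=(-1)^{s-1}\theta_{j_1}\cdots\widehat{\theta_{j_s}}\cdots\theta_{j_r}$ if $j_s=i$ (the $j$'s being distinct), and $0$ if $i\notin\{j_1,\dots,j_r\}$. For $f,g\in\Omega_n$ let $f\odot g=f(\partial_1,\dots,\partial_n,\partial_1^\theta,\dots,\partial_n^\theta)(g)$. For a bihomogeneous ideal $I\subseteq\Omega_n$ (bigrading: $x_i$ has degree $(1,0)$, $\theta_i$ has degree $(0,1)$), the Macaulay inverse system is $I^\perp=\{g\in\Omega_n: f\odot g=0\text{ for all }f\in I\}$. Multiarrangement: a finite collection $\mathcal{A}=\{H_1,\dots,H_m\}$ of linear hyperplanes of $\mathbb{C}^n$, repeats allowed (repeated copies are regarded as distinct elements). For a line $L=\mathbb{C}\cdot(\ell_1,\dots,\ell_n)$ put $\lambda_L=\ell_1x_1+\cdots+\ell_nx_n$ and $\rho_{\mathcal{A}}(L)=\#\{i: L\not\subseteq H_i\}$. Then $$I_{\mathcal{A}}=\left(\lambda_L^{\rho_{\mathcal{A}}(L)+1},\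 d\big(\lambda_L^{\rho_{\mathcal{A}}(L)+1}\big)\ :\ L\subseteq\mathbb{C}^n\text{ a line}\right)\subseteq\Omega_n .$$ A basis of $\mathcal{A}$ is a subset $B\subseteq\mathcal{A}$ such that $\{\alpha_H:H\in B\}$ is a basis of the span of $\{\alpha_H:H\in\mathcal{A}\}$. The total order on $\mathcal{A}$ induces a lexicographic order on subsets (sets of the same size are compared by listing their elements increasingly). For a basis $B$: - $H\in\mathcal{A}-B$ is externally active if $B$ is the lexicographically largest basis contained in $B\cup\{H\}$, and externally passive otherwise; $EP_{\mathcal{A}}(B)$ is the set of externally passive elements. - $H\in B$ is internally active if $B$ is the lexicographically smallest basis containing $B-\{H\}$, and internally passive otherwise; $IA_{\mathcal{A}}(B)$ and $IP_{\mathcal{A}}(B)$ are the sets of internally active and internally passive elements. Products of the anticommuting elements $d\alpha_i$ are taken in some fixed order; changing the order only changes the sign. *)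

theory Defs
  imports "HOL-Analysis.Analysis" "HOL-Library.Poly_Mapping" "HOL-Library.List_Lexorder"
begin

section \<open>The polynomial ring\<close>

type_synonym 'n mpoly = "('n \<Rightarrow>\<^sub>0 nat) \<Rightarrow>\<^sub>0 complex"

definition lin_form :: "complex ^ 'n \<Rightarrow> 'n::finite mpoly" where
  "lin_form a = (\<Sum>i\<in>UNIV. Poly_Mapping.single (Poly_Mapping.single i 1) (a $ i))"

text \<open>The partial derivative. If the variable \<open>i\<close> does not occur in the monomial \<open>m\<close>, then the
  difference of exponents is truncated, but the coefficient of that term is zero.\<close>

definition pdiff :: "'n \<Rightarrow> 'n mpoly \<Rightarrow> 'n mpoly" where
  "pdiff i p = (\<Sum>m\<in>Poly_Mapping.keys p.
     Poly_Mapping.single (m - Poly_Mapping.single i 1)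
       (of_nat (Poly_Mapping.lookup m i) * Poly_Mapping.lookup p m))"


section \<open>Superspace\<close>

text \<open>An element is stored as its family of coefficients: \<open>f\<close> stands for the sum over all subsets
  \<open>S = {s\<^sub>1 < \<dots> < s\<^sub>r}\<close> of the index type of \<open>coeff f S\<close> times
  \<open>\<theta>\<^sub>s\<^sub>1 \<cdots> \<theta>\<^sub>s\<^sub>r\<close>.\<close>

typedef 'n superspace = "UNIV :: ('n set \<Rightarrow> 'n mpoly) set"
  morphisms coeff Superspace
  by simp

lemma coeff_Superspace [simp]: "coeff (Superspace f) S = f S"
  by (simp add: Superspace_inverse)

lemma superspace_eqI: "(\<And>S. coeff f S = coeff g S) \<Longrightarrow> f = g"
  by (metis coeff_inverse ext)

text \<open>Sorting the product of two increasing \<open>\<theta>\<close>-monomials with disjoint supports \<open>A\<close> and \<open>B\<close>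
  costs one sign for each inversion.\<close>

definition theta_sign :: "'n::linorder set \<Rightarrow> 'n set \<Rightarrow> 'n mpoly" where
  "theta_sign A B = (-1) ^ card {(i, j). i \<in> A \<and> j \<in> B \<and> j < i}"

lemma theta_sign_empty [simp]: "theta_sign {} B = 1" "theta_sign A {} = 1"
  by (simp_all add: theta_sign_def)

lemma theta_sign_Un_left:
  fixes A B C :: "'n::{finite,linorder} set"
  assumes "A \<inter> B = {}"
  shows "theta_sign (A \<union> B) C = theta_sign A C * theta_sign B C"
proof -
  let ?X = "\<lambda>A. {(i, j). i \<in> A \<and> j \<in> C \<and> j < i}"
  have "?X (A \<union> B) = ?X A \<union> ?X B" by auto
  moreover have "?X A \<inter> ?X B = {}" using assms by auto
  ultimately have "card (?X (A \<union> B)) = card (?X A) + card (?X B)"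
    by (simp add: card_Un_disjoint)
  then show ?thesis by (simp add: theta_sign_def power_add)
qed

lemma theta_sign_Un_right:
  fixes A B C :: "'n::{finite,linorder} set"
  assumes "B \<inter> C = {}"
  shows "theta_sign A (B \<union> C) = theta_sign A B * theta_sign A C"
proof -
  let ?X = "\<lambda>B. {(i, j). i \<in> A \<and> j \<in> B \<and> j < i}"
  have "?X (B \<union> C) = ?X B \<union> ?X C" by auto
  moreover have "?X B \<inter> ?X C = {}" using assms by auto
  ultimately have "card (?X (B \<union> C)) = card (?X B) + card (?X C)"
    by (simp add: card_Un_disjoint)
  then show ?thesis by (simp add: theta_sign_def power_add)
qed

instantiation superspace :: ("{finite,linorder}") ring_1
begin

definition "0 = Superspace (\<lambda>_. 0)"
definition "1 = Superspace (\<lambda>S. if S = {} then 1 else 0)"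
definition "f + g = Superspace (\<lambda>S. coeff f S + coeff g S)"
definition "f - g = Superspace (\<lambda>S. coeff f S - coeff g S)"
definition "- f = Superspace (\<lambda>S. - coeff f S)"
definition "f * g = Superspace (\<lambda>S. \<Sum>A\<in>Pow S. theta_sign A (S - A) * (coeff f A * coeff g (S - A)))"

lemma coeff_simps [simp]:
  fixes f g :: "'a superspace"
  shows "coeff (0 :: 'a superspace) S = 0"
    and "coeff (1 :: 'a superspace) S = (if S = {} then 1 else 0)"
    and "coeff (f + g) S = coeff f S + coeff g S"
    and "coeff (f - g) S = coeff f S - coeff g S"
    and "coeff (- f) S = - coeff f S"
  by (simp_all add: zero_superspace_def one_superspace_def plus_superspace_def
      minus_superspace_def uminus_superspace_def)

lemma coeff_mult:
  fixes f g :: "'a superspace"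
  shows "coeff (f * g) S = (\<Sum>A\<in>Pow S. theta_sign A (S - A) * (coeff f A * coeff g (S - A)))"
  by (simp add: times_superspace_def)

instance
proof
  fix f g h :: "'a superspace"
  show "f * g * h = f * (g * h)"
  proof (rule superspace_eqI)
    fix S :: "'a set"
    let ?t = "\<lambda>A B C. theta_sign A B * theta_sign A C * theta_sign B C
      * (coeff f A * coeff g B * coeff h C)"
    have "coeff (f * g * h) S = (\<Sum>D\<in>Pow S. \<Sum>A\<in>Pow D. ?t A (D - A) (S - D))"
      unfolding coeff_mult sum_distrib_left sum_distrib_right
    proof (intro sum.cong refl)
      fix D A assume "D \<in> Pow S" "A \<in> Pow D"
      then have "D = A \<union> (D - A)" by auto
      then have "theta_sign D (S - D) = theta_sign A (S - D) * theta_sign (D - A) (S - D)"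
        by (metis Diff_disjoint theta_sign_Un_left)
      then show "theta_sign D (S - D) *
         (theta_sign A (D - A) * (coeff f A * coeff g (D - A)) * coeff h (S - D))
         = ?t A (D - A) (S - D)"
        by (simp add: mult_ac)
    qed
    also have "\<dots> = (\<Sum>(D, A)\<in>Sigma (Pow S) Pow. ?t A (D - A) (S - D))"
      by (rule sum.Sigma) auto
    also have "\<dots> = (\<Sum>(A, B)\<in>Sigma (Pow S) (\<lambda>A. Pow (S - A)). ?t A B (S - A - B))"
      by (rule sum.reindex_bij_witness[where i = "\<lambda>(A, B). (A \<union> B, A)" and j = "\<lambda>(D, A). (A, D - A)"])
        (auto intro!: arg_cong2[where f = "(*)"] arg_cong2[where f = theta_sign] arg_cong[where f = "coeff _"])
    also have "\<dots> = (\<Sum>A\<in>Pow S. \<Sum>B\<in>Pow (S - A). ?t A B (S - A - B))"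
      by (rule sum.Sigma[symmetric]) auto
    also have "\<dots> = coeff (f * (g * h)) S"
      unfolding coeff_mult sum_distrib_left sum_distrib_right
    proof (intro sum.cong refl)
      fix A B assume "A \<in> Pow S" "B \<in> Pow (S - A)"
      then have "S - A = B \<union> (S - A - B)" by auto
      then have "theta_sign A (S - A) = theta_sign A B * theta_sign A (S - A - B)"
        by (metis Diff_disjoint theta_sign_Un_right)
      then show "?t A B (S - A - B) = theta_sign A (S - A) *
         (coeff f A * (theta_sign B (S - A - B) * (coeff g B * coeff h (S - A - B))))"
        by (simp add: mult_ac)
    qed
    finally show "coeff (f * g * h) S = coeff (f * (g * h)) S" .
  qed
  show "1 * f = f"
  proof (rule superspace_eqI)
    fix S :: "'a set"
    have "coeff (1 * f) S = (\<Sum>A\<in>{{}}. theta_sign A (S - A) * coeff f (S - A))"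
      unfolding coeff_mult by (rule sum.mono_neutral_cong_right) auto
    then show "coeff (1 * f) S = coeff f S" by simp
  qed
  show "f * 1 = f"
  proof (rule superspace_eqI)
    fix S :: "'a set"
    have "coeff (f * 1) S = (\<Sum>A\<in>{S}. theta_sign A (S - A) * coeff f A)"
      unfolding coeff_mult by (rule sum.mono_neutral_cong_right) auto
    then show "coeff (f * 1) S = coeff f S" by simp
  qed
  show "(f + g) * h = f * h + g * h"
    by (rule superspace_eqI) (simp add: coeff_mult sum.distrib[symmetric] algebra_simps)
  show "f * (g + h) = f * g + f * h"
    by (rule superspace_eqI) (simp add: coeff_mult sum.distrib[symmetric] algebra_simps)
  show "(0 :: 'a superspace) \<noteq> 1"
  proof
    assume "(0 :: 'a superspace) = 1"
    then have "coeff (0 :: 'a superspace) {} = coeff 1 {}" by simp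
    then show False by simp
  qed
qed (auto intro!: superspace_eqI simp: algebra_simps)

end

definition scale :: "complex \<Rightarrow> 'n superspace \<Rightarrow> 'n::{finite,linorder} superspace" where
  "scale c f = Superspace (\<lambda>S. Poly_Mapping.single 0 c * coeff f S)"

lemma coeff_scale [simp]: "coeff (scale c f) S = Poly_Mapping.single 0 c * coeff f S"
  by (simp add: scale_def)

interpretation superspace: vector_space scale
  by unfold_locales
    (auto intro!: superspace_eqI simp: algebra_simps single_add mult_single mult.assoc[symmetric])

definition of_mpoly :: "'n mpoly \<Rightarrow> 'n::{finite,linorder} superspace" where
  "of_mpoly p = Superspace (\<lambda>S. if S = {} then p else 0)"

definition theta :: "'n \<Rightarrow> 'n::{finite,linorder} superspace" where
  "theta i = Superspace (\<lambda>S. if S = {i} then 1 else 0)"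

definition x_diff :: "'n \<Rightarrow> 'n superspace \<Rightarrow> 'n::{finite,linorder} superspace" where
  "x_diff i g = Superspace (\<lambda>S. pdiff i (coeff g S))"

definition euler :: "'n superspace \<Rightarrow> 'n::{finite,linorder} superspace" where
  "euler f = (\<Sum>i\<in>UNIV. x_diff i f * theta i)"

lemma of_mpoly_mult: "of_mpoly (p * q) = of_mpoly p * of_mpoly q"
proof (rule superspace_eqI)
  fix S :: "'a set"
  have "coeff (of_mpoly p * of_mpoly q) S = (\<Sum>A\<in>{{} :: 'a set}. coeff (of_mpoly (p * q)) S)"
    unfolding coeff_mult by (rule sum.mono_neutral_cong_right) (auto simp: of_mpoly_def)
  then show "coeff (of_mpoly (p * q)) S = coeff (of_mpoly p * of_mpoly q) S" by simp
qed

lemma of_mpoly_commute: "of_mpoly p * f = f * of_mpoly p"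
proof (rule superspace_eqI)
  fix S :: "'a set"
  have "coeff (of_mpoly p * f) S = (\<Sum>A\<in>{{} :: 'a set}. p * coeff f S)"
    unfolding coeff_mult by (rule sum.mono_neutral_cong_right) (auto simp: of_mpoly_def)
  moreover have "coeff (f * of_mpoly p) S = (\<Sum>A\<in>{S}. coeff f S * p)"
    unfolding coeff_mult by (rule sum.mono_neutral_cong_right) (auto simp: of_mpoly_def)
  ultimately show "coeff (of_mpoly p * f) S = coeff (f * of_mpoly p) S"
    by (simp add: mult.commute)
qed

lemma coeff_theta_mult:
  "coeff (theta i * f) S =
     (if i \<in> S then (-1) ^ card {j \<in> S. j < i} * coeff f (S - {i}) else 0)"
proof -
  have "coeff (theta i * f) S = (\<Sum>A\<in>(if i \<in> S then {{i}} else {}).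
      theta_sign {i} (S - {i}) * coeff f (S - {i}))"
    unfolding coeff_mult
    by (rule sum.mono_neutral_cong_right) (auto simp: theta_def split: if_splits)
  moreover have "{(k, j). k \<in> {i} \<and> j \<in> S - {i} \<and> j < k} = Pair i ` {j \<in> S. j < i}"
    by auto
  then have "card {(k, j). k \<in> {i} \<and> j \<in> S - {i} \<and> j < k} = card {j \<in> S. j < i}"
    by (simp add: card_image inj_on_def)
  ultimately show ?thesis by (cases "i \<in> S") (simp_all add: theta_sign_def)
qed

lemma theta_square: "theta i * theta i = 0"
proof (rule superspace_eqI)
  show "coeff (theta i * theta i) S = coeff 0 S" for S
    unfolding coeff_theta_mult by (auto simp: theta_def)
qed

lemma theta_anticommute: "theta i * theta j = - (theta j * theta i)"
proof (cases "i = j")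
  case False
  have *: "coeff (theta i * theta j) S = (if S = {i, j} then (if i < j then 1 else -1) else 0)"
    if "i \<noteq> j" for i j :: 'a and S
  proof (cases "S = {i, j}")
    case True
    have "{k \<in> {i, j}. k < i} = (if i < j then {} else {j})"
      using that by auto
    moreover have "{i, j} - {i} = {j}" using that by auto
    ultimately show ?thesis
      using True unfolding coeff_theta_mult by (simp add: theta_def)
  next
    case False
    then have "S - {i} \<noteq> {j}" if "i \<in> S" using that by blast
    then show ?thesis using False unfolding coeff_theta_mult by (simp add: theta_def)
  qed
  show ?thesis
  proof (rule superspace_eqI)
    fix S
    have "{j, i} = {i, j}" by blast
    then show "coeff (theta i * theta j) S = coeff (- (theta j * theta i)) S"
      using False *[OF False, of S] *[OF False[symmetric], of S] by auto
  qed
qed (simp add: theta_square)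

lemma theta_monomial:
  "(\<Prod>i\<leftarrow>sorted_list_of_set S. theta i) = Superspace (\<lambda>T. if T = S then 1 else 0)"
proof -
  have "(\<Prod>i\<leftarrow>xs. theta i) = Superspace (\<lambda>T. if T = set xs then 1 else 0)"
    if "sorted xs" "distinct xs" for xs :: "'a list"
    using that
  proof (induction xs)
    case Nil
    then show ?case by (simp add: one_superspace_def)
  next
    case (Cons i xs)
    then have "{j \<in> set (i # xs). j < i} = {}" by auto
    then have *: "card {j \<in> set (i # xs). j < i} = 0" by (simp only: card.empty)
    have **: "T - {i} = set xs \<longleftrightarrow> T = set (i # xs)" if "i \<in> T" for T
      using that Cons.prems by auto
    have IH: "(\<Prod>i\<leftarrow>xs. theta i) = Superspace (\<lambda>T. if T = set xs then 1 else 0)"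
      using Cons by simp
    show ?case
    proof (rule superspace_eqI)
      fix T
      show "coeff (\<Prod>i\<leftarrow>i # xs. theta i) T = coeff (Superspace (\<lambda>T. if T = set (i # xs) then 1 else 0)) T"
      proof (cases "T = set (i # xs)")
        case True
        then have "i \<in> T" by simp
        moreover from this have "T - {i} = set xs" using ** True by blast
        moreover have "card {j \<in> T. j < i} = 0" using * True by blast
        ultimately show ?thesis using True
          by (simp only: list.map prod_list.Cons coeff_theta_mult IH coeff_Superspace) simp
      next
        case False
        then have "coeff (\<Prod>i\<leftarrow>xs. theta i) (T - {i}) = 0" if "i \<in> T"
          using ** that by (simp only: IH coeff_Superspace) simp
        then show ?thesis using False by (simp add: coeff_theta_mult)
      qed
    qed
  qed
  from this[of "sorted_list_of_set S"] show ?thesis by simp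
qed


section \<open>Macaulay inverse systems\<close>

text \<open>Contraction maps \<open>\<theta>\<^sub>T\<close> with \<open>i \<in> T\<close> to \<open>\<theta>\<^bsub>T - {i}\<^esub>\<close> with sign \<open>(-1) ^ card {j \<in> T. j < i}\<close>.
  The definition lists the coefficient of \<open>\<theta>\<^sub>S\<close> in the result, which comes from \<open>T = insert i S\<close>.\<close>

definition contract :: "'n \<Rightarrow> 'n superspace \<Rightarrow> 'n::{finite,linorder} superspace" where
  "contract i g = Superspace (\<lambda>S.
     if i \<in> S then 0 else (-1) ^ card {j \<in> S. j < i} * coeff g (insert i S))"

text \<open>The operators \<open>x_diff i\<close> commute, so that the order of the composition over the variables is
  immaterial. The contractions anticommute, and are composed in the same (increasing)
  order as the \<open>\<theta>\<close>-variables are multiplied: \<open>\<theta>\<^sub>s\<^sub>1 \<cdots> \<theta>\<^sub>s\<^sub>r\<close> acts as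
  \<open>contract s\<^sub>1 \<circ> \<dots> \<circ> contract s\<^sub>r\<close>.\<close>

definition monom_diff :: "('n \<Rightarrow>\<^sub>0 nat) \<Rightarrow> 'n superspace \<Rightarrow> 'n::{finite,linorder} superspace" where
  "monom_diff m = fold (\<lambda>i. x_diff i ^^ Poly_Mapping.lookup m i) (sorted_list_of_set UNIV)"

definition theta_contract :: "'n set \<Rightarrow> 'n superspace \<Rightarrow> 'n::{finite,linorder} superspace" where
  "theta_contract S = foldr contract (sorted_list_of_set S)"

definition odot :: "'n superspace \<Rightarrow> 'n superspace \<Rightarrow> 'n::{finite,linorder} superspace"
    (infixr \<open>\<odot>\<close> 70) where
  "f \<odot> g = (\<Sum>S\<in>UNIV. \<Sum>m\<in>Poly_Mapping.keys (coeff f S).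
     scale (Poly_Mapping.lookup (coeff f S) m) (monom_diff m (theta_contract S g)))"

definition is_ideal :: "'n::{finite,linorder} superspace set \<Rightarrow> bool" where
  "is_ideal I \<longleftrightarrow> 0 \<in> I \<and> (\<forall>f\<in>I. \<forall>g\<in>I. f + g \<in> I) \<and> (\<forall>f\<in>I. \<forall>h. h * f \<in> I \<and> f * h \<in> I)"

definition inverse_system :: "'n superspace set \<Rightarrow> 'n::{finite,linorder} superspace set" where
  "inverse_system I = {g. \<forall>f\<in>I. f \<odot> g = 0}"


section \<open>Multiarrangements\<close>

text \<open>A multiarrangement with a total order is a family \<open>hyp\<close> of hyperplanes indexed by
  a finite subset \<open>A\<close> of a linear order. The elements of the matroid are the indices, so repeated
  copies of a hyperplane are distinct elements. The defining form of \<open>hyp h\<close> is given by its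
  coefficient vector \<open>\<alpha> h\<close>.\<close>

definition linear_hyperplane :: "(complex ^ 'n::finite) set \<Rightarrow> bool" where
  "linear_hyperplane H \<longleftrightarrow> vec.subspace H \<and> vec.dim H = CARD('n) - 1"

definition zero_set :: "complex ^ 'n::finite \<Rightarrow> (complex ^ 'n) set" where
  "zero_set a = {v. (\<Sum>i\<in>UNIV. a $ i * v $ i) = 0}"

definition rho :: "'h set \<Rightarrow> ('h \<Rightarrow> (complex ^ 'n::finite) set) \<Rightarrow> (complex ^ 'n) set \<Rightarrow> nat" where
  "rho A hyp L = card {h \<in> A. \<not> L \<subseteq> hyp h}"

text \<open>The form \<open>\<lambda>\<^sub>L\<close> is determined by the line \<open>L\<close> up to a nonzero scalar only; taking all
  spanning vectors \<open>l\<close> of \<open>L\<close> gives the same ideal as choosing one for each \<open>L\<close>.\<close>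

definition arrangement_ideal ::
    "'h set \<Rightarrow> ('h \<Rightarrow> (complex ^ 'n::{finite,linorder}) set) \<Rightarrow> 'n superspace set" where
  "arrangement_ideal A hyp = is_ideal hull
     (\<Union>l\<in>{l. l \<noteq> 0}. let p = of_mpoly (lin_form l) ^ (rho A hyp (vec.span {l}) + 1) in {p, euler p})"

text \<open>Injectivity of \<open>\<alpha>\<close> on \<open>B\<close> makes this independence of a family: two indices with
  the same form are dependent.\<close>

definition basis :: "'h set \<Rightarrow> ('h \<Rightarrow> complex ^ 'n::finite) \<Rightarrow> 'h set \<Rightarrow> bool" where
  "basis A \<alpha> B \<longleftrightarrow> B \<subseteq> A \<and> inj_on \<alpha> B \<and> vec.independent (\<alpha> ` B) \<and>
     vec.span (\<alpha> ` B) = vec.span (\<alpha> ` A)"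

definition lex_le :: "'h::linorder set \<Rightarrow> 'h set \<Rightarrow> bool" where
  "lex_le B C \<longleftrightarrow> sorted_list_of_set B \<le> sorted_list_of_set C"

definition EP :: "'h::linorder set \<Rightarrow> ('h \<Rightarrow> complex ^ 'n::finite) \<Rightarrow> 'h set \<Rightarrow> 'h set" where
  "EP A \<alpha> B = {h \<in> A - B. \<not> (\<forall>C. basis A \<alpha> C \<and> C \<subseteq> B \<union> {h} \<longrightarrow> lex_le C B)}"

definition IA :: "'h::linorder set \<Rightarrow> ('h \<Rightarrow> complex ^ 'n::finite) \<Rightarrow> 'h set \<Rightarrow> 'h set" where
  "IA A \<alpha> B = {h \<in> B. \<forall>C. basis A \<alpha> C \<and> B - {h} \<subseteq> C \<longrightarrow> lex_le B C}"

definition IP :: "'h::linorder set \<Rightarrow> ('h \<Rightarrow> complex ^ 'n::finite) \<Rightarrow> 'h set \<Rightarrow> 'h set" where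
  "IP A \<alpha> B = B - IA A \<alpha> B"

definition x_prod :: "('h \<Rightarrow> complex ^ 'n::{finite,linorder}) \<Rightarrow> 'h set \<Rightarrow> 'n superspace" where
  "x_prod \<alpha> X = of_mpoly (\<Prod>h\<in>X. lin_form (\<alpha> h))"

definition d_prod :: "('h \<Rightarrow> complex ^ 'n::{finite,linorder}) \<Rightarrow> 'h::linorder set \<Rightarrow> 'n superspace" where
  "d_prod \<alpha> X = (\<Prod>h\<leftarrow>sorted_list_of_set X. euler (of_mpoly (lin_form (\<alpha> h))))"

definition M_set :: "'h::linorder set \<Rightarrow> ('h \<Rightarrow> complex ^ 'n::{finite,linorder}) \<Rightarrow> 'n superspace set" where
  "M_set A \<alpha> = (\<Union>B\<in>{B. basis A \<alpha> B}.
     {x_prod \<alpha> E * d_prod \<alpha> I * x_prod \<alpha> S * d_prod \<alpha> T | E I S T.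
       E = EP A \<alpha> B \<and> I \<subseteq> IP A \<alpha> B \<and> S \<subseteq> IA A \<alpha> B \<and> T \<subseteq> IA A \<alpha> B \<and> S \<inter> T = {}})"

end

theory Submission
  imports Defs
begin

text \<open>Write \<open>D\<^sub>l\<close> for the derivative and \<open>i\<^sub>l\<close> for the contraction along \<open>l\<close>. The inverse system consists of
  the \<open>g\<close> with \<open>D\<^sub>l\<^sup>r\<^sup>+\<^sup>1 g = 0\<close> and \<open>D\<^sub>l\<^sup>r i\<^sub>l g = 0\<close> for all \<open>l\<close>, where \<open>r\<close> is the number of forms of the
  arrangement that do not vanish at \<open>l\<close>; in this description zero forms (loops) are harmless. Let \<open>P(\<A>)\<close>
  be this space, and let \<open>h\<close> be the largest element, with form \<open>a \<noteq> 0\<close>. Restricting both the part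
  of \<open>g\<close> without \<open>da\<close> and the coefficient of \<open>da\<close> to the hyperplane of \<open>a\<close> gives an exact sequence
  \<open>0 \<rightarrow> P(\<A> - h) \<rightarrow> P(\<A>) \<rightarrow> P(\<A> / h)\<^sup>2\<close>, whose first map is multiplication by \<open>a\<close>.
  The monomials split in the same way: since \<open>h\<close> is maximal, it is externally passive for the bases that
  avoid it, and internally passive for those that contain it, unless it is a coloop. So the monomials of
  \<open>\<A>\<close> are \<open>a\<close> times those of \<open>\<A> - h\<close>, together with lifts of those of \<open>\<A> / h\<close> and \<open>da\<close> times these
  lifts, and induction on \<open>\<A>\<close> shows that they form a basis. To stay within one ring, \<open>\<A> / h\<close> is
  realised on the whole space, by projecting the forms along a vector \<open>v\<close> with \<open>a(v) = 1\<close>.\<close>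

section \<open>Linear forms and derivations on superspace\<close>

text \<open>Surjectivity of the last arrow comes from explicit lifts: each monomial of the
  contraction lifts, and \<open>da\<close> times the lifts covers the second copy of
  \<open>P(A / h)\<close>, so the induction gives independence and spanning together. Injectivity of
  the first map and exactness in the middle rest on one fact: along \<open>l\<close>, multiplication
  by \<open>a\<close> raises the degree by exactly 1 if \<open>a(l)\<close> is nonzero and by 0
  otherwise, which is also how the rank changes when \<open>h\<close> is added. The second component
  is there because elements that restrict to zero have the form \<open>a f + da k\<close>.
  Contracting along \<open>v\<close> recovers \<open>k\<close> on the hyperplane, and
  \<open>da * da = 0\<close> turns \<open>da k\<close> into a multiple of \<open>a\<close> once
  \<open>k\<close> vanishes there. If \<open>h\<close> is a coloop, then deletion and contraction
  have the same bases and \<open>h\<close> is internally active; its three places, in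
  \<open>S\<close>, in neither set, in \<open>T\<close>, then give the three families. Contraction
  can turn nonzero forms into zero, so the induction runs over arbitrary families of vectors instead
  of hyperplanes.\<close>

abbreviation unit_exp :: "'n \<Rightarrow> ('n \<Rightarrow>\<^sub>0 nat)" where
  "unit_exp i \<equiv> Poly_Mapping.single i 1"

text \<open>Coefficientwise the truncated subtraction disappears: only \<open>m + unit_exp i\<close>
  contributes to \<open>m\<close>, since a monomial on which the subtraction truncates has the
  factor zero.\<close>

lemma lookup_pdiff:
  "Poly_Mapping.lookup (pdiff i p) m =
     of_nat (Suc (Poly_Mapping.lookup m i)) * Poly_Mapping.lookup p (m + unit_exp i)"
proof -
  let ?g = "\<lambda>k. of_nat (Poly_Mapping.lookup k i) * Poly_Mapping.lookup p k"
  have *: "k = m + unit_exp i"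
    if "Poly_Mapping.lookup k i \<noteq> 0" "k - unit_exp i = m" for k
    using that by (auto intro!: poly_mapping_eqI simp: lookup_add lookup_minus lookup_single when_def)
  have **: "m + unit_exp i - unit_exp i = m"
    by simp
  have "Poly_Mapping.lookup (pdiff i p) m =
      (\<Sum>k\<in>Poly_Mapping.keys p. if k - unit_exp i = m then ?g k else 0)"
    unfolding pdiff_def lookup_sum by (intro sum.cong refl) (simp add: lookup_single when_def)
  also have "\<dots> = (\<Sum>k\<in>Poly_Mapping.keys p. if k = m + unit_exp i then ?g k else 0)"
    using * ** by (intro sum.cong refl) (metis mult_zero_left of_nat_0)
  also have "\<dots> = ?g (m + unit_exp i)"
    by (simp add: in_keys_iff)
  finally show ?thesis
    by (simp add: lookup_add lookup_single)
qed

lemma pdiff_add: "pdiff i (p + q) = pdiff i p + pdiff i q"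
  by (rule poly_mapping_eqI) (simp add: lookup_pdiff lookup_add algebra_simps)

lemma lookup_const_mult:
  "Poly_Mapping.lookup (Poly_Mapping.single 0 c * p) m = c * Poly_Mapping.lookup p (m::'n \<Rightarrow>\<^sub>0 nat)"
  for c :: complex
  by (simp add: mult_map_scale_conv_mult[symmetric] Poly_Mapping.map.rep_eq when_def)

lemma pdiff_const_mult:
  "pdiff i (Poly_Mapping.single 0 c * p) = Poly_Mapping.single 0 c * pdiff i p"
  by (rule poly_mapping_eqI) (simp add: lookup_pdiff lookup_const_mult)

lemma pdiff_zero [simp]: "pdiff i 0 = 0"
  by (rule poly_mapping_eqI) (simp add: lookup_pdiff)

lemma pdiff_sum: "pdiff i (sum f X) = (\<Sum>x\<in>X. pdiff i (f x))"
  by (induction X rule: infinite_finite_induct) (simp_all add: pdiff_add)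

lemma pdiff_single:
  "pdiff i (Poly_Mapping.single m c) =
     Poly_Mapping.single (m - unit_exp i) (of_nat (Poly_Mapping.lookup m i) * c)"
  by (cases "c = 0") (simp_all add: pdiff_def)

lemma pdiff_commute: "pdiff i (pdiff j p) = pdiff j (pdiff i p)"
proof (cases "i = j")
  case False
  then show ?thesis
    by (intro poly_mapping_eqI) (simp add: lookup_pdiff lookup_add lookup_single add_ac mult_ac)
qed simp

lemma mpoly_induct [case_names add single]:
  fixes p :: "'n mpoly"
  assumes "\<And>p q. P p \<Longrightarrow> P q \<Longrightarrow> P (p + q)" "\<And>m c. P (Poly_Mapping.single m c)"
  shows "P p"
proof -
  have 0: "P 0" using assms(2)[of 0 0] by simp
  have "P (\<Sum>m\<in>K. Poly_Mapping.single m (Poly_Mapping.lookup p m))" if "finite K" for K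
    using that by induction (auto intro: 0 assms)
  moreover have "p = (\<Sum>m\<in>Poly_Mapping.keys p. Poly_Mapping.single m (Poly_Mapping.lookup p m))"
    by (rule poly_mapping_eqI) (simp add: lookup_sum lookup_single when_def in_keys_iff)
  ultimately show ?thesis
    by (metis finite_keys)
qed

lemma pdiff_single_mult:
  "pdiff i (Poly_Mapping.single (unit_exp j) a * p) =
     (if i = j then Poly_Mapping.single 0 a * p else 0) + Poly_Mapping.single (unit_exp j) a * pdiff i p"
proof (induction p rule: mpoly_induct)
  case (single m c)
  show ?case
  proof (cases "i = j")
    case False
    then have "unit_exp j + m - unit_exp i = unit_exp j + (m - unit_exp i)"
      by (intro poly_mapping_eqI) (auto simp: lookup_add lookup_minus lookup_single when_def)
    then show ?thesis
      using False by (simp add: mult_single pdiff_single lookup_add lookup_single mult.left_commute[of a])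
  next
    case True
    \<comment> \<open>If \<open>j\<close> does not occur in \<open>m\<close>, the exponent is wrong,
      but its coefficient is zero, so both sides still agree.\<close>
    have "unit_exp j + (m - unit_exp j) = m" if "Poly_Mapping.lookup m j \<noteq> 0"
      using that by (intro poly_mapping_eqI) (auto simp add: lookup_add lookup_minus lookup_single when_def)
    then have "Poly_Mapping.single (unit_exp j + (m - unit_exp j)) (a * (of_nat (Poly_Mapping.lookup m j) * c))
        = Poly_Mapping.single m (a * (of_nat (Poly_Mapping.lookup m j) * c))"
      by (cases "Poly_Mapping.lookup m j = 0") simp_all
    then show ?thesis
      using True by (simp add: mult_single pdiff_single lookup_add lookup_single algebra_simps single_add)
  qed
qed (auto simp: pdiff_add algebra_simps)

section \<open>Linear forms and their differentials in superspace\<close>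

lemma lin_form_add: "lin_form (a + b) = lin_form a + lin_form b"
  by (simp add: lin_form_def single_add sum.distrib)

lemma lin_form_scale: "lin_form (c *s a) = Poly_Mapping.single 0 c * lin_form a"
  by (simp add: lin_form_def sum_distrib_left mult_single)

lemma lin_form_axis: "lin_form (axis i c) = Poly_Mapping.single (unit_exp i) c"
proof -
  have "lin_form (axis i c) = (\<Sum>j\<in>UNIV. if j = i then Poly_Mapping.single (unit_exp i) c else 0)"
    unfolding lin_form_def by (intro sum.cong) (auto simp: axis_def)
  then show ?thesis by simp
qed

lemma pdiff_lin_form_mult:
  "pdiff i (lin_form a * p) = Poly_Mapping.single 0 (a $ i) * p + lin_form a * pdiff i p"
proof -
  have "(\<Sum>j\<in>UNIV. if i = j then Poly_Mapping.single 0 (a $ j) * p else 0) = Poly_Mapping.single 0 (a $ i) * p"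
    by simp
  then show ?thesis
    unfolding lin_form_def sum_distrib_right pdiff_sum pdiff_single_mult sum.distrib by simp
qed

abbreviation lin :: "complex ^ 'n::{finite,linorder} \<Rightarrow> 'n superspace" where
  "lin a \<equiv> of_mpoly (lin_form a)"

abbreviation dlin :: "complex ^ 'n::{finite,linorder} \<Rightarrow> 'n superspace" where
  "dlin a \<equiv> euler (of_mpoly (lin_form a))"

lemma coeff_of_mpoly_mult [simp]: "coeff (of_mpoly p * f) S = p * coeff f S"
proof -
  have "coeff (of_mpoly p * f) S = (\<Sum>A\<in>{{} :: 'a set}. p * coeff f S)"
    unfolding coeff_mult by (rule sum.mono_neutral_cong_right) (auto simp: of_mpoly_def)
  then show ?thesis by simp
qed

lemma scale_eq_mult: "scale c f = of_mpoly (Poly_Mapping.single 0 c) * f"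
  by (rule superspace_eqI) simp

lemma scale_mult_left [simp]: "scale c f * g = scale c (f * g)"
  by (simp add: scale_eq_mult mult.assoc)

lemma scale_mult_right [simp]: "f * scale c g = scale c (f * g)"
  by (metis scale_eq_mult mult.assoc of_mpoly_commute)

lemma of_mpoly_add: "of_mpoly (p + q) = of_mpoly p + of_mpoly q"
  by (rule superspace_eqI) (simp add: of_mpoly_def)

lemma of_mpoly_1 [simp]: "of_mpoly 1 = 1"
  by (rule superspace_eqI) (simp add: of_mpoly_def)

lemma lin_add: "lin (a + b) = lin a + lin b"
  by (simp add: lin_form_add of_mpoly_add)

lemma lin_scale: "lin (c *s a) = scale c (lin a)"
  by (simp add: lin_form_scale of_mpoly_mult scale_eq_mult)

lemma coeff_sum: "coeff (sum f X) S = (\<Sum>x\<in>X. coeff (f x) S)"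
  for f :: "'b \<Rightarrow> 'a::{finite,linorder} superspace"
  by (induction X rule: infinite_finite_induct) simp_all

lemma dlin_eq: "dlin a = (\<Sum>i\<in>UNIV. scale (a $ i) (theta i))"
  unfolding euler_def
proof (intro sum.cong refl)
  fix i :: 'a
  have "x_diff i (lin a) = of_mpoly (pdiff i (lin_form a * 1))"
    by (rule superspace_eqI) (simp add: x_diff_def of_mpoly_def)
  also have "\<dots> = scale (a $ i) 1"
    unfolding pdiff_lin_form_mult
    by (rule superspace_eqI) (use pdiff_single[of i 0 1] in \<open>simp add: of_mpoly_def\<close>)
  finally show "x_diff i (lin a) * theta i = scale (a $ i) (theta i)"
    by simp
qed

lemma dlin_add: "dlin (a + b) = dlin a + dlin b"
  by (simp add: dlin_eq superspace.scale_left_distrib sum.distrib)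

lemma dlin_scale: "dlin (c *s a) = scale c (dlin a)"
  by (simp add: dlin_eq superspace.scale_sum_right)

lemma dlin_axis: "dlin (axis i 1) = theta i"
proof -
  have "dlin (axis i 1) = (\<Sum>j\<in>UNIV. if j = i then theta i else 0)"
    unfolding dlin_eq by (intro sum.cong) (auto simp: axis_def)
  then show ?thesis by simp
qed

lemma lin_zero [simp]: "lin 0 = 0" "dlin 0 = 0"
  using lin_scale[of 0 0] dlin_scale[of 0 0] by simp_all

lemma dlin_anticommute: "dlin a * dlin b = - (dlin b * dlin a)"
proof -
  have "dlin a * dlin b = (\<Sum>i\<in>UNIV. \<Sum>j\<in>UNIV. scale (b $ j) (scale (a $ i) (theta i * theta j)))"
    unfolding dlin_eq sum_distrib_left sum_distrib_right
    by (subst sum.swap) (simp add: superspace.scale_sum_right mult.commute)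
  also have "\<dots> = (\<Sum>i\<in>UNIV. \<Sum>j\<in>UNIV. - scale (b $ j) (scale (a $ i) (theta j * theta i)))"
    by (intro sum.cong refl) (subst theta_anticommute, simp)
  also have "\<dots> = (\<Sum>j\<in>UNIV. \<Sum>i\<in>UNIV. - scale (b $ j) (scale (a $ i) (theta j * theta i)))"
    by (rule sum.swap)
  also have "\<dots> = - (dlin b * dlin a)"
    by (subst sum.swap)
      (simp add: dlin_eq sum_distrib_left sum_distrib_right sum_negf superspace.scale_sum_right mult.commute[of "a $ _"])
  finally show ?thesis .
qed

lemma dlin_square: "dlin a * dlin a = 0"
proof -
  have "scale 2 (dlin a * dlin a) = dlin a * dlin a + dlin a * dlin a"
    using superspace.scale_left_distrib[of 1 1 "dlin a * dlin a"] by simp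
  also have "\<dots> = 0"
    using dlin_anticommute[of a a] by (metis add.right_inverse)
  finally show ?thesis by simp
qed

text \<open>Superspace arises from 1 by left multiplication with the variables, sums and scalars.
  Operators with a Leibniz rule for these generators can therefore be compared without looking at
  coefficients. The generators are written as \<open>lin\<close> and \<open>dlin\<close> of axis
  vectors so that the rules for arbitrary forms apply to them.\<close>

lemma superspace_induct [case_names add scale one lin dlin]:
  fixes f :: "'n::{finite,linorder} superspace"
  assumes add: "\<And>f g. P f \<Longrightarrow> P g \<Longrightarrow> P (f + g)"
    and scale: "\<And>c f. P f \<Longrightarrow> P (scale c f)"
    and one: "P 1"
    and lin: "\<And>i f. P f \<Longrightarrow> P (lin (axis i 1) * f)"
    and dlin: "\<And>i f. P f \<Longrightarrow> P (dlin (axis i 1) * f)"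
  shows "P f"
proof -
  have monom: "P f \<Longrightarrow> P (of_mpoly (Poly_Mapping.single m 1) * f)" for f m
  proof (induction "\<Sum>i\<in>UNIV. Poly_Mapping.lookup m i" arbitrary: m)
    case 0
    then have "m = 0" by (intro poly_mapping_eqI) simp
    then show ?case using 0 by simp
  next
    case (Suc k)
    then obtain i where i: "Poly_Mapping.lookup m i \<noteq> 0"
      by (metis nat.distinct(1) sum.neutral)
    define m' where "m' = m - unit_exp i"
    have m: "m = unit_exp i + m'"
      using i unfolding m'_def
      by (intro poly_mapping_eqI) (auto simp: lookup_add lookup_minus lookup_single when_def)
    have "(\<Sum>j\<in>UNIV. Poly_Mapping.lookup m j) = Suc (\<Sum>j\<in>UNIV. Poly_Mapping.lookup m' j)"
      unfolding m lookup_add sum.distrib by (simp add: lookup_single when_def)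
    then have "P (of_mpoly (Poly_Mapping.single m' 1) * f)"
      using Suc by simp
    then have "P (lin (axis i 1) * (of_mpoly (Poly_Mapping.single m' 1) * f))"
      by (rule lin)
    moreover have "lin (axis i 1) * (of_mpoly (Poly_Mapping.single m' 1) * f) = of_mpoly (Poly_Mapping.single m 1) * f"
      unfolding lin_form_axis m mult.assoc[symmetric] of_mpoly_mult[symmetric] mult_single by simp
    ultimately show ?case by simp
  qed
  have poly: "P f \<Longrightarrow> P (of_mpoly p * f)" for f p
  proof (induction p rule: mpoly_induct)
    case (single m c)
    have "of_mpoly (Poly_Mapping.single m c) * f = scale c (of_mpoly (Poly_Mapping.single m 1) * f)"
      unfolding scale_eq_mult mult.assoc[symmetric] of_mpoly_mult[symmetric] mult_single by simp
    then show ?case using scale[OF monom[OF single]] by simp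
  qed (auto simp: of_mpoly_add algebra_simps add)
  have prod: "P (\<Prod>i\<leftarrow>xs. theta i)" for xs
    using one dlin by (induction xs) (auto simp: dlin_axis)
  have sum: "P (\<Sum>S\<in>\<S>. of_mpoly (coeff f S) * (\<Prod>i\<leftarrow>sorted_list_of_set S. theta i))"
    if "finite \<S>" for \<S>
    using that
  proof (induction rule: finite_induct)
    case empty
    then show ?case using scale[OF one, of 0] by simp
  qed (auto intro: add poly prod)
  from sum[of UNIV] have "P (\<Sum>S\<in>UNIV. of_mpoly (coeff f S) * (\<Prod>i\<leftarrow>sorted_list_of_set S. theta i))"
    by simp
  moreover have "f = (\<Sum>S\<in>UNIV. of_mpoly (coeff f S) * (\<Prod>i\<leftarrow>sorted_list_of_set S. theta i))"
    by (rule superspace_eqI) (simp add: coeff_sum theta_monomial if_distrib cong: if_cong)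
  ultimately show ?thesis by simp
qed

section \<open>Leibniz rules for the coordinate derivatives and contractions\<close>

lemma x_diff_add: "x_diff i (f + g) = x_diff i f + x_diff i g"
  by (rule superspace_eqI) (simp add: x_diff_def pdiff_add)

lemma x_diff_scale: "x_diff i (scale c f) = scale c (x_diff i f)"
  by (rule superspace_eqI) (simp add: x_diff_def pdiff_const_mult)

lemma x_diff_one: "x_diff i 1 = 0"
  by (rule superspace_eqI) (use pdiff_single[of i 0 1] in \<open>simp add: x_diff_def\<close>)

lemma x_diff_lin_mult: "x_diff i (lin a * f) = scale (a $ i) f + lin a * x_diff i f"
  by (rule superspace_eqI) (simp add: x_diff_def pdiff_lin_form_mult)

lemma pdiff_uminus: "pdiff i (- p) = - pdiff i p"
  by (rule poly_mapping_eqI) (simp add: lookup_pdiff)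

lemma pdiff_sign_mult: "pdiff i ((-1) ^ k * p) = (-1) ^ k * pdiff i p"
  by (cases "even k") (simp_all add: pdiff_uminus)

lemma x_diff_theta_mult: "x_diff i (theta j * f) = theta j * x_diff i f"
  by (rule superspace_eqI) (simp add: x_diff_def coeff_theta_mult pdiff_sign_mult)

lemma x_diff_commute: "x_diff i (x_diff j f) = x_diff j (x_diff i f)"
  by (rule superspace_eqI) (simp add: x_diff_def pdiff_commute)

lemma contract_add: "contract i (f + g) = contract i f + contract i g"
  by (rule superspace_eqI) (simp add: contract_def algebra_simps)

lemma contract_scale: "contract i (scale c f) = scale c (contract i f)"
  by (rule superspace_eqI) (simp add: contract_def mult_ac)

lemma contract_one: "contract i 1 = 0"
  by (rule superspace_eqI) (simp add: contract_def)

lemma contract_lin_mult: "contract i (lin a * f) = lin a * contract i f"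
  by (rule superspace_eqI) (simp add: contract_def mult_ac)

text \<open>For \<open>i \<noteq> j\<close> the sign exponents on the two sides count smaller
  indices before and after \<open>i\<close> is inserted and \<open>j\<close> removed. Exactly one of
  \<open>i < j\<close> and \<open>j < i\<close> holds, so exactly one of these counts changes by
  one, which produces the minus sign.\<close>

lemma contract_theta_mult:
  "contract i (theta j * f) = (if i = j then f else 0) - theta j * contract i f"
proof (rule superspace_eqI)
  fix S
  let ?n = "\<lambda>i S. card {k \<in> S. k < i}"
  have ins: "?n j (insert i S) = (if i < j then Suc (?n j S) else ?n j S)" if "i \<notin> S" for i j and S :: "'a set"
  proof -
    have "{k \<in> insert i S. k < j} = (if i < j then insert i {k \<in> S. k < j} else {k \<in> S. k < j})"
      by auto
    then show ?thesis using that by simp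
  qed
  have rem: "?n i S = (if j < i then Suc (?n i (S - {j})) else ?n i (S - {j}))" if "j \<in> S" for i j and S :: "'a set"
    using ins[of j "S - {j}" i] that by (simp add: insert_absorb)
  show "coeff (contract i (theta j * f)) S = coeff ((if i = j then f else 0) - theta j * contract i f) S"
  proof (cases "i = j")
    case True
    have "(-1) ^ ?n i S * ((-1) ^ ?n i S * p) = p" for p :: "'a mpoly"
      by (cases "even (?n i S)") simp_all
    then show ?thesis
      using True rem[of i S i] ins[of i S i] by (auto simp: contract_def coeff_theta_mult insert_absorb)
  next
    case False
    show ?thesis
    proof (cases "i \<notin> S \<and> j \<in> S")
      case True
      let ?c = "coeff f (insert i (S - {j}))"
      have "insert i S - {j} = insert i (S - {j})" using False by auto
      then have L: "coeff (contract i (theta j * f)) S = (-1) ^ ?n i S * ((-1) ^ ?n j (insert i S) * ?c)"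
        using True False by (simp add: contract_def coeff_theta_mult)
      have R: "coeff (theta j * contract i f) S = (-1) ^ ?n j S * ((-1) ^ ?n i (S - {j}) * ?c)"
        using True False by (simp add: contract_def coeff_theta_mult)
      have sgn: "(-1) ^ Suc a * ((-1) ^ b * p) = - ((-1) ^ b * ((-1) ^ a * p))"
          "(-1) ^ a * ((-1) ^ Suc b * p) = - ((-1) ^ b * ((-1) ^ a * p))" for a b and p :: "'a mpoly"
        by (simp_all add: mult.left_commute)
      from False consider "i < j" | "j < i" by fastforce
      then have "coeff (contract i (theta j * f)) S = - coeff (theta j * contract i f) S"
      proof cases
        case 1
        then have "\<not> j < i" by simp
        then have n: "?n i S = ?n i (S - {j})" "?n j (insert i S) = Suc (?n j S)"
          using rem[THEN trans, OF _ if_not_P] ins[THEN trans, OF _ if_P] True 1 by blast+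
        show ?thesis unfolding L R n by (rule sgn(2))
      next
        case 2
        then have "\<not> i < j" by simp
        then have n: "?n j (insert i S) = ?n j S" "?n i S = Suc (?n i (S - {j}))"
          using ins[THEN trans, OF _ if_not_P] rem[THEN trans, OF _ if_P] True 2 by blast+
        show ?thesis unfolding L R n by (rule sgn(1))
      qed
      then show ?thesis using False by simp
    next
      case nt: False
      then show ?thesis using False by (auto simp: contract_def coeff_theta_mult)
    qed
  qed
qed

section \<open>Derivatives and contractions along a vector\<close>

definition ddir :: "complex ^ 'n::{finite,linorder} \<Rightarrow> 'n superspace \<Rightarrow> 'n superspace" where
  "ddir u g = (\<Sum>i\<in>UNIV. scale (u $ i) (x_diff i g))"

definition idir :: "complex ^ 'n::{finite,linorder} \<Rightarrow> 'n superspace \<Rightarrow> 'n superspace" where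
  "idir u g = (\<Sum>i\<in>UNIV. scale (u $ i) (contract i g))"

text \<open>Vectors play two roles, as forms (\<open>lin\<close>, \<open>dlin\<close>) and as
  directions (\<open>ddir\<close>, \<open>idir\<close>). This is the value of the form
  \<open>a\<close> at the point \<open>u\<close>.\<close>

definition pair :: "complex ^ 'n::finite \<Rightarrow> complex ^ 'n \<Rightarrow> complex" where
  "pair a u = (\<Sum>i\<in>UNIV. a $ i * u $ i)"

lemma pair_add_left: "pair (a + b) u = pair a u + pair b u"
  by (simp add: pair_def sum.distrib algebra_simps)

lemma pair_diff_left: "pair (a - b) u = pair a u - pair b u"
  by (simp add: pair_def sum_subtractf algebra_simps)

lemma pair_scale_left: "pair (c *s a) u = c * pair a u"
  by (simp add: pair_def sum_distrib_left mult_ac)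

lemma pair_diff_right: "pair a (u - v) = pair a u - pair a v"
  by (simp add: pair_def sum_subtractf algebra_simps)

lemma pair_scale_right: "pair a (c *s u) = c * pair a u"
  by (simp add: pair_def sum_distrib_left mult_ac)

lemma pair_axis: "pair a (axis i c) = a $ i * c"
proof -
  have "pair a (axis i c) = (\<Sum>j\<in>UNIV. if j = i then a $ i * c else 0)"
    unfolding pair_def by (intro sum.cong) (auto simp: axis_def)
  then show ?thesis by simp
qed

lemma ddir_add: "ddir u (f + g) = ddir u f + ddir u g"
  by (simp add: ddir_def x_diff_add superspace.scale_right_distrib sum.distrib)

lemma ddir_scale: "ddir u (scale c f) = scale c (ddir u f)"
  by (simp add: ddir_def x_diff_scale superspace.scale_sum_right mult.commute)

lemma ddir_one: "ddir u 1 = 0"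
  by (simp add: ddir_def x_diff_one)

lemma ddir_lin_mult: "ddir u (lin a * f) = scale (pair a u) f + lin a * ddir u f"
proof -
  have "ddir u (lin a * f) = (\<Sum>i\<in>UNIV. scale (a $ i * u $ i) f + lin a * scale (u $ i) (x_diff i f))"
    by (simp add: ddir_def x_diff_lin_mult superspace.scale_right_distrib mult.commute[of "u $ _"])
  then show ?thesis
    unfolding sum.distrib superspace.scale_sum_left[symmetric] sum_distrib_left[symmetric]
    by (simp add: ddir_def pair_def)
qed

lemma ddir_dlin_mult: "ddir u (dlin a * f) = dlin a * ddir u f"
proof -
  have sum: "x_diff i (sum h X) = (\<Sum>x\<in>X. x_diff i (h x))" for i h and X :: "'a set"
    by (induction X rule: infinite_finite_induct) (simp_all add: x_diff_add x_diff_scale[of _ 0 0, simplified])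
  have "x_diff i (dlin a * f) = dlin a * x_diff i f" for i
    by (simp add: dlin_eq sum_distrib_right sum x_diff_scale x_diff_theta_mult)
  then show ?thesis by (simp add: ddir_def sum_distrib_left)
qed

lemma idir_add: "idir u (f + g) = idir u f + idir u g"
  by (simp add: idir_def contract_add superspace.scale_right_distrib sum.distrib)

lemma idir_scale: "idir u (scale c f) = scale c (idir u f)"
  by (simp add: idir_def contract_scale superspace.scale_sum_right mult.commute)

lemma idir_one: "idir u 1 = 0"
  by (simp add: idir_def contract_one)

lemma idir_lin_mult: "idir u (lin a * f) = lin a * idir u f"
  by (simp add: idir_def contract_lin_mult sum_distrib_left)

lemma idir_dlin_mult: "idir u (dlin a * f) = scale (pair a u) f - dlin a * idir u f"
proof -
  have sum: "contract i (sum h X) = (\<Sum>x\<in>X. contract i (h x))" for i h and X :: "'a set"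
    by (induction X rule: infinite_finite_induct) (simp_all add: contract_add contract_scale[of _ 0 0, simplified])
  have "contract i (dlin a * f) = scale (a $ i) f - dlin a * contract i f" for i
  proof -
    have "contract i (dlin a * f) =
        (\<Sum>j\<in>UNIV. (if j = i then scale (a $ i) f else 0) - scale (a $ j) (theta j * contract i f))"
      unfolding dlin_eq sum_distrib_right sum
      by (intro sum.cong refl) (auto simp: contract_scale contract_theta_mult superspace.scale_right_diff_distrib)
    then show ?thesis
      by (simp add: sum_subtractf dlin_eq sum_distrib_right)
  qed
  then have "idir u (dlin a * f) =
      (\<Sum>i\<in>UNIV. scale (a $ i * u $ i) f - dlin a * scale (u $ i) (contract i f))"
    by (simp add: idir_def superspace.scale_right_diff_distrib mult.commute[of "u $ _"])
  then show ?thesis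
    unfolding sum_subtractf superspace.scale_sum_left[symmetric] sum_distrib_left[symmetric]
    by (simp add: idir_def pair_def)
qed


interpretation ddir: Vector_Spaces.linear scale scale "ddir u" for u
  by unfold_locales (simp_all add: ddir_add ddir_scale)

interpretation idir: Vector_Spaces.linear scale scale "idir u" for u
  by unfold_locales (simp_all add: idir_add idir_scale)

lemma funpow_ddir_add: "(ddir u ^^ k) (f + g) = (ddir u ^^ k) f + (ddir u ^^ k) g"
  by (induction k) (simp_all add: ddir_add)

lemma funpow_ddir_scale: "(ddir u ^^ k) (scale c f) = scale c ((ddir u ^^ k) f)"
  by (induction k) (simp_all add: ddir_scale)

interpretation ddirs: Vector_Spaces.linear scale scale "ddir u ^^ k" for u k
  by unfold_locales (simp_all add: funpow_ddir_add funpow_ddir_scale)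

lemma ddir_diff_dir: "ddir (u - c *s w) f = ddir u f - scale c (ddir w f)"
  by (simp add: ddir_def superspace.scale_left_diff_distrib sum_subtractf superspace.scale_sum_right)

lemma idir_diff_dir: "idir (u - c *s w) f = idir u f - scale c (idir w f)"
  by (simp add: idir_def superspace.scale_left_diff_distrib sum_subtractf superspace.scale_sum_right)

lemma ddir_commute: "ddir u (ddir w f) = ddir w (ddir u f)"
  by (induction f rule: superspace_induct)
    (simp_all add: ddir_lin_mult ddir_dlin_mult ddir_one ddir.add ddir.scale)

lemma idir_ddir_commute: "idir u (ddir w f) = ddir w (idir u f)"
  by (induction f rule: superspace_induct)
    (simp_all add: ddir_lin_mult ddir_dlin_mult ddir_one idir_lin_mult idir_dlin_mult idir_one
      ddir.add ddir.scale ddir.diff idir.add idir.scale)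

lemma idir_anticommute: "idir u (idir w f) = - idir w (idir u f)"
  by (induction f rule: superspace_induct)
    (simp_all add: idir_lin_mult idir_dlin_mult idir_one idir.add idir.scale idir.diff algebra_simps)

lemma idir_idir: "idir u (idir u f) = 0"
proof -
  have "scale 2 (idir u (idir u f)) = idir u (idir u f) + idir u (idir u f)"
    using superspace.scale_left_distrib[of 1 1 "idir u (idir u f)"] by simp
  also have "\<dots> = 0"
    using idir_anticommute[of u u f] by (metis add.right_inverse)
  finally show ?thesis by simp
qed

lemma funpow_ddir_commute: "(ddir u ^^ k) (ddir w f) = ddir w ((ddir u ^^ k) f)"
  by (induction k) (simp_all add: ddir_commute)

lemma funpow_ddir_idir: "(ddir u ^^ k) (idir w f) = idir w ((ddir u ^^ k) f)"
  by (induction k) (simp_all add: idir_ddir_commute)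

lemma funpow_ddir_dlin_mult: "(ddir u ^^ k) (dlin a * f) = dlin a * (ddir u ^^ k) f"
  by (induction k) (simp_all add: ddir_dlin_mult)

text \<open>The higher Leibniz rule has only two terms because the second derivative of a linear
  form vanishes. The exponent \<open>Suc k\<close> keeps the lower derivative free of truncated
  subtraction.\<close>

lemma funpow_ddir_lin_mult:
  "(ddir u ^^ Suc k) (lin a * f) =
     scale (of_nat (Suc k) * pair a u) ((ddir u ^^ k) f) + lin a * (ddir u ^^ Suc k) f"
proof (induction k)
  case (Suc k)
  then have "(ddir u ^^ Suc (Suc k)) (lin a * f) =
      ddir u (scale (of_nat (Suc k) * pair a u) ((ddir u ^^ k) f) + lin a * (ddir u ^^ Suc k) f)"
    by simp
  also have "\<dots> = scale (of_nat (Suc k) * pair a u + pair a u) ((ddir u ^^ Suc k) f)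
      + lin a * (ddir u ^^ Suc (Suc k)) f"
    unfolding superspace.scale_left_distrib by (simp add: ddir.add ddir.scale ddir_lin_mult)
  also have "of_nat (Suc k) * pair a u + pair a u = of_nat (Suc (Suc k)) * pair a u"
    by (simp add: algebra_simps)
  finally show ?case .
qed (simp add: ddir_lin_mult)

lemma funpow_ddir_lin_mult_0:
  "pair a u = 0 \<Longrightarrow> (ddir u ^^ k) (lin a * f) = lin a * (ddir u ^^ k) f"
  by (induction k) (simp_all add: ddir_lin_mult)

lemma funpow_ddir_eq_0_mono:
  assumes "(ddir u ^^ k) f = 0" "k \<le> n"
  shows "(ddir u ^^ n) f = 0"
proof -
  have "(ddir u ^^ (n - k)) ((ddir u ^^ k) f) = 0"
    using assms(1) by (simp add: ddirs.zero)
  then show ?thesis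
    using assms(2) by (metis comp_apply funpow_add le_add_diff_inverse2)
qed

text \<open>Elements are polynomial in \<open>x\<close>, and each linear factor raises the bound by
  one. The cancellation below takes the last nonvanishing derivative from here.\<close>

lemma ddir_nilpotent: "\<exists>k. (ddir u ^^ k) f = 0"
proof (induction f rule: superspace_induct)
  case (add f g)
  then obtain k n where "(ddir u ^^ k) f = 0" "(ddir u ^^ n) g = 0" by blast
  then have "(ddir u ^^ (k + n)) (f + g) = 0"
    using funpow_ddir_eq_0_mono[of k u f "k + n"] funpow_ddir_eq_0_mono[of n u g "k + n"]
    by (simp add: ddirs.add)
  then show ?case by blast
next
  case (scale c f)
  then show ?case by (metis ddirs.scale superspace.scale_zero_right)
next
  case one
  have "(ddir u ^^ 1) 1 = 0" by (simp add: ddir_one)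
  then show ?case by blast
next
  case (lin i f)
  then obtain k where k: "(ddir u ^^ k) f = 0" by blast
  then have "(ddir u ^^ Suc k) (lin (axis i 1) * f) = 0"
    using funpow_ddir_eq_0_mono[of k u f "Suc k"] unfolding funpow_ddir_lin_mult by (simp del: funpow.simps)
  then show ?case by blast
next
  case (dlin i f)
  then show ?case by (metis funpow_ddir_dlin_mult mult_zero_right)
qed

text \<open>The last nonvanishing derivative of \<open>g\<close> along \<open>u\<close> reappears, with a nonzero factor, in the next
  derivative of \<open>lin a * g\<close>.\<close>

lemma funpow_ddir_lin_mult_cancel:
  assumes "pair a u \<noteq> 0" "(ddir u ^^ Suc k) (lin a * g) = 0"
  shows "(ddir u ^^ k) g = 0"
proof (rule ccontr)
  assume nz: "(ddir u ^^ k) g \<noteq> 0"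
  define n where "n = (LEAST n. (ddir u ^^ n) g = 0)"
  have n: "(ddir u ^^ n) g = 0"
    unfolding n_def using ddir_nilpotent by (rule LeastI_ex)
  have "k < n"
    using funpow_ddir_eq_0_mono[OF n, of k] nz by force
  then obtain j where j: "n = Suc j" "k \<le> j" by (cases n) auto
  have "(ddir u ^^ j) g \<noteq> 0"
    using not_less_Least[of j "\<lambda>n. (ddir u ^^ n) g = 0"] j n_def by simp
  moreover have "(ddir u ^^ Suc j) (lin a * g) = 0"
    using funpow_ddir_eq_0_mono[OF assms(2)] j by (simp del: funpow.simps)
  ultimately show False
    using n assms(1) j unfolding funpow_ddir_lin_mult by (simp del: of_nat_Suc funpow.simps)
qed

lemma pair_eq_1_exists:
  assumes "a \<noteq> 0"
  obtains v where "pair a v = 1"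
proof -
  obtain i where "a $ i \<noteq> 0"
    using assms by (auto simp: vec_eq_iff)
  then have "pair a (axis i (1 / a $ i)) = 1"
    by (simp add: pair_axis)
  then show ?thesis by (rule that)
qed

text \<open>The case \<open>k = 0\<close> of the cancellation, in a direction \<open>v\<close> with
  \<open>a(v) = 1\<close>: a nonzero form is not a zero divisor.\<close>

lemma lin_mult_cancel:
  assumes "a \<noteq> 0" "lin a * g = 0"
  shows "g = 0"
proof -
  obtain v where "pair a v = 1" using assms(1) by (rule pair_eq_1_exists)
  then show ?thesis
    using funpow_ddir_lin_mult_cancel[of a v 0 g] assms(2) by (simp add: ddir.zero)
qed


section \<open>Forms of bounded degree along every line\<close>

definition line_rank :: "'h set \<Rightarrow> ('h \<Rightarrow> complex ^ 'n::finite) \<Rightarrow> complex ^ 'n \<Rightarrow> nat" where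
  "line_rank A \<alpha> l = card {h \<in> A. pair (\<alpha> h) l \<noteq> 0}"

text \<open>The second condition is the action of
  \<open>d(\<lambda>^(r+1)) = (r+1) \<lambda>^r d\<lambda>\<close> with the invertible factor
  \<open>r+1\<close> removed. Both conditions hold trivially at \<open>l = 0\<close>, so
  \<open>l\<close> may range over all vectors.\<close>

definition ext_space :: "'h set \<Rightarrow> ('h \<Rightarrow> complex ^ 'n::{finite,linorder}) \<Rightarrow> 'n superspace set" where
  "ext_space A \<alpha> = {g. \<forall>l. (ddir l ^^ Suc (line_rank A \<alpha> l)) g = 0 \<and>
     (ddir l ^^ line_rank A \<alpha> l) (idir l g) = 0}"

lemma ext_space_subspace: "superspace.subspace (ext_space A \<alpha>)"
  unfolding superspace.subspace_def ext_space_def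
  by (simp add: ddirs.add ddirs.scale ddirs.zero idir.add idir.scale idir.zero del: funpow.simps)

lemma ext_space_ddir:
  assumes "g \<in> ext_space A \<alpha>"
  shows "ddir u g \<in> ext_space A \<alpha>"
  using assms unfolding ext_space_def
  by (simp add: funpow_ddir_commute idir_ddir_commute ddir.zero del: funpow.simps)

text \<open>Contractions anticommute and commute with derivatives, so the bounds survive up to sign.
  Together with \<open>ext_space_ddir\<close> this makes the space stable under the whole superspace
  action, and the gluing uses it to extract the \<open>da\<close>-part.\<close>

lemma ext_space_idir:
  assumes "g \<in> ext_space A \<alpha>"
  shows "idir u g \<in> ext_space A \<alpha>"
proof -
  have "(ddir l ^^ line_rank A \<alpha> l) (idir l (idir u g)) = 0" for l
    using assms unfolding ext_space_def idir_anticommute[of l u]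
    by (simp add: ddirs.neg funpow_ddir_idir[of _ l u] idir.zero)
  then show ?thesis
    using assms unfolding ext_space_def
    by (simp add: funpow_ddir_idir idir.zero del: funpow.simps)
qed

lemma line_rank_insert:
  assumes "finite A" "h \<notin> A"
  shows "line_rank (insert h A) \<alpha> l = (if pair (\<alpha> h) l = 0 then line_rank A \<alpha> l else Suc (line_rank A \<alpha> l))"
proof -
  have "{k \<in> insert h A. pair (\<alpha> k) l \<noteq> 0} =
      (if pair (\<alpha> h) l = 0 then {k \<in> A. pair (\<alpha> k) l \<noteq> 0} else insert h {k \<in> A. pair (\<alpha> k) l \<noteq> 0})"
    by auto
  then show ?thesis using assms by (simp add: line_rank_def)
qed

lemma ext_space_mono:
  assumes "finite A" "B \<subseteq> A"
  shows "ext_space B \<alpha> \<subseteq> ext_space A \<alpha>"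
proof -
  have "line_rank B \<alpha> l \<le> line_rank A \<alpha> l" for l
    unfolding line_rank_def by (rule card_mono) (use assms in auto)
  then show ?thesis
    unfolding ext_space_def by (auto simp del: funpow.simps intro: funpow_ddir_eq_0_mono)
qed

text \<open>Along \<open>l\<close> with \<open>pair (\<alpha> h) l \<noteq> 0\<close>, the factor
  raises the degree by exactly one, and so does \<open>h\<close> the rank; along all other
  \<open>l\<close> neither changes. The backward direction identifies the kernel of the restriction
  maps.\<close>

lemma lin_mult_in_ext_space_iff:
  assumes "finite A" "h \<notin> A" "\<alpha> h \<noteq> 0"
  shows "lin (\<alpha> h) * g \<in> ext_space (insert h A) \<alpha> \<longleftrightarrow> g \<in> ext_space A \<alpha>"
proof -
  have nonconst: "(ddir l ^^ Suc k) (lin (\<alpha> h) * f) = 0 \<longleftrightarrow> (ddir l ^^ k) f = 0"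
    if "pair (\<alpha> h) l \<noteq> 0" for l k f
  proof
    assume k: "(ddir l ^^ k) f = 0"
    then have "(ddir l ^^ Suc k) f = 0" by (rule funpow_ddir_eq_0_mono) simp
    then show "(ddir l ^^ Suc k) (lin (\<alpha> h) * f) = 0"
      unfolding funpow_ddir_lin_mult k by simp
  qed (rule funpow_ddir_lin_mult_cancel[OF that])
  have const: "(ddir l ^^ k) (lin (\<alpha> h) * f) = 0 \<longleftrightarrow> (ddir l ^^ k) f = 0"
    if "pair (\<alpha> h) l = 0" for l k f
    unfolding funpow_ddir_lin_mult_0[OF that] using lin_mult_cancel[OF assms(3)] by auto
  have 1: "(ddir l ^^ Suc (line_rank (insert h A) \<alpha> l)) (lin (\<alpha> h) * g) = 0 \<longleftrightarrow>
      (ddir l ^^ Suc (line_rank A \<alpha> l)) g = 0" for l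
    unfolding line_rank_insert[OF assms(1,2)]
    by (cases "pair (\<alpha> h) l = 0") (simp_all only: simp_thms if_True if_False const nonconst)
  have 2: "(ddir l ^^ line_rank (insert h A) \<alpha> l) (lin (\<alpha> h) * f) = 0 \<longleftrightarrow>
      (ddir l ^^ line_rank A \<alpha> l) f = 0" for l f
    unfolding line_rank_insert[OF assms(1,2)]
    by (cases "pair (\<alpha> h) l = 0") (simp_all only: simp_thms if_True if_False const nonconst)
  show ?thesis
    unfolding ext_space_def mem_Collect_eq idir_lin_mult 1 2 ..
qed

lemma lin_mult_in_ext_space:
  assumes "finite A" "h \<notin> A" "g \<in> ext_space A \<alpha>"
  shows "lin (\<alpha> h) * g \<in> ext_space (insert h A) \<alpha>"
proof (cases "\<alpha> h = 0")
  case True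
  then show ?thesis
    using superspace.subspace_0[OF ext_space_subspace] by simp
next
  case False
  then show ?thesis
    using lin_mult_in_ext_space_iff[of A h \<alpha> g] assms by simp
qed

text \<open>Contraction along \<open>l\<close> gives \<open>pair (\<alpha> h) l\<close> times
  \<open>g\<close>, minus \<open>d\<alpha>\<close> times the contraction of \<open>g\<close>. The
  first term either vanishes or has one more derivative available, which is just what
  \<open>g\<close> needs.\<close>

lemma dlin_mult_in_ext_space:
  assumes "finite A" "h \<notin> A" "g \<in> ext_space A \<alpha>"
  shows "dlin (\<alpha> h) * g \<in> ext_space (insert h A) \<alpha>"
proof -
  have le: "line_rank A \<alpha> l \<le> line_rank (insert h A) \<alpha> l" for l
    by (simp add: line_rank_insert assms)
  have 1: "(ddir l ^^ Suc (line_rank A \<alpha> l)) g = 0" "(ddir l ^^ line_rank A \<alpha> l) (idir l g) = 0" for l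
    using assms(3) unfolding ext_space_def by blast+
  have "(ddir l ^^ line_rank (insert h A) \<alpha> l) (scale (pair (\<alpha> h) l) g) = 0" for l
    using 1(1) by (simp add: line_rank_insert assms(1,2) ddirs.scale del: funpow.simps)
  moreover have "(ddir l ^^ line_rank (insert h A) \<alpha> l) (idir l g) = 0" for l
    using 1(2) le by (rule funpow_ddir_eq_0_mono)
  moreover have "(ddir l ^^ Suc (line_rank (insert h A) \<alpha> l)) g = 0" for l
    by (rule funpow_ddir_eq_0_mono[OF 1(1)]) (use le in simp)
  ultimately show ?thesis
    unfolding ext_space_def
    by (simp add: idir_dlin_mult ddirs.diff funpow_ddir_dlin_mult del: funpow.simps)
qed

lemma one_in_ext_space: "1 \<in> ext_space {} \<alpha>"
  unfolding ext_space_def by (simp add: line_rank_def ddir_one idir_one)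

section \<open>Products of forms and differentials\<close>

lemma x_prod_empty: "x_prod \<alpha> {} = 1"
  by (simp add: x_prod_def)

lemma x_prod_insert: "finite X \<Longrightarrow> h \<notin> X \<Longrightarrow> x_prod \<alpha> (insert h X) = lin (\<alpha> h) * x_prod \<alpha> X"
  by (simp add: x_prod_def of_mpoly_mult)

lemma x_prod_mult_in_ext_space:
  assumes "finite A" "g \<in> ext_space A \<alpha>" "finite X" "X \<inter> A = {}"
  shows "x_prod \<alpha> X * g \<in> ext_space (X \<union> A) \<alpha>"
  using assms(3,4,1,2)
proof (induction X rule: finite_induct)
  case (insert h X)
  then show ?case
    using lin_mult_in_ext_space[of "X \<union> A" h "x_prod \<alpha> X * g" \<alpha>]
    by (simp add: x_prod_insert mult.assoc)
qed (simp add: x_prod_empty)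

lemma dlins_mult_in_ext_space:
  assumes "finite A" "g \<in> ext_space A \<alpha>" "distinct xs" "set xs \<inter> A = {}"
  shows "(\<Prod>h\<leftarrow>xs. dlin (\<alpha> h)) * g \<in> ext_space (set xs \<union> A) \<alpha>"
  using assms(3,4,1,2)
proof (induction xs)
  case (Cons h xs)
  then show ?case
    using dlin_mult_in_ext_space[of "set xs \<union> A" h "(\<Prod>h\<leftarrow>xs. dlin (\<alpha> h)) * g" \<alpha>]
    by (simp add: mult.assoc)
qed simp

text \<open>Starting from 1 over the empty arrangement, each element of \<open>A\<close> is spent on
  at most one factor, either its form or its differential. The elements left over are absorbed by
  \<open>ext_space_mono\<close>.\<close>

lemma product_in_ext_space:
  assumes "finite A" "E \<subseteq> A" "I \<subseteq> A" "S \<subseteq> A" "T \<subseteq> A"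
    and "E \<inter> I = {}" "E \<inter> S = {}" "E \<inter> T = {}" "I \<inter> S = {}" "I \<inter> T = {}" "S \<inter> T = {}"
  shows "x_prod \<alpha> E * d_prod \<alpha> I * x_prod \<alpha> S * d_prod \<alpha> T \<in> ext_space A \<alpha>"
proof -
  have fin: "finite E" "finite I" "finite S" "finite T"
    using assms finite_subset by blast+
  have "d_prod \<alpha> T * 1 \<in> ext_space (T \<union> {}) \<alpha>"
    using dlins_mult_in_ext_space[OF _ one_in_ext_space, of "sorted_list_of_set T" \<alpha>] fin
    by (simp add: d_prod_def)
  then have "x_prod \<alpha> S * (d_prod \<alpha> T * 1) \<in> ext_space (S \<union> (T \<union> {})) \<alpha>"
    by (rule x_prod_mult_in_ext_space[rotated]) (use fin assms in auto)
  then have "d_prod \<alpha> I * (x_prod \<alpha> S * (d_prod \<alpha> T * 1)) \<in> ext_space (I \<union> (S \<union> (T \<union> {}))) \<alpha>"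
    using dlins_mult_in_ext_space[of "S \<union> (T \<union> {})" _ \<alpha> "sorted_list_of_set I"] fin
      Int_Un_distrib[of I S T] \<open>I \<inter> S = {}\<close> \<open>I \<inter> T = {}\<close>
    by (simp add: d_prod_def)
  then have "x_prod \<alpha> E * (d_prod \<alpha> I * (x_prod \<alpha> S * (d_prod \<alpha> T * 1)))
      \<in> ext_space (E \<union> (I \<union> (S \<union> (T \<union> {})))) \<alpha>"
    by (rule x_prod_mult_in_ext_space[rotated]) (use fin assms in auto)
  moreover have "ext_space (E \<union> (I \<union> (S \<union> (T \<union> {})))) \<alpha> \<subseteq> ext_space A \<alpha>"
    by (rule ext_space_mono) (use assms in auto)
  ultimately show ?thesis by (auto simp: mult.assoc)
qed


section \<open>Restriction to a hyperplane\<close>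

lemma of_mpoly_left_commute: "f * (of_mpoly p * g) = of_mpoly p * (f * g)"
  by (metis mult.assoc of_mpoly_commute)

lemma dlin_left_anticommute: "dlin a * (dlin b * g) = - (dlin b * (dlin a * g))"
  unfolding mult.assoc[symmetric] dlin_anticommute[of a b] by simp

text \<open>The class of \<open>g\<close> modulo the ideal of \<open>a\<close> and
  \<open>da\<close>, represented by the element that is constant along \<open>v\<close> and free of
  contraction along \<open>v\<close>. For \<open>a(v) = 1\<close> this representative exists and is
  unique, so the choice is a genuine function.\<close>

definition restr :: "complex ^ 'n::{finite,linorder} \<Rightarrow> complex ^ 'n::{finite,linorder} \<Rightarrow> 'n superspace \<Rightarrow> 'n superspace" where
  "restr a v g = (SOME r. ddir v r = 0 \<and> idir v r = 0 \<and> (\<exists>h k. g = r + lin a * h + dlin a * k))"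

text \<open>If \<open>a(v) = 1\<close>, this is the projection with kernel spanned by
  \<open>a\<close> onto the forms that vanish at \<open>v\<close>; it is how \<open>restr\<close>
  acts on linear forms.\<close>

definition proj_form :: "complex ^ 'n::finite \<Rightarrow> complex ^ 'n \<Rightarrow> complex ^ 'n \<Rightarrow> complex ^ 'n" where
  "proj_form a v b = b - pair b v *s a"

lemma lin_proj_form: "lin b = lin (proj_form a v b) + scale (pair b v) (lin a)"
  and dlin_proj_form: "dlin b = dlin (proj_form a v b) + scale (pair b v) (dlin a)"
  unfolding lin_scale[symmetric] dlin_scale[symmetric] lin_add[symmetric] dlin_add[symmetric]
  by (simp_all add: proj_form_def)

context
  fixes a v :: "complex ^ 'n::{finite,linorder}"
  assumes av: "pair a v = 1"
begin

lemma pair_proj_form: "pair (proj_form a v b) v = 0"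
  by (simp add: proj_form_def pair_diff_left pair_scale_left av)

text \<open>Contraction along \<open>v\<close> writes \<open>k\<close> as a combination of
  \<open>da\<close> and \<open>a\<close>. Since \<open>da * da = 0\<close>, the term
  \<open>da * k\<close> becomes a multiple of \<open>a\<close>, and hence so does \<open>w\<close>.
  A nonzero multiple of \<open>a\<close> is never constant along \<open>v\<close>.\<close>

lemma restr_unique:
  assumes "ddir v w = 0" "idir v w = 0" "w = lin a * h + dlin a * k"
  shows "w = 0"
proof -
  have "0 = idir v w" using assms by simp
  also have "\<dots> = lin a * idir v h + (k - dlin a * idir v k)"
    by (simp add: assms(3) idir.add idir_lin_mult idir_dlin_mult av)
  finally have "k = dlin a * idir v k - lin a * idir v h"
    by (simp add: algebra_simps)
  then have "dlin a * k = dlin a * (dlin a * idir v k - lin a * idir v h)"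
    by simp
  also have "\<dots> = (dlin a * dlin a) * idir v k - (dlin a * lin a) * idir v h"
    by (simp add: right_diff_distrib mult.assoc)
  also have "\<dots> = - (lin a * (dlin a * idir v h))"
    by (simp add: dlin_square of_mpoly_commute[symmetric] mult.assoc)
  finally have "w = lin a * (h - dlin a * idir v h)"
    by (simp add: assms(3) algebra_simps)
  then show ?thesis
    using funpow_ddir_lin_mult_cancel[of a v 0 "h - dlin a * idir v h"] assms(1) av by simp
qed

text \<open>When a variable is multiplied on, it splits into its projection, which keeps the
  remainder constant along \<open>v\<close>, and a multiple of \<open>a\<close> or
  \<open>da\<close>, which joins the ideal part.\<close>

lemma restr_exists:
  "\<exists>r h k. ddir v r = 0 \<and> idir v r = 0 \<and> g = r + lin a * h + dlin a * k"
proof (induction g rule: superspace_induct)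
  case (add f g)
  then obtain r h k r' h' k' where "ddir v r = 0" "idir v r = 0" "f = r + lin a * h + dlin a * k"
    "ddir v r' = 0" "idir v r' = 0" "g = r' + lin a * h' + dlin a * k'"
    by blast
  then show ?case
    by (intro exI[of _ "r + r'"] exI[of _ "h + h'"] exI[of _ "k + k'"])
      (simp add: ddir.add idir.add algebra_simps)
next
  case (scale c g)
  then obtain r h k where "ddir v r = 0" "idir v r = 0" "g = r + lin a * h + dlin a * k"
    by blast
  then show ?case
    by (intro exI[of _ "scale c r"] exI[of _ "scale c h"] exI[of _ "scale c k"])
      (simp add: ddir.scale idir.scale superspace.scale_right_distrib)
next
  case one
  show ?case
    by (intro exI[of _ 1] exI[of _ 0]) (simp add: ddir_one idir_one)
next
  case (lin i g)
  then obtain r h k where *: "ddir v r = 0" "idir v r = 0" "g = r + lin a * h + dlin a * k"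
    by blast
  let ?b = "axis i 1 :: complex ^ 'n::{finite,linorder}"
  let ?c = "pair ?b v"
  have "dlin a * (lin ?b * k) = lin ?b * (dlin a * k)"
    by (rule of_mpoly_left_commute)
  then have "lin ?b * g = lin ?b * r + lin a * (lin ?b * h) + dlin a * (lin ?b * k)"
    unfolding *(3) distrib_left of_mpoly_left_commute[of "lin ?b" "lin_form a"] by simp
  also have "lin ?b * r = lin (proj_form a v ?b) * r + lin a * scale ?c r"
    by (subst lin_proj_form[of ?b a v]) (simp add: algebra_simps)
  finally have "lin ?b * g = lin (proj_form a v ?b) * r + lin a * (scale ?c r + lin ?b * h) + dlin a * (lin ?b * k)"
    by (simp add: algebra_simps)
  moreover have "ddir v (lin (proj_form a v ?b) * r) = 0" "idir v (lin (proj_form a v ?b) * r) = 0"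
    using *(1,2) by (simp_all add: ddir_lin_mult idir_lin_mult pair_proj_form)
  ultimately show ?case by blast
next
  case (dlin i g)
  then obtain r h k where *: "ddir v r = 0" "idir v r = 0" "g = r + lin a * h + dlin a * k"
    by blast
  let ?b = "axis i 1 :: complex ^ 'n::{finite,linorder}"
  let ?c = "pair ?b v"
  have "dlin ?b * (dlin a * k) = - (dlin a * (dlin ?b * k))"
    by (rule dlin_left_anticommute)
  then have "dlin ?b * g = dlin ?b * r + lin a * (dlin ?b * h) - dlin a * (dlin ?b * k)"
    unfolding *(3) distrib_left of_mpoly_left_commute[of "dlin ?b" "lin_form a"] by simp
  also have "dlin ?b * r = dlin (proj_form a v ?b) * r + dlin a * scale ?c r"
    by (subst dlin_proj_form[of ?b a v]) (simp add: algebra_simps)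
  finally have "dlin ?b * g = dlin (proj_form a v ?b) * r + lin a * (dlin ?b * h) + dlin a * (scale ?c r - dlin ?b * k)"
    by (simp add: algebra_simps)
  moreover have "ddir v (dlin (proj_form a v ?b) * r) = 0" "idir v (dlin (proj_form a v ?b) * r) = 0"
    using *(1,2) by (simp_all add: ddir_dlin_mult idir_dlin_mult pair_proj_form)
  ultimately show ?case by blast
qed

lemma restr_works:
  obtains h k where "ddir v (restr a v g) = 0" "idir v (restr a v g) = 0"
    "g = restr a v g + lin a * h + dlin a * k"
proof -
  have "\<exists>r. ddir v r = 0 \<and> idir v r = 0 \<and> (\<exists>h k. g = r + lin a * h + dlin a * k)"
    using restr_exists by blast
  then have "ddir v (restr a v g) = 0 \<and> idir v (restr a v g) = 0 \<and>
      (\<exists>h k. g = restr a v g + lin a * h + dlin a * k)"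
    unfolding restr_def by (rule someI_ex)
  then show ?thesis using that by blast
qed

lemma restr_eqI:
  assumes "ddir v r = 0" "idir v r = 0" "g = r + lin a * h + dlin a * k"
  shows "restr a v g = r"
proof -
  obtain h' k' where *: "ddir v (restr a v g) = 0" "idir v (restr a v g) = 0"
    "g = restr a v g + lin a * h' + dlin a * k'"
    by (rule restr_works)
  have "r + lin a * h + dlin a * k = restr a v g + lin a * h' + dlin a * k'"
    using assms(3) *(3) by (rule subst)
  then have "restr a v g - r = lin a * (h - h') + dlin a * (k - k')"
    by (simp add: algebra_simps)
  then have "restr a v g - r = 0"
    by (rule restr_unique[rotated 2]) (simp_all add: assms(1,2) *(1,2) ddir.diff idir.diff)
  then show ?thesis by simp
qed

lemma restr_linear: "Vector_Spaces.linear scale scale (restr a v)"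
proof (unfold_locales, goal_cases)
  case (1 f g)
  obtain h k where *: "ddir v (restr a v f) = 0" "idir v (restr a v f) = 0"
    "f = restr a v f + lin a * h + dlin a * k"
    by (rule restr_works)
  obtain h' k' where **: "ddir v (restr a v g) = 0" "idir v (restr a v g) = 0"
    "g = restr a v g + lin a * h' + dlin a * k'"
    by (rule restr_works)
  show ?case
  proof (rule restr_eqI)
    have "f + g = (restr a v f + lin a * h + dlin a * k) + (restr a v g + lin a * h' + dlin a * k')"
      using *(3) **(3) by simp
    then show "f + g = restr a v f + restr a v g + lin a * (h + h') + dlin a * (k + k')"
      by (simp only: algebra_simps)
  qed (simp_all add: *(1,2) **(1,2) ddir.add idir.add)
next
  case (2 c g)
  obtain h k where *: "ddir v (restr a v g) = 0" "idir v (restr a v g) = 0"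
    "g = restr a v g + lin a * h + dlin a * k"
    by (rule restr_works)
  show ?case
  proof (rule restr_eqI)
    have "scale c g = scale c (restr a v g + lin a * h + dlin a * k)"
      using *(3) by simp
    then show "scale c g = scale c (restr a v g) + lin a * scale c h + dlin a * scale c k"
      by (simp only: superspace.scale_right_distrib scale_mult_right)
  qed (simp_all add: *(1,2) ddir.scale idir.scale)
qed

interpretation restr: Vector_Spaces.linear scale scale "restr a v"
  by (rule restr_linear)

lemma restr_one: "restr a v 1 = 1"
  by (rule restr_eqI[of _ _ 0 0]) (simp_all add: ddir_one idir_one)

lemma restr_lin_self: "restr a v (lin a * g) = 0"
  by (rule restr_eqI[of _ _ g 0]) (simp_all add: ddir.zero idir.zero)

lemma restr_dlin_self: "restr a v (dlin a * g) = 0"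
  by (rule restr_eqI[of _ _ 0 g]) (simp_all add: ddir.zero idir.zero)

lemma restr_lin_mult: "restr a v (lin b * g) = lin (proj_form a v b) * restr a v g"
proof -
  obtain h k where *: "ddir v (restr a v g) = 0" "idir v (restr a v g) = 0"
    "g = restr a v g + lin a * h + dlin a * k"
    by (rule restr_works)
  let ?p = "lin (proj_form a v b)"
  have "restr a v (?p * g) = ?p * restr a v g"
  proof (rule restr_eqI)
    have "?p * g = ?p * (restr a v g + lin a * h + dlin a * k)"
      using *(3) by simp
    also have "\<dots> = ?p * restr a v g + ?p * (lin a * h) + ?p * (dlin a * k)"
      by (simp only: distrib_left)
    also have "?p * (lin a * h) = lin a * (?p * h)"
      by (metis mult.assoc of_mpoly_commute)
    also have "?p * (dlin a * k) = dlin a * (?p * k)"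
      by (metis mult.assoc of_mpoly_commute)
    finally show "?p * g = ?p * restr a v g + lin a * (?p * h) + dlin a * (?p * k)" .
  qed (simp_all add: *(1,2) ddir_lin_mult idir_lin_mult pair_proj_form)
  moreover have "lin b * g = ?p * g + scale (pair b v) (lin a * g)"
    by (subst lin_proj_form[of b a v]) (simp add: algebra_simps)
  ultimately show ?thesis
    by (simp add: restr.add restr.scale restr_lin_self)
qed

lemma restr_dlin_mult: "restr a v (dlin b * g) = dlin (proj_form a v b) * restr a v g"
proof -
  obtain h k where *: "ddir v (restr a v g) = 0" "idir v (restr a v g) = 0"
    "g = restr a v g + lin a * h + dlin a * k"
    by (rule restr_works)
  let ?p = "dlin (proj_form a v b)"
  have "restr a v (?p * g) = ?p * restr a v g"
  proof (rule restr_eqI)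
    have "?p * g = ?p * (restr a v g + lin a * h + dlin a * k)"
      using *(3) by simp
    also have "\<dots> = ?p * restr a v g + ?p * (lin a * h) + ?p * (dlin a * k)"
      by (simp only: distrib_left)
    also have "?p * (lin a * h) = lin a * (?p * h)"
      by (metis mult.assoc of_mpoly_commute)
    also have "?p * (dlin a * k) = dlin a * (- (?p * k))"
      unfolding mult_minus_right by (rule dlin_left_anticommute)
    finally show "?p * g = ?p * restr a v g + lin a * (?p * h) + dlin a * (- (?p * k))" .
  qed (simp_all add: *(1,2) ddir_dlin_mult idir_dlin_mult pair_proj_form)
  moreover have "dlin b * g = ?p * g + scale (pair b v) (dlin a * g)"
    by (subst dlin_proj_form[of b a v]) (simp add: algebra_simps)
  ultimately show ?thesis
    by (simp add: restr.add restr.scale restr_dlin_self)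
qed

text \<open>The vector \<open>u - a(u) v\<close> is tangent to the hyperplane of \<open>a\<close>,
  so its derivative and contraction preserve the ideal of \<open>a\<close> and \<open>da\<close>. On
  the representative it acts as \<open>u\<close> does, because \<open>v\<close> acts as zero
  there.\<close>

lemma restr_ddir: "ddir u (restr a v g) = restr a v (ddir (u - pair a u *s v) g)"
  and restr_idir: "idir u (restr a v g) = restr a v (idir (u - pair a u *s v) g)"
proof -
  obtain h k where *: "ddir v (restr a v g) = 0" "idir v (restr a v g) = 0"
    "g = restr a v g + lin a * h + dlin a * k"
    by (rule restr_works)
  define w where "w = u - pair a u *s v"
  have w: "pair a w = 0"
    by (simp add: w_def pair_diff_right pair_scale_right av)
  have "restr a v (ddir w g) = ddir w (restr a v g)"
  proof (rule restr_eqI)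
    have "ddir w g = ddir w (restr a v g + lin a * h + dlin a * k)"
      using *(3) by simp
    then show "ddir w g = ddir w (restr a v g) + lin a * ddir w h + dlin a * ddir w k"
      by (simp add: ddir.add ddir_lin_mult ddir_dlin_mult w)
  qed (simp_all add: *(1,2) ddir_commute[of v w] idir_ddir_commute ddir.zero)
  moreover have "ddir w (restr a v g) = ddir u (restr a v g)"
    by (simp add: w_def ddir_diff_dir *(1,2))
  ultimately show "ddir u (restr a v g) = restr a v (ddir (u - pair a u *s v) g)"
    by (simp add: w_def)
  have "restr a v (idir w g) = idir w (restr a v g)"
  proof (rule restr_eqI)
    have "idir w g = idir w (restr a v g + lin a * h + dlin a * k)"
      using *(3) by simp
    then show "idir w g = idir w (restr a v g) + lin a * idir w h + dlin a * (- idir w k)"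
      by (simp add: idir.add idir_lin_mult idir_dlin_mult w)
  qed (simp_all add: *(1,2) idir_anticommute[of v w] idir_ddir_commute[symmetric] idir.zero)
  moreover have "idir w (restr a v g) = idir u (restr a v g)"
    by (simp add: w_def idir_diff_dir *(1,2))
  ultimately show "idir u (restr a v g) = restr a v (idir (u - pair a u *s v) g)"
    by (simp add: w_def)
qed

text \<open>The first condition gives \<open>g = a h + da k\<close>, and the second says that
  \<open>k\<close> restricts to zero, so \<open>k = a h' + da k'\<close>. Then
  \<open>da k = a da h'\<close> because \<open>da * da = 0\<close>.\<close>

lemma restr_kernel:
  assumes "restr a v g = 0" "restr a v (idir v g) = 0"
  obtains f where "g = lin a * f"
proof -
  obtain h k where g: "g = lin a * h + dlin a * k"
    using restr_works[of g] assms(1) by (metis add_0)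
  have "idir v g = lin a * idir v h + (k - dlin a * idir v k)"
    by (simp add: g idir.add idir_lin_mult idir_dlin_mult av)
  then have "restr a v k = 0"
    using assms(2) by (simp add: restr.add restr.diff restr_lin_self restr_dlin_self)
  then obtain h' k' where "k = lin a * h' + dlin a * k'"
    using restr_works[of k] by (metis add_0)
  then have "dlin a * k = dlin a * (lin a * h') + (dlin a * dlin a) * k'"
    by (simp add: distrib_left mult.assoc)
  also have "\<dots> = lin a * (dlin a * h')"
    by (metis add.right_neutral dlin_square mult.assoc mult_zero_left of_mpoly_commute)
  finally have "g = lin a * (h + dlin a * h')"
    by (simp add: g distrib_left)
  then show ?thesis by (rule that)
qed

text \<open>A projected form takes at \<open>l\<close> the value of the original form at
  \<open>w = l - a(l) v\<close>. As \<open>a(w) = 0\<close>, the element \<open>h\<close> does not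
  count along \<open>w\<close>, so the bounds for the restriction along \<open>l\<close> are those
  for \<open>g\<close> along \<open>w\<close>.\<close>

lemma restr_in_ext_space:
  assumes "finite A" "h \<notin> A" "\<alpha> h = a" "g \<in> ext_space (insert h A) \<alpha>"
  shows "restr a v g \<in> ext_space A (\<lambda>k. proj_form a v (\<alpha> k))"
proof -
  have "(ddir l ^^ Suc (line_rank A (\<lambda>k. proj_form a v (\<alpha> k)) l)) (restr a v g) = 0 \<and>
      (ddir l ^^ line_rank A (\<lambda>k. proj_form a v (\<alpha> k)) l) (idir l (restr a v g)) = 0" for l
  proof -
    define w where "w = l - pair a l *s v"
    have w: "pair a w = 0"
      by (simp add: w_def pair_diff_right pair_scale_right av)
    have "pair (proj_form a v b) l = pair b w" for b
      by (simp add: w_def proj_form_def pair_diff_right pair_scale_right pair_diff_left pair_scale_left)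
    then have "line_rank A (\<lambda>k. proj_form a v (\<alpha> k)) l = line_rank (insert h A) \<alpha> w"
      unfolding line_rank_insert[OF assms(1,2)] assms(3) w by (simp add: line_rank_def)
    moreover have "(ddir l ^^ n) (restr a v f) = restr a v ((ddir w ^^ n) f)" for n f
      by (induction n) (simp_all add: restr_ddir w_def)
    ultimately show ?thesis
      using assms(4) unfolding ext_space_def
      by (simp add: restr_idir w_def[symmetric] restr.zero del: funpow.simps)
  qed
  then show ?thesis by (simp add: ext_space_def del: funpow.simps)
qed

text \<open>Contraction along \<open>v\<close> followed by restriction reads off the coefficient of
  \<open>da\<close> on the hyperplane and annihilates multiples of \<open>a\<close>.\<close>

lemma restr_idir_dlin: "restr a v (idir v (dlin a * g)) = restr a v g"
  by (simp add: idir_dlin_mult av restr.diff restr_dlin_self)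

lemma restr_idir_lin: "restr a v (idir v (lin a * g)) = 0"
  by (simp add: idir_lin_mult restr_lin_self)

lemma restr_x_prod_mult:
  "finite X \<Longrightarrow> restr a v (x_prod \<alpha> X * g) = x_prod (\<lambda>k. proj_form a v (\<alpha> k)) X * restr a v g"
  by (induction X rule: finite_induct) (simp_all add: x_prod_empty x_prod_insert mult.assoc restr_lin_mult)

lemma restr_d_prod_mult:
  "restr a v (d_prod \<alpha> X * g) = d_prod (\<lambda>k. proj_form a v (\<alpha> k)) X * restr a v g"
proof -
  have "restr a v ((\<Prod>h\<leftarrow>xs. dlin (\<alpha> h)) * g) = (\<Prod>h\<leftarrow>xs. dlin (proj_form a v (\<alpha> h))) * restr a v g" for xs
    by (induction xs) (simp_all add: mult.assoc restr_dlin_mult)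
  then show ?thesis by (simp add: d_prod_def)
qed

end


section \<open>The inverse system as a space of forms\<close>

lemma x_diff_eq_ddir: "x_diff i f = ddir (axis i 1) f"
proof -
  have "ddir (axis i 1) f = (\<Sum>j\<in>UNIV. if j = i then x_diff i f else 0)"
    unfolding ddir_def by (intro sum.cong) (auto simp: axis_def)
  then show "x_diff i f = ddir (axis i 1) f" by simp
qed

lemma contract_linear: "Vector_Spaces.linear scale scale (contract i)"
  by unfold_locales (simp_all add: contract_add contract_scale)

lemma contract_eq_idir: "contract i f = idir (axis i 1) f"
proof -
  have "idir (axis i 1) f = (\<Sum>j\<in>UNIV. if j = i then contract i f else 0)"
    unfolding idir_def by (intro sum.cong) (auto simp: axis_def)
  then show "contract i f = idir (axis i 1) f" by simp
qed

lemma lin_eq: "lin a = (\<Sum>i\<in>UNIV. scale (a $ i) (lin (axis i 1)))"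
proof (rule superspace_eqI)
  show "coeff (lin a) S = coeff (\<Sum>i\<in>UNIV. scale (a $ i) (lin (axis i 1))) S" for S
    unfolding lin_form_axis coeff_sum coeff_scale of_mpoly_def coeff_Superspace
    by (simp add: lin_form_def mult_single)
qed

lemma contract_anticommute: "contract i (contract j f) = - contract j (contract i f)"
  by (simp add: contract_eq_idir idir_anticommute[of "axis i 1" "axis j 1"])

lemma contract_zero: "contract i 0 = 0"
  by (simp add: contract_eq_idir idir.zero)

lemma contract_contract: "contract i (contract i f) = 0"
  by (simp add: contract_eq_idir idir_idir)

lemma contract_foldr_mem: "i \<in> set xs \<Longrightarrow> contract i (foldr contract xs g) = 0"
proof (induction xs)
  case (Cons j xs)
  show ?case
  proof (cases "i = j")
    case False
    then have "contract i (foldr contract xs g) = 0" using Cons by simp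
    then show ?thesis
      using contract_anticommute[of i j "foldr contract xs g"] by (simp add: contract_zero)
  qed (simp add: contract_contract)
qed simp

lemma foldr_contract_insort:
  "i \<notin> set xs \<Longrightarrow> sorted xs \<Longrightarrow> distinct xs \<Longrightarrow>
   foldr contract (insort i xs) g =
     scale ((-1) ^ card {j \<in> set xs. j < i}) (contract i (foldr contract xs g))"
proof (induction xs)
  case (Cons j xs)
  show ?case
  proof (cases "i < j")
    case True
    have "{k \<in> set (j # xs). k < i} = {}" using True Cons.prems by fastforce
    then have "scale ((-1) ^ card {k \<in> set (j # xs). k < i}) f = f" for f :: "'a superspace"
      by (simp only: card.empty power_0 superspace.scale_one)
    then show ?thesis using less_imp_le[OF True] by (simp del: set_simps)
  next
    case False
    then have "j < i" using Cons.prems by auto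
    then have "{k \<in> set (j # xs). k < i} = insert j {k \<in> set xs. k < i}" by auto
    then have "card {k \<in> set (j # xs). k < i} = Suc (card {k \<in> set xs. k < i})"
      using Cons.prems by simp
    moreover have "foldr contract (insort i xs) g =
        scale ((-1) ^ card {j \<in> set xs. j < i}) (contract i (foldr contract xs g))"
      using Cons by simp
    ultimately show ?thesis
      using less_le_not_le[of j i] \<open>j < i\<close> contract_anticommute[of j i "foldr contract xs g"]
      by (simp add: contract_scale del: set_simps)
  qed
qed simp

text \<open>Moving a contraction into its sorted place costs one sign per smaller index. This is the
  sign of \<open>coeff_theta_mult\<close>, so the two cancel in the action of a product.\<close>

lemma theta_contract_insert:
  "i \<notin> S \<Longrightarrow> theta_contract (insert i S) g =
     scale ((-1) ^ card {j \<in> S. j < i}) (contract i (theta_contract S g))"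
  unfolding theta_contract_def
  using foldr_contract_insort[of i "sorted_list_of_set S" g] by simp

lemma contract_theta_contract: "i \<in> S \<Longrightarrow> contract i (theta_contract S g) = 0"
  unfolding theta_contract_def by (rule contract_foldr_mem) simp

lemma funpow_commute1: "(\<And>g. f (h g) = h (f g)) \<Longrightarrow> f ((h ^^ n) g) = (h ^^ n) (f g)"
  by (induction n) simp_all

lemma monom_diff_commute:
  assumes "\<And>i g. T (x_diff i g) = x_diff i (T g)"
  shows "T (monom_diff m g) = monom_diff m (T g)"
proof -
  have "T (fold (\<lambda>i. x_diff i ^^ Poly_Mapping.lookup m i) xs g) =
      fold (\<lambda>i. x_diff i ^^ Poly_Mapping.lookup m i) xs (T g)" for xs
    by (induction xs arbitrary: g) (simp_all add: funpow_commute1[where f = T] assms)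
  then show ?thesis by (simp add: monom_diff_def)
qed

lemma monom_diff_0: "monom_diff 0 g = g"
proof -
  have "fold (\<lambda>i. x_diff i ^^ 0) xs g = g" for xs
    by (induction xs) simp_all
  then show ?thesis by (simp add: monom_diff_def)
qed

lemma monom_diff_unit_add: "monom_diff (unit_exp i + m) g = x_diff i (monom_diff m g)"
proof -
  let ?F = "\<lambda>m xs. fold (\<lambda>j. x_diff j ^^ Poly_Mapping.lookup m j) xs"
  have commute: "x_diff i (?F m xs g) = ?F m xs (x_diff i g)" for xs g
    by (induction xs arbitrary: g) (simp_all add: funpow_commute1 x_diff_commute)
  have "distinct xs \<Longrightarrow> ?F (unit_exp i + m) xs g = (if i \<in> set xs then x_diff i (?F m xs g) else ?F m xs g)"
    for xs g
  proof (induction xs arbitrary: g)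
    case (Cons j xs)
    then show ?case
      by (auto simp: commute lookup_add lookup_single when_def funpow_commute1 x_diff_commute)
  qed simp
  then show ?thesis by (simp add: monom_diff_def)
qed

section \<open>The action of superspace on itself\<close>

definition poly_diff :: "'n mpoly \<Rightarrow> 'n superspace \<Rightarrow> 'n::{finite,linorder} superspace" where
  "poly_diff p g = (\<Sum>m\<in>Poly_Mapping.keys p. scale (Poly_Mapping.lookup p m) (monom_diff m g))"

lemma odot_eq: "f \<odot> g = (\<Sum>S\<in>UNIV. poly_diff (coeff f S) (theta_contract S g))"
  by (simp add: odot_def poly_diff_def)

text \<open>Terms of \<open>p\<close> and \<open>q\<close> may cancel in \<open>p + q\<close>; a
  common finite index set makes their sums comparable.\<close>

lemma poly_diff_superset:
  assumes "finite K" "Poly_Mapping.keys p \<subseteq> K"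
  shows "poly_diff p g = (\<Sum>m\<in>K. scale (Poly_Mapping.lookup p m) (monom_diff m g))"
  unfolding poly_diff_def
  by (rule sum.mono_neutral_left) (use assms in \<open>auto simp: in_keys_iff\<close>)

lemma poly_diff_add: "poly_diff (p + q) g = poly_diff p g + poly_diff q g"
proof -
  let ?K = "Poly_Mapping.keys p \<union> Poly_Mapping.keys q"
  have "poly_diff r g = (\<Sum>m\<in>?K. scale (Poly_Mapping.lookup r m) (monom_diff m g))"
    if "r = p \<or> r = q \<or> r = p + q" for r
    by (rule poly_diff_superset) (use that keys_add[of p q] in auto)
  then show ?thesis
    by (simp add: lookup_add superspace.scale_left_distrib sum.distrib)
qed

lemma poly_diff_single: "poly_diff (Poly_Mapping.single m c) g = scale c (monom_diff m g)"
  by (cases "c = 0") (simp_all add: poly_diff_def)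

lemma poly_diff_zero [simp]: "poly_diff 0 g = 0"
  by (simp add: poly_diff_def)

lemma poly_diff_one: "poly_diff 1 g = g"
  using poly_diff_single[of 0 1 g] by (simp add: monom_diff_0)

lemma poly_diff_unit_mult:
  "poly_diff (Poly_Mapping.single (unit_exp i) 1 * p) g = x_diff i (poly_diff p g)"
  by (induction p rule: mpoly_induct)
    (simp_all add: distrib_left poly_diff_add x_diff_add mult_single poly_diff_single
      monom_diff_unit_add[simplified] x_diff_scale)

lemma poly_diff_const_mult: "poly_diff (Poly_Mapping.single 0 c * p) g = scale c (poly_diff p g)"
  by (induction p rule: mpoly_induct)
    (simp_all add: distrib_left poly_diff_add mult_single poly_diff_single superspace.scale_right_distrib)

lemma poly_diff_commute:
  assumes "Vector_Spaces.linear scale scale T" "\<And>i g. T (x_diff i g) = x_diff i (T g)"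
  shows "T (poly_diff p g) = poly_diff p (T g)"
proof -
  interpret T: Vector_Spaces.linear scale scale T by fact
  show ?thesis
    by (simp add: poly_diff_def T.sum T.scale monom_diff_commute[of T, OF assms(2)])
qed

lemma sign_eq_single: "(-1) ^ k = (Poly_Mapping.single 0 ((-1) ^ k) :: 'n mpoly)"
  by (cases "even k") (simp_all add: single_uminus)

lemma odot_add: "(f + g) \<odot> h = f \<odot> h + g \<odot> h"
  by (simp add: odot_eq poly_diff_add sum.distrib)

lemma odot_scale: "scale c f \<odot> g = scale c (f \<odot> g)"
  by (simp add: odot_eq poly_diff_const_mult superspace.scale_sum_right)

lemma odot_one: "1 \<odot> g = g"
proof -
  have "poly_diff (coeff 1 S) (theta_contract S g) = (if S = {} then g else 0)" for S
    by (simp add: theta_contract_def poly_diff_one)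
  then show ?thesis by (simp add: odot_eq)
qed

lemma odot_lin_axis_mult: "(lin (axis i 1) * f) \<odot> g = ddir (axis i 1) (f \<odot> g)"
proof -
  have "(lin (axis i 1) * f) \<odot> g =
      (\<Sum>S\<in>UNIV. ddir (axis i 1) (poly_diff (coeff f S) (theta_contract S g)))"
    by (simp add: odot_eq lin_form_axis poly_diff_unit_mult[simplified] x_diff_eq_ddir)
  also have "\<dots> = ddir (axis i 1) (f \<odot> g)"
    by (simp add: odot_eq ddir.sum)
  finally show ?thesis .
qed

text \<open>Only sets that contain \<open>i\<close> contribute on the left, and they are reindexed
  by removing \<open>i\<close>. The sign of multiplying by \<open>theta i\<close> and that of
  pulling \<open>contract i\<close> out of the sorted composition agree, so their product is
  1.\<close>

lemma odot_dlin_axis_mult: "(dlin (axis i 1) * f) \<odot> g = idir (axis i 1) (f \<odot> g)"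
proof -
  let ?t = "\<lambda>S. contract i (poly_diff (coeff f S) (theta_contract S g))"
  let ?s = "\<lambda>S. (-1) ^ card {j \<in> S. j < i} :: complex"
  have com: "contract i (poly_diff p h) = poly_diff p (contract i h)" for p h
    by (rule poly_diff_commute[OF contract_linear])
      (simp add: contract_eq_idir x_diff_eq_ddir idir_ddir_commute)
  have com': "scale c (poly_diff p h) = poly_diff p (scale c h)" for c p and h :: "'a superspace"
    by (rule poly_diff_commute) (unfold_locales, simp_all add: x_diff_scale superspace.scale_right_distrib mult.commute)
  have "(theta i * f) \<odot> g =
      (\<Sum>S\<in>{S. i \<in> S}. poly_diff (coeff (theta i * f) S) (theta_contract S g))"
    unfolding odot_eq
    by (intro sum.mono_neutral_right) (auto simp: coeff_theta_mult)
  also have "\<dots> = (\<Sum>S\<in>{S. i \<notin> S}. ?t S)"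
  proof (rule sum.reindex_bij_witness[where j = "\<lambda>S. S - {i}" and i = "insert i"])
    fix S assume "S \<in> {S. i \<in> S}"
    then have S: "i \<in> S" "insert i (S - {i}) = S" "i \<notin> S - {i}" by auto
    have "{j \<in> S. j < i} = {j \<in> S - {i}. j < i}" by auto
    then have "coeff (theta i * f) S = Poly_Mapping.single 0 (?s (S - {i})) * coeff f (S - {i})"
      using S(1) by (simp only: coeff_theta_mult sign_eq_single if_True)
    moreover have "theta_contract S g = scale (?s (S - {i})) (contract i (theta_contract (S - {i}) g))"
      using theta_contract_insert[OF S(3), of g] S(2) by simp
    ultimately show "?t (S - {i}) = poly_diff (coeff (theta i * f) S) (theta_contract S g)"
      by (simp add: poly_diff_const_mult com com'[symmetric] power_add[symmetric] mult_2[symmetric])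
  qed auto
  \<comment> \<open>The sets that contain \<open>i\<close> may be added back, since a repeated
    contraction by \<open>i\<close> is zero.\<close>
  also have "\<dots> = (\<Sum>S\<in>UNIV. ?t S)"
    by (rule sum.mono_neutral_left)
      (use com'[of 0 _ 0] in \<open>auto simp: com contract_theta_contract\<close>)
  also have "\<dots> = idir (axis i 1) (f \<odot> g)"
    by (simp add: odot_eq contract_eq_idir idir.sum)
  finally show ?thesis by (simp add: dlin_axis)
qed

lemma odot_zero: "0 \<odot> g = 0"
  using odot_scale[of 0 0 g] by simp

lemma odot_sum: "sum f X \<odot> g = (\<Sum>x\<in>X. f x \<odot> g)"
  by (induction X rule: infinite_finite_induct) (simp_all add: odot_zero odot_add)

text \<open>The action makes superspace a left module over itself: left multiplication by each
  generator is composition with its operator on the outside. Powers of forms thus act as iterated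
  derivatives.\<close>

lemma odot_mult: "(f * h) \<odot> g = f \<odot> (h \<odot> g)"
  by (induction f rule: superspace_induct)
    (simp_all add: odot_one odot_add odot_scale odot_lin_axis_mult odot_dlin_axis_mult distrib_right mult.assoc)

lemma odot_lin: "lin a \<odot> g = ddir a g"
proof -
  have "lin (axis i 1) \<odot> g = x_diff i g" for i
    using odot_lin_axis_mult[of i 1 g] by (simp add: odot_one x_diff_eq_ddir)
  then have "(\<Sum>i\<in>UNIV. scale (a $ i) (lin (axis i 1))) \<odot> g = ddir a g"
    by (simp add: odot_sum odot_scale ddir_def)
  then show ?thesis by (simp only: lin_eq[of a])
qed

lemma odot_dlin: "dlin a \<odot> g = idir a g"
proof -
  have "theta i \<odot> g = contract i g" for i
    using odot_dlin_axis_mult[of i 1 g] by (simp add: odot_one contract_eq_idir dlin_axis)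
  then show ?thesis
    unfolding dlin_eq by (simp add: odot_sum odot_scale idir_def)
qed

lemma odot_lin_power: "lin a ^ k \<odot> g = (ddir a ^^ k) g"
  by (induction k) (simp_all add: odot_one odot_mult odot_lin)

lemma euler_lin_power: "euler (lin a ^ Suc k) = scale (of_nat (Suc k)) (lin a ^ k * dlin a)"
proof -
  have x: "x_diff i (lin a ^ Suc k) = scale (of_nat (Suc k) * a $ i) (lin a ^ k)" for i k
  proof (induction k)
    case 0
    then show ?case using x_diff_lin_mult[of i a 1] by (simp add: x_diff_one)
  next
    case (Suc k)
    have "x_diff i (lin a ^ Suc (Suc k)) =
        scale (a $ i) (lin a ^ Suc k) + lin a * x_diff i (lin a ^ Suc k)"
      unfolding power_Suc[of _ "Suc k"] by (rule x_diff_lin_mult)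
    also have "\<dots> = scale (a $ i + of_nat (Suc k) * a $ i) (lin a ^ Suc k)"
      unfolding Suc superspace.scale_left_distrib by simp
    also have "a $ i + of_nat (Suc k) * a $ i = of_nat (Suc (Suc k)) * a $ i"
      by (simp add: algebra_simps)
    finally show ?case .
  qed
  have "euler (lin a ^ Suc k) = (\<Sum>i\<in>UNIV. scale (of_nat (Suc k)) (lin a ^ k * scale (a $ i) (theta i)))"
    unfolding euler_def x by simp
  also have "\<dots> = scale (of_nat (Suc k)) (lin a ^ k * dlin a)"
    unfolding dlin_eq by (simp only: sum_distrib_left superspace.scale_sum_right)
  finally show ?thesis .
qed

lemma ext_space_odot:
  assumes "g \<in> ext_space A \<alpha>"
  shows "f \<odot> g \<in> ext_space A \<alpha>"
proof (induction f rule: superspace_induct)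
  case (add f h)
  then show ?case
    using superspace.subspace_add[OF ext_space_subspace] by (simp add: odot_add)
next
  case (scale c f)
  then show ?case
    using superspace.subspace_scale[OF ext_space_subspace] by (simp add: odot_scale)
qed (simp_all add: assms odot_one odot_lin_axis_mult odot_dlin_axis_mult ext_space_ddir ext_space_idir)

lemma odot_zero_right: "f \<odot> 0 = 0"
  by (induction f rule: superspace_induct)
    (simp_all add: odot_add odot_scale odot_one odot_lin_axis_mult odot_dlin_axis_mult ddir.zero idir.zero)

text \<open>Up to nonzero scalars, the generators act by the operators that define
  \<open>ext_space\<close>. The step from generators to the ideal uses that \<open>ext_space\<close>
  is stable under the action.\<close>

lemma inverse_system_eq_ext_space:
  fixes \<alpha> :: "'h \<Rightarrow> complex ^ 'n::{finite,linorder}"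
  assumes "\<And>h. h \<in> A \<Longrightarrow> zero_set (\<alpha> h) = hyp h"
  shows "inverse_system (arrangement_ideal A hyp) = ext_space A \<alpha>"
proof -
  have rho: "rho A hyp (vec.span {l}) = line_rank A \<alpha> l" for l
  proof -
    have "vec.span {l} \<subseteq> hyp h \<longleftrightarrow> pair (\<alpha> h) l = 0" if "h \<in> A" for h
    proof -
      have "vec.span {l} \<subseteq> zero_set (\<alpha> h) \<longleftrightarrow> (\<forall>k. k * pair (\<alpha> h) l = 0)"
        unfolding vec.span_singleton zero_set_def pair_def[symmetric]
        by (simp add: image_subset_iff pair_scale_right)
      also have "\<dots> \<longleftrightarrow> pair (\<alpha> h) l = 0"
        by (metis mult_1 mult_zero_right)
      finally show ?thesis using assms[OF that] by simp
    qed
    then show ?thesis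
      unfolding rho_def line_rank_def by (intro arg_cong[where f = card]) auto
  qed
  define gens where "gens = (\<Union>l\<in>{l. l \<noteq> (0 :: complex ^ 'n::{finite,linorder})}. let p = lin l ^ (rho A hyp (vec.span {l}) + 1) in {p, euler p})"
  have ideal: "arrangement_ideal A hyp = is_ideal hull gens"
    by (simp add: arrangement_ideal_def gens_def)
  have gens: "gens = (\<Union>l\<in>{l. l \<noteq> 0}. {lin l ^ Suc (line_rank A \<alpha> l),
      scale (of_nat (Suc (line_rank A \<alpha> l))) (lin l ^ line_rank A \<alpha> l * dlin l)})"
    unfolding gens_def rho Let_def Suc_eq_plus1[symmetric] euler_lin_power ..
  show ?thesis
  proof (intro equalityI subsetI)
    fix g assume g: "g \<in> inverse_system (arrangement_ideal A hyp)"
    have "(ddir l ^^ Suc (line_rank A \<alpha> l)) g = 0 \<and> (ddir l ^^ line_rank A \<alpha> l) (idir l g) = 0" for l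
    proof (cases "l = 0")
      case True
      then show ?thesis
        by (simp add: ddirs.zero ddir_def idir_def)
    next
      case False
      have "f \<odot> g = 0" if "f \<in> gens" for f
        using g hull_inc[OF that, of is_ideal] unfolding inverse_system_def ideal by blast
      from this[of "lin l ^ Suc (line_rank A \<alpha> l)"]
        this[of "scale (of_nat (Suc (line_rank A \<alpha> l))) (lin l ^ line_rank A \<alpha> l * dlin l)"]
      have "lin l ^ Suc (line_rank A \<alpha> l) \<odot> g = 0"
        "scale (of_nat (Suc (line_rank A \<alpha> l))) (lin l ^ line_rank A \<alpha> l * dlin l) \<odot> g = 0"
        using False unfolding gens by blast+
      then show ?thesis
        unfolding odot_scale odot_mult odot_lin_power odot_dlin superspace.scale_eq_0_iff of_nat_eq_0_iff
        by blast
    qed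
    then show "g \<in> ext_space A \<alpha>" by (simp add: ext_space_def del: funpow.simps)
  next
    fix g assume g: "g \<in> ext_space A \<alpha>"
    \<comment> \<open>The annihilator of the whole space, not of \<open>g\<close> alone: for
      \<open>f * h\<close> to annihilate \<open>g\<close>, \<open>f\<close> has to kill
      \<open>h \<odot> g\<close>, which again lies in the space. Hence \<open>K\<close> is a
      two-sided ideal.\<close>
    define K where "K = {f. \<forall>g\<in>ext_space A \<alpha>. f \<odot> g = 0}"
    have "gens \<subseteq> K"
      unfolding gens K_def ext_space_def
      by (auto simp: odot_scale odot_mult odot_lin_power odot_dlin simp del: power_Suc funpow.simps of_nat_Suc)
    moreover have "is_ideal K"
      unfolding is_ideal_def K_def
      by (auto simp: odot_zero odot_add odot_mult odot_zero_right ext_space_odot)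
    ultimately have "is_ideal hull gens \<subseteq> K"
      by (rule hull_minimal)
    then show "g \<in> inverse_system (arrangement_ideal A hyp)"
      using g unfolding ideal K_def inverse_system_def by blast
  qed
qed


section \<open>Bases and activities under deletion and contraction\<close>

definition indep_family :: "('h \<Rightarrow> complex ^ 'n::finite) \<Rightarrow> 'h set \<Rightarrow> bool" where
  "indep_family \<alpha> B \<longleftrightarrow> inj_on \<alpha> B \<and> vec.independent (\<alpha> ` B)"

lemma basis_iff:
  "basis A \<alpha> B \<longleftrightarrow> B \<subseteq> A \<and> indep_family \<alpha> B \<and> (\<forall>k\<in>A. \<alpha> k \<in> vec.span (\<alpha> ` B))"
proof -
  have "vec.span (\<alpha> ` B) = vec.span (\<alpha> ` A) \<longleftrightarrow> (\<forall>k\<in>A. \<alpha> k \<in> vec.span (\<alpha> ` B))" if "B \<subseteq> A"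
  proof
    assume "\<forall>k\<in>A. \<alpha> k \<in> vec.span (\<alpha> ` B)"
    then have "vec.span (\<alpha> ` A) \<subseteq> vec.span (\<alpha> ` B)"
      by (intro vec.span_minimal) (auto simp: vec.subspace_span)
    moreover have "vec.span (\<alpha> ` B) \<subseteq> vec.span (\<alpha> ` A)"
      using that by (intro vec.span_mono) auto
    ultimately show "vec.span (\<alpha> ` B) = vec.span (\<alpha> ` A)" by auto
  next
    assume "vec.span (\<alpha> ` B) = vec.span (\<alpha> ` A)"
    then show "\<forall>k\<in>A. \<alpha> k \<in> vec.span (\<alpha> ` B)" by (simp add: vec.span_base)
  qed
  then show ?thesis by (auto simp: basis_def indep_family_def)
qed

lemma indep_family_insert:
  "h \<notin> B \<Longrightarrow> indep_family \<alpha> (insert h B) \<longleftrightarrow> indep_family \<alpha> B \<and> \<alpha> h \<notin> vec.span (\<alpha> ` B)"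
  by (cases "\<alpha> h \<in> \<alpha> ` B") (auto simp: indep_family_def vec.independent_insert vec.span_base)

lemma card_basis_eq:
  assumes "basis A \<alpha> B" "basis A \<alpha> C"
  shows "card B = card C"
proof -
  have "card D = vec.dim (\<alpha> ` A)" if "basis A \<alpha> D" for D
    using that vec.dim_span_eq_card_independent[of "\<alpha> ` D"]
    by (simp add: basis_def card_image)
  then show ?thesis using assms by simp
qed

text \<open>The condition on the right says that \<open>b\<close> occurs in the expansion of
  \<open>\<alpha> e\<close> over \<open>B\<close>, that is, \<open>b\<close> lies on the fundamental
  circuit of \<open>e\<close>. Circuits and cocircuits enter below only in this form.\<close>

lemma basis_exchange:
  assumes "basis A \<alpha> B" "b \<in> B" "e \<in> A" "e \<notin> B"
  shows "basis A \<alpha> (insert e (B - {b})) \<longleftrightarrow> \<alpha> e \<notin> vec.span (\<alpha> ` (B - {b}))"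
proof
  assume "basis A \<alpha> (insert e (B - {b}))"
  then show "\<alpha> e \<notin> vec.span (\<alpha> ` (B - {b}))"
    using assms(4) indep_family_insert[of e "B - {b}" \<alpha>] by (simp add: basis_iff)
next
  assume e: "\<alpha> e \<notin> vec.span (\<alpha> ` (B - {b}))"
  have B: "insert b (B - {b}) = B" using assms(2) by auto
  have "\<alpha> e \<in> vec.span (insert (\<alpha> b) (\<alpha> ` (B - {b})))"
    using assms(1,3) B by (metis basis_iff image_insert)
  then have "\<alpha> b \<in> vec.span (insert (\<alpha> e) (\<alpha> ` (B - {b})))"
    using e by (rule vec.in_span_insert)
  then have "\<alpha> ` B \<subseteq> vec.span (\<alpha> ` insert e (B - {b}))"
    using vec.span_superset[of "\<alpha> ` insert e (B - {b})"] by auto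
  then have "vec.span (\<alpha> ` B) \<subseteq> vec.span (\<alpha> ` insert e (B - {b}))"
    by (rule vec.span_minimal) (rule vec.subspace_span)
  moreover have "indep_family \<alpha> (insert e (B - {b}))"
    using e assms indep_family_insert[of e "B - {b}" \<alpha>] indep_family_insert[of b "B - {b}" \<alpha>] B
    by (simp add: basis_iff)
  ultimately show "basis A \<alpha> (insert e (B - {b}))"
    using assms unfolding basis_iff by blast
qed

text \<open>Take a smallest \<open>C \<subseteq> B\<close> whose span contains \<open>x\<close>,
  nonempty as \<open>x \<noteq> 0\<close>, and any \<open>b\<close> in it. If \<open>x\<close> were
  in the span of \<open>B - {b}\<close>, exchanging \<open>b\<close> with \<open>x\<close> would put
  \<open>\<alpha> b\<close> there too, against independence.\<close>

lemma nonzero_exchange: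
  assumes "finite B" "indep_family \<alpha> B" "x \<in> vec.span (\<alpha> ` B)" "x \<noteq> 0"
  obtains b where "b \<in> B" "x \<notin> vec.span (\<alpha> ` (B - {b}))"
proof -
  define C where "C = (ARG_MIN card C. C \<subseteq> B \<and> x \<in> vec.span (\<alpha> ` C))"
  have C: "C \<subseteq> B" "x \<in> vec.span (\<alpha> ` C)"
    and min: "\<And>D. D \<subseteq> B \<Longrightarrow> x \<in> vec.span (\<alpha> ` D) \<Longrightarrow> card C \<le> card D"
    using arg_min_nat_lemma[of "\<lambda>C. C \<subseteq> B \<and> x \<in> vec.span (\<alpha> ` C)" B card] assms(3)
    unfolding C_def by auto
  have fin: "finite C" using C(1) assms(1) by (rule finite_subset)
  have "C \<noteq> {}" using C(2) assms(4) by auto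
  then obtain b where b: "b \<in> C" by auto
  then have "card (C - {b}) < card C" by (rule card_Diff1_less[OF fin])
  then have "x \<notin> vec.span (\<alpha> ` (C - {b}))" using min[of "C - {b}"] C(1) by auto
  moreover have "insert (\<alpha> b) (\<alpha> ` (C - {b})) = \<alpha> ` C" using b by auto
  then have "x \<in> vec.span (insert (\<alpha> b) (\<alpha> ` (C - {b})))"
    using C(2) \<open>insert (\<alpha> b) (\<alpha> ` (C - {b})) = \<alpha> ` C\<close> by simp
  ultimately have "\<alpha> b \<in> vec.span (insert x (\<alpha> ` (C - {b})))"
    by (rule vec.in_span_insert[rotated])
  moreover have "insert x (\<alpha> ` (C - {b})) \<subseteq> vec.span (\<alpha> ` (B - {b}))" if "x \<in> vec.span (\<alpha> ` (B - {b}))"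
    using that C(1) vec.span_superset[of "\<alpha> ` (B - {b})"] by auto
  ultimately have "x \<in> vec.span (\<alpha> ` (B - {b})) \<Longrightarrow> \<alpha> b \<in> vec.span (\<alpha> ` (B - {b}))"
    by (meson subsetD vec.span_minimal vec.subspace_span)
  moreover have "\<alpha> b \<notin> vec.span (\<alpha> ` (B - {b}))"
    using assms(2) b C(1) indep_family_insert[of b "B - {b}" \<alpha>] by (auto simp: insert_absorb)
  ultimately show ?thesis using that b C(1) by blast
qed

section \<open>Activities through fundamental circuits and cocircuits\<close>

lemma insort_mono:
  fixes x y :: "'h::linorder"
  assumes "x \<le> y" "sorted zs"
  shows "insort x zs \<le> insort y zs"
  using assms(2,1) by (induction zs) (auto simp: insort_is_Cons less_le_not_le)

text \<open>Both sorted lists arise by inserting one element into the list of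
  \<open>B - {b}\<close>, and insertion is monotone in the inserted element.\<close>

lemma lex_le_exchange:
  fixes B :: "'h::linorder set"
  assumes "finite B" "b \<in> B" "e \<notin> B"
  shows "lex_le B (insert e (B - {b})) \<longleftrightarrow> b < e" "lex_le (insert e (B - {b})) B \<longleftrightarrow> e < b"
proof -
  have B: "sorted_list_of_set B = insort b (sorted_list_of_set (B - {b}))"
    and C: "sorted_list_of_set (insert e (B - {b})) = insort e (sorted_list_of_set (B - {b}))"
    using assms sorted_list_of_set_insert[of "B - {b}" b] by (auto simp: insert_absorb)
  have "B \<noteq> insert e (B - {b})" using assms by auto
  then have "insort b (sorted_list_of_set (B - {b})) \<noteq> insort e (sorted_list_of_set (B - {b}))"
    unfolding B[symmetric] C[symmetric] using assms(1) sorted_list_of_set_inject[of B "insert e (B - {b})"] by blast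
  moreover have "b < e \<or> e < b" using assms(2,3) linorder_less_linear[of b e] by blast
  ultimately have "(insort b (sorted_list_of_set (B - {b})) \<le> insort e (sorted_list_of_set (B - {b})) \<longleftrightarrow> b < e) \<and>
      (insort e (sorted_list_of_set (B - {b})) \<le> insort b (sorted_list_of_set (B - {b})) \<longleftrightarrow> e < b)"
    using insort_mono[of b e "sorted_list_of_set (B - {b})"] insort_mono[of e b "sorted_list_of_set (B - {b})"]
    by fastforce
  then show "lex_le B (insert e (B - {b})) \<longleftrightarrow> b < e" "lex_le (insert e (B - {b})) B \<longleftrightarrow> e < b"
    unfolding lex_le_def B C by blast+
qed

text \<open>All bases have the same size, so those containing \<open>B - {b}\<close> are
  \<open>B\<close> and its exchanges of \<open>b\<close>. Internal activity thus means that
  \<open>b\<close> is the smallest element of its fundamental cocircuit.\<close>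

lemma IA_iff:
  fixes A :: "'h::linorder set"
  assumes "finite A" "basis A \<alpha> B"
  shows "b \<in> IA A \<alpha> B \<longleftrightarrow> b \<in> B \<and> (\<forall>e\<in>A - B. \<alpha> e \<notin> vec.span (\<alpha> ` (B - {b})) \<longrightarrow> b < e)"
proof -
  have fin: "finite B" using assms by (auto simp: basis_def dest: finite_subset)
  have "(\<forall>C. basis A \<alpha> C \<and> B - {b} \<subseteq> C \<longrightarrow> lex_le B C) \<longleftrightarrow>
      (\<forall>e\<in>A - B. \<alpha> e \<notin> vec.span (\<alpha> ` (B - {b})) \<longrightarrow> b < e)" (is "?L \<longleftrightarrow> ?R") if b: "b \<in> B"
  proof
    assume L: ?L
    show ?R
    proof (intro ballI impI)
      fix e assume e: "e \<in> A - B" "\<alpha> e \<notin> vec.span (\<alpha> ` (B - {b}))"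
      then have "basis A \<alpha> (insert e (B - {b}))"
        using basis_exchange[OF assms(2) b, of e] by simp
      then show "b < e"
        using L lex_le_exchange(1)[OF fin b, of e] e by auto
    qed
  next
    assume R: ?R
    show ?L
    proof (intro allI impI)
      fix C assume C: "basis A \<alpha> C \<and> B - {b} \<subseteq> C"
      then have finC: "finite C" using assms(1) by (auto simp: basis_def dest: finite_subset)
      have "card C = card B" using C assms(2) card_basis_eq by blast
      moreover have "card (C - (B - {b})) = card C - card (B - {b})"
        using C fin by (intro card_Diff_subset) auto
      moreover have "card B > 0" using fin b card_gt_0_iff by blast
      ultimately have "card (C - (B - {b})) = 1"
        using b fin by simp
      then obtain e where "C - (B - {b}) = {e}" by (auto simp: card_1_singleton_iff)
      then have e: "C = insert e (B - {b})" "e \<notin> B - {b}" using C by auto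
      show "lex_le B C"
      proof (cases "e = b")
        case True
        then have "C = B" using e b by auto
        then show ?thesis by (simp add: lex_le_def)
      next
        case False
        then have "e \<in> A - B" using e C by (auto simp: basis_def)
        then show ?thesis
          using R basis_exchange[OF assms(2) b, of e] lex_le_exchange(1)[OF fin b, of e] e C by auto
      qed
    qed
  qed
  then show ?thesis unfolding IA_def by blast
qed

text \<open>A basis inside \<open>B \<union> {e}\<close> other than \<open>B\<close> exchanges
  \<open>e\<close> for some \<open>b\<close> and is larger exactly if \<open>b < e\<close>. So
  \<open>e\<close> is passive if its fundamental circuit contains a smaller element.\<close>

lemma EP_iff:
  fixes A :: "'h::linorder set"
  assumes "finite A" "basis A \<alpha> B"
  shows "e \<in> EP A \<alpha> B \<longleftrightarrow> e \<in> A - B \<and> (\<exists>b\<in>B. \<alpha> e \<notin> vec.span (\<alpha> ` (B - {b})) \<and> b < e)"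
proof -
  have fin: "finite B" using assms by (auto simp: basis_def dest: finite_subset)
  have "(\<exists>C. basis A \<alpha> C \<and> C \<subseteq> B \<union> {e} \<and> \<not> lex_le C B) \<longleftrightarrow>
      (\<exists>b\<in>B. \<alpha> e \<notin> vec.span (\<alpha> ` (B - {b})) \<and> b < e)" (is "?L \<longleftrightarrow> ?R") if e: "e \<in> A" "e \<notin> B"
  proof
    assume ?L
    then obtain C where C: "basis A \<alpha> C" "C \<subseteq> B \<union> {e}" "\<not> lex_le C B" by blast
    have "C \<noteq> B" using C(3) by (auto simp: lex_le_def)
    have card: "card C = card B" using C(1) assms(2) by (rule card_basis_eq)
    have "e \<in> C"
    proof (rule ccontr)
      assume "e \<notin> C"
      then have "C \<subseteq> B" using C(2) by auto
      then show False using card fin \<open>C \<noteq> B\<close> by (metis card_subset_eq)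
    qed
    \<comment> \<open>\<open>B \<union> {e}\<close> has one element more than a basis, so
      \<open>C\<close> omits exactly one element, the exchanged \<open>b\<close>.\<close>
    have "card (B \<union> {e} - C) = card (B \<union> {e}) - card C"
      using C(2) fin finite_subset by (intro card_Diff_subset) auto
    then have "card (B \<union> {e} - C) = 1" using card fin e by simp
    then obtain b where b: "B \<union> {e} - C = {b}" by (auto simp: card_1_singleton_iff)
    then have "b \<in> B" "C = insert e (B - {b})" using \<open>e \<in> C\<close> C(2) by auto
    then show ?R
      using basis_exchange[OF assms(2) _ e] lex_le_exchange(2)[OF fin _ e(2)] C
      by (metis e(2) linorder_cases)
  next
    assume ?R
    then obtain b where b: "b \<in> B" "\<alpha> e \<notin> vec.span (\<alpha> ` (B - {b}))" "b < e" by blast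
    show ?L
      using b basis_exchange[OF assms(2) b(1) e] lex_le_exchange(2)[OF fin b(1) e(2)]
      by (intro exI[of _ "insert e (B - {b})"]) auto
  qed
  then show ?thesis unfolding EP_def by blast
qed

lemma proj_form_linear: "Vector_Spaces.linear (*s) (*s) (proj_form a v)"
  by unfold_locales
    (simp_all add: proj_form_def pair_add_left pair_scale_left vec.scale_left_distrib
      vec.scale_right_diff_distrib vec.scale_right_distrib)

text \<open>The projection has kernel spanned by \<open>a\<close>, so it tests membership in a span
  modulo \<open>a\<close>; this is contraction of the matroid.\<close>

lemma proj_form_in_span_iff:
  assumes "pair a v = 1"
  shows "proj_form a v x \<in> vec.span (proj_form a v ` S) \<longleftrightarrow> x \<in> vec.span (insert a S)"
proof
  assume "proj_form a v x \<in> vec.span (proj_form a v ` S)"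
  then obtain s where s: "s \<in> vec.span S" "proj_form a v x = proj_form a v s"
    unfolding vec.linear_span_image[OF proj_form_linear] by auto
  then have "x = s + (pair x v - pair s v) *s a"
    by (simp add: proj_form_def vec.scale_left_diff_distrib algebra_simps)
  moreover have "s \<in> vec.span (insert a S)"
    using s(1) vec.span_mono[of S "insert a S"] by auto
  ultimately show "x \<in> vec.span (insert a S)"
    by (metis insertI1 vec.span_add vec.span_base vec.span_scale)
next
  assume "x \<in> vec.span (insert a S)"
  then obtain k where "x - k *s a \<in> vec.span S"
    by (auto simp: vec.span_breakdown_eq)
  then have "proj_form a v (x - k *s a) \<in> vec.span (proj_form a v ` S)"
    unfolding vec.linear_span_image[OF proj_form_linear] by (rule imageI)
  moreover have "proj_form a v (x - k *s a) = proj_form a v x"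
    using assms by (simp add: proj_form_def pair_diff_left pair_scale_left vec.scale_left_diff_distrib)
  ultimately show "proj_form a v x \<in> vec.span (proj_form a v ` S)" by simp
qed

section \<open>Bases and activities when a largest element is added\<close>

context
  fixes A :: "'h::linorder set" and h :: 'h and \<alpha> :: "'h \<Rightarrow> complex ^ 'n::finite"
  assumes fin: "finite A" and less_h: "\<forall>k\<in>A. k < h"
begin

lemma h_notin: "h \<notin> A"
  using less_h by blast

lemma basis_delete:
  assumes "\<alpha> h \<in> vec.span (\<alpha> ` A)" "h \<notin> B"
  shows "basis (insert h A) \<alpha> B \<longleftrightarrow> basis A \<alpha> B"
proof -
  have "\<alpha> h \<in> vec.span (\<alpha> ` B)" if "\<forall>k\<in>A. \<alpha> k \<in> vec.span (\<alpha> ` B)"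
  proof -
    have "vec.span (\<alpha> ` A) \<subseteq> vec.span (\<alpha> ` B)"
      using that by (intro vec.span_minimal) (auto simp: vec.subspace_span)
    then show ?thesis using assms(1) by auto
  qed
  then show ?thesis using assms(2) unfolding basis_iff by auto
qed

text \<open>Every element of \<open>B\<close> is below \<open>h\<close>, so \<open>h\<close> is
  passive as soon as its circuit meets \<open>B\<close>, which holds because its form is nonzero.
  For the internal activity of \<open>b\<close>, the new element only adds the true condition
  \<open>b < h\<close>.\<close>

lemma delete_activities:
  assumes "\<alpha> h \<in> vec.span (\<alpha> ` A)" "\<alpha> h \<noteq> 0" "basis A \<alpha> B"
  shows "EP (insert h A) \<alpha> B = insert h (EP A \<alpha> B)" "IA (insert h A) \<alpha> B = IA A \<alpha> B"
proof -
  have B: "B \<subseteq> A" "h \<notin> B" "finite B"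
    using assms(3) h_notin fin by (auto simp: basis_def dest: finite_subset)
  have basis: "basis (insert h A) \<alpha> B" using basis_delete[OF assms(1) B(2)] assms(3) by simp
  have "\<alpha> h \<in> vec.span (\<alpha> ` B)" using basis by (simp add: basis_iff)
  then obtain b where b: "b \<in> B" "\<alpha> h \<notin> vec.span (\<alpha> ` (B - {b}))"
    using nonzero_exchange[OF B(3) _ _ assms(2)] assms(3) by (auto simp: basis_iff)
  have lt: "b < h" if "b \<in> B" for b using that B less_h by auto
  show "EP (insert h A) \<alpha> B = insert h (EP A \<alpha> B)"
    using b lt B EP_iff[OF _ basis] EP_iff[OF fin assms(3)] fin by auto
  show "IA (insert h A) \<alpha> B = IA A \<alpha> B"
    using B lt IA_iff[OF _ basis] IA_iff[OF fin assms(3)] fin by auto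
qed

text \<open>The zero form lies in every span: \<open>h\<close> belongs to no basis, has no elements
  of \<open>B\<close> on its circuit, and lies on no fundamental cocircuit.\<close>

lemma loop_activities:
  assumes "\<alpha> h = 0"
  shows "basis (insert h A) \<alpha> B \<longleftrightarrow> basis A \<alpha> B"
    and "basis A \<alpha> B \<Longrightarrow> EP (insert h A) \<alpha> B = EP A \<alpha> B"
    and "basis A \<alpha> B \<Longrightarrow> IA (insert h A) \<alpha> B = IA A \<alpha> B"
proof -
  have "h \<notin> B" if "basis (insert h A) \<alpha> B"
    using that assms vec.dependent_zero[of "\<alpha> ` B"] by (auto simp: basis_def)
  then show *: "basis (insert h A) \<alpha> B \<longleftrightarrow> basis A \<alpha> B"
    using basis_delete[of B] assms vec.span_zero h_notin by (auto simp: basis_def)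
  assume B: "basis A \<alpha> B"
  then have "h \<notin> B" using h_notin by (auto simp: basis_def)
  show "EP (insert h A) \<alpha> B = EP A \<alpha> B"
    using EP_iff[of "insert h A" \<alpha> B] EP_iff[OF fin B] fin B * assms \<open>h \<notin> B\<close> by (auto simp: vec.span_zero)
  show "IA (insert h A) \<alpha> B = IA A \<alpha> B"
    using IA_iff[of "insert h A" \<alpha> B] IA_iff[OF fin B] fin B * assms \<open>h \<notin> B\<close> by (auto simp: vec.span_zero)
qed

text \<open>If \<open>h\<close> helped to express \<open>\<alpha> k\<close>, exchanging the two
  would put \<open>\<alpha> h\<close> into the span of \<open>A\<close>.\<close>

lemma coloop_span_iff:
  assumes "\<alpha> h \<notin> vec.span (\<alpha> ` A)" "k \<in> A" "S \<subseteq> A"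
  shows "\<alpha> k \<in> vec.span (\<alpha> ` insert h S) \<longleftrightarrow> \<alpha> k \<in> vec.span (\<alpha> ` S)"
proof
  assume k: "\<alpha> k \<in> vec.span (\<alpha> ` insert h S)"
  show "\<alpha> k \<in> vec.span (\<alpha> ` S)"
  proof (rule ccontr)
    assume "\<alpha> k \<notin> vec.span (\<alpha> ` S)"
    then have "\<alpha> h \<in> vec.span (insert (\<alpha> k) (\<alpha> ` S))"
      using k by (intro vec.in_span_insert[of "\<alpha> k" "\<alpha> h"]) auto
    moreover have "vec.span (insert (\<alpha> k) (\<alpha> ` S)) \<subseteq> vec.span (\<alpha> ` A)"
      using assms by (intro vec.span_mono) auto
    ultimately show False using assms(1) by auto
  qed
next
  assume "\<alpha> k \<in> vec.span (\<alpha> ` S)"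
  then show "\<alpha> k \<in> vec.span (\<alpha> ` insert h S)"
    using vec.span_mono[of "\<alpha> ` S" "\<alpha> ` insert h S"] by auto
qed

lemma coloop_mem_basis:
  assumes "\<alpha> h \<notin> vec.span (\<alpha> ` A)" "basis (insert h A) \<alpha> B"
  shows "h \<in> B"
proof (rule ccontr)
  assume "h \<notin> B"
  then have "\<alpha> ` B \<subseteq> \<alpha> ` A" using assms(2) by (auto simp: basis_def)
  then have "vec.span (\<alpha> ` B) \<subseteq> vec.span (\<alpha> ` A)" by (rule vec.span_mono)
  then show False using assms by (auto simp: basis_iff)
qed

lemma basis_coloop:
  assumes "\<alpha> h \<notin> vec.span (\<alpha> ` A)" "B \<subseteq> A"
  shows "basis (insert h A) \<alpha> (insert h B) \<longleftrightarrow> basis A \<alpha> B"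
proof -
  have "h \<notin> B" using assms(2) h_notin by auto
  moreover have "\<alpha> h \<notin> vec.span (\<alpha> ` B)"
    using assms vec.span_mono[of "\<alpha> ` B" "\<alpha> ` A"] by auto
  moreover have "\<alpha> h \<in> vec.span (\<alpha> ` insert h B)" by (intro vec.span_base) auto
  ultimately show ?thesis
    using assms coloop_span_iff[OF assms(1) _ assms(2)] by (auto simp: basis_iff indep_family_insert)
qed

text \<open>A coloop is on no circuit, so it makes no element passive; its cocircuit is
  \<open>{h}\<close>, so it is internally active itself.\<close>

lemma coloop_activities:
  assumes "\<alpha> h \<notin> vec.span (\<alpha> ` A)" "basis A \<alpha> B"
  shows "EP (insert h A) \<alpha> (insert h B) = EP A \<alpha> B"
    "IA (insert h A) \<alpha> (insert h B) = insert h (IA A \<alpha> B)"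
proof -
  have B: "B \<subseteq> A" "h \<notin> B" using assms(2) h_notin by (auto simp: basis_def)
  have basis: "basis (insert h A) \<alpha> (insert h B)"
    using basis_coloop[OF assms(1) B(1)] assms(2) by simp
  have ex: "\<alpha> k \<in> vec.span (\<alpha> ` (insert h B - {b})) \<longleftrightarrow> \<alpha> k \<in> vec.span (\<alpha> ` (B - {b}))"
    if "k \<in> A" "b \<in> B" for k b
  proof -
    have "insert h B - {b} = insert h (B - {b})" using that B by auto
    then show ?thesis using coloop_span_iff[OF assms(1) that(1), of "B - {b}"] B by auto
  qed
  have "insert h B - {h} = B" using B by auto
  then have exh: "\<alpha> k \<in> vec.span (\<alpha> ` (insert h B - {h}))" if "k \<in> A" for k
    using assms(2) that by (simp add: basis_iff)
  have A: "insert h A - insert h B = A - B" using B h_notin by auto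
  show "EP (insert h A) \<alpha> (insert h B) = EP A \<alpha> B"
    unfolding set_eq_iff EP_iff[OF fin assms(2)] EP_iff[OF finite.insertI[OF fin] basis] A
    using ex exh by blast
  show "IA (insert h A) \<alpha> (insert h B) = insert h (IA A \<alpha> B)"
    unfolding set_eq_iff insert_iff IA_iff[OF fin assms(2)] IA_iff[OF finite.insertI[OF fin] basis] A
    using ex exh by blast
qed

context
  fixes v
  assumes v: "pair (\<alpha> h) v = 1"
begin

lemma contract_span_iff:
  "proj_form (\<alpha> h) v (\<alpha> k) \<in> vec.span ((\<lambda>k. proj_form (\<alpha> h) v (\<alpha> k)) ` S) \<longleftrightarrow>
     \<alpha> k \<in> vec.span (\<alpha> ` insert h S)"
  using proj_form_in_span_iff[OF v, of "\<alpha> k" "\<alpha> ` S"] by (simp add: image_image)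

lemma indep_family_contract:
  assumes "finite B" "h \<notin> B"
  shows "indep_family (\<lambda>k. proj_form (\<alpha> h) v (\<alpha> k)) B \<longleftrightarrow> indep_family \<alpha> (insert h B)"
  using assms
proof (induction B rule: finite_induct)
  case empty
  have "\<alpha> h \<noteq> 0" using v by (auto simp: pair_def)
  then show ?case by (simp add: indep_family_def vec.independent_empty)
next
  case (insert b B)
  have "indep_family \<alpha> (insert h (insert b B)) \<longleftrightarrow>
      indep_family \<alpha> (insert h B) \<and> \<alpha> b \<notin> vec.span (\<alpha> ` insert h B)"
    using insert indep_family_insert[of b "insert h B" \<alpha>] by (auto simp: insert_commute)
  then show ?case
    using insert contract_span_iff[of b B] indep_family_insert[of b B "\<lambda>k. proj_form (\<alpha> h) v (\<alpha> k)"] by simp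
qed

lemma basis_contract:
  assumes "B \<subseteq> A"
  shows "basis (insert h A) \<alpha> (insert h B) \<longleftrightarrow> basis A (\<lambda>k. proj_form (\<alpha> h) v (\<alpha> k)) B"
proof -
  have "finite B" "h \<notin> B" using assms h_notin fin by (auto dest: finite_subset)
  moreover have "\<alpha> h \<in> vec.span (\<alpha> ` insert h B)" by (intro vec.span_base) auto
  ultimately show ?thesis
    using assms unfolding basis_iff contract_span_iff by (auto simp: indep_family_contract)
qed

text \<open>Spans modulo \<open>\<alpha> h\<close> give the same exchanges for the elements of
  \<open>B\<close>, and the maximal \<open>h\<close> is never the smaller element that makes another
  one passive. As every other element is below \<open>h\<close>, internal activity of
  \<open>h\<close> forces all of \<open>A\<close> into the span of \<open>B\<close>, which says that
  \<open>h\<close> is a coloop.\<close>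

lemma contract_activities:
  assumes "basis A (\<lambda>k. proj_form (\<alpha> h) v (\<alpha> k)) B"
  shows "EP (insert h A) \<alpha> (insert h B) = EP A (\<lambda>k. proj_form (\<alpha> h) v (\<alpha> k)) B"
    "IA (insert h A) \<alpha> (insert h B) =
       (if \<alpha> h \<in> vec.span (\<alpha> ` A) then {} else {h}) \<union> IA A (\<lambda>k. proj_form (\<alpha> h) v (\<alpha> k)) B"
proof -
  let ?\<beta> = "\<lambda>k. proj_form (\<alpha> h) v (\<alpha> k)"
  have B: "B \<subseteq> A" "h \<notin> B" using assms h_notin by (auto simp: basis_def)
  have basis: "basis (insert h A) \<alpha> (insert h B)"
    using basis_contract[OF B(1)] assms by simp
  have ex: "\<alpha> k \<in> vec.span (\<alpha> ` (insert h B - {b})) \<longleftrightarrow> ?\<beta> k \<in> vec.span (?\<beta> ` (B - {b}))"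
    if "b \<in> B" for k b
  proof -
    have "insert h B - {b} = insert h (B - {b})" using that B by auto
    then show ?thesis using contract_span_iff[of k "B - {b}"] by simp
  qed
  have A: "insert h A - insert h B = A - B" using B h_notin by auto
  show "EP (insert h A) \<alpha> (insert h B) = EP A ?\<beta> B"
    unfolding set_eq_iff EP_iff[OF fin assms] EP_iff[OF finite.insertI[OF fin] basis] A
    using ex less_h by (metis Diff_iff insert_iff order.asym)
  have IA: "b \<in> IA (insert h A) \<alpha> (insert h B) \<longleftrightarrow> b \<in> IA A ?\<beta> B" if "b \<in> B" for b
    unfolding IA_iff[OF fin assms] IA_iff[OF finite.insertI[OF fin] basis] A
    using ex that by blast
  have "h \<in> IA (insert h A) \<alpha> (insert h B) \<longleftrightarrow> (\<forall>e\<in>A - B. \<alpha> e \<in> vec.span (\<alpha> ` B))"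
    unfolding IA_iff[OF finite.insertI[OF fin] basis] A
    using B less_h by (auto simp: insert_Diff_if dest: order.asym)
  also have "\<dots> \<longleftrightarrow> \<alpha> h \<notin> vec.span (\<alpha> ` A)"
  proof
    assume L: "\<forall>e\<in>A - B. \<alpha> e \<in> vec.span (\<alpha> ` B)"
    then have "\<alpha> ` A \<subseteq> vec.span (\<alpha> ` B)"
      using vec.span_base[of _ "\<alpha> ` B"] by blast
    then have "vec.span (\<alpha> ` A) \<subseteq> vec.span (\<alpha> ` B)"
      by (rule vec.span_minimal) (rule vec.subspace_span)
    moreover have "\<alpha> h \<notin> vec.span (\<alpha> ` B)"
      using basis B by (simp add: basis_iff indep_family_insert)
    ultimately show "\<alpha> h \<notin> vec.span (\<alpha> ` A)" by auto
  next
    assume "\<alpha> h \<notin> vec.span (\<alpha> ` A)"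
    then have "basis A \<alpha> B" using basis_coloop[OF _ B(1)] basis by simp
    then show "\<forall>e\<in>A - B. \<alpha> e \<in> vec.span (\<alpha> ` B)" by (simp add: basis_iff)
  qed
  finally have h: "h \<in> IA (insert h A) \<alpha> (insert h B) \<longleftrightarrow> \<alpha> h \<notin> vec.span (\<alpha> ` A)" .
  have sub: "IA (insert h A) \<alpha> (insert h B) \<subseteq> insert h B" "IA A ?\<beta> B \<subseteq> B"
    by (auto simp: IA_def)
  show "IA (insert h A) \<alpha> (insert h B) = (if \<alpha> h \<in> vec.span (\<alpha> ` A) then {} else {h}) \<union> IA A ?\<beta> B"
    using sub IA h B by (auto split: if_splits)
qed

end

end


section \<open>Gluing families of monomials\<close>

text \<open>Indexed families instead of sets allow the three kinds of monomials to be glued by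
  reindexing, before it is known that different indices give different elements.\<close>

definition family_basis :: "'j set \<Rightarrow> ('j \<Rightarrow> 'n superspace) \<Rightarrow> 'n::{finite,linorder} superspace set \<Rightarrow> bool" where
  "family_basis J m P \<longleftrightarrow> finite J \<and> m ` J \<subseteq> P \<and>
     (\<forall>c. (\<Sum>j\<in>J. scale (c j) (m j)) = 0 \<longrightarrow> (\<forall>j\<in>J. c j = 0)) \<and>
     (\<forall>g\<in>P. \<exists>c. g = (\<Sum>j\<in>J. scale (c j) (m j)))"

text \<open>Equal values at two indices would give the relation \<open>m i - m j = 0\<close>, so
  independence of the family includes injectivity, and sums over indices become sums over the
  image.\<close>

lemma family_basis_imp_basis:
  assumes "family_basis J m P" "superspace.subspace P"
  shows "superspace.independent (m ` J) \<and> superspace.span (m ` J) = P"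
proof
  have J: "finite J" "m ` J \<subseteq> P"
    and ind: "\<And>c. (\<Sum>j\<in>J. scale (c j) (m j)) = 0 \<Longrightarrow> \<forall>j\<in>J. c j = 0"
    and span: "\<And>g. g \<in> P \<Longrightarrow> \<exists>c. g = (\<Sum>j\<in>J. scale (c j) (m j))"
    using assms(1) unfolding family_basis_def by auto
  have inj: "inj_on m J"
  proof (rule inj_onI, rule ccontr)
    fix i j assume ij: "i \<in> J" "j \<in> J" "m i = m j" "i \<noteq> j"
    let ?c = "\<lambda>k. if k = i then 1 else if k = j then -1 else 0 :: complex"
    have "(\<Sum>k\<in>J. scale (?c k) (m k)) = (\<Sum>k\<in>{i, j}. scale (?c k) (m k))"
      using J ij by (intro sum.mono_neutral_right) auto
    also have "\<dots> = 0" using ij by simp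
    finally have "\<forall>k\<in>J. ?c k = 0" by (rule ind)
    then show False using ij(1) by auto
  qed
  show "superspace.independent (m ` J)"
  proof
    assume "superspace.dependent (m ` J)"
    then obtain c v where c: "v \<in> m ` J" "c v \<noteq> 0" "(\<Sum>v\<in>m ` J. scale (c v) v) = 0"
      using J(1) by (auto simp: superspace.dependent_finite)
    have "(\<Sum>j\<in>J. scale (c (m j)) (m j)) = 0"
      using c(3) by (simp add: sum.reindex[OF inj])
    then have "\<forall>j\<in>J. c (m j) = 0" by (rule ind)
    then show False using c by auto
  qed
  show "superspace.span (m ` J) = P"
  proof
    show "superspace.span (m ` J) \<subseteq> P"
      using J(2) assms(2) by (rule superspace.span_minimal)
    show "P \<subseteq> superspace.span (m ` J)"
    proof
      fix g assume "g \<in> P"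
      then obtain c where "g = (\<Sum>j\<in>J. scale (c j) (m j))" using span by blast
      moreover have "(\<Sum>j\<in>J. scale (c j) (m j)) \<in> superspace.span (m ` J)"
        by (intro superspace.span_sum superspace.span_scale superspace.span_base imageI)
      ultimately show "g \<in> superspace.span (m ` J)" by simp
    qed
  qed
qed

text \<open>The exact sequence: restricting \<open>g\<close> and its \<open>dlin a\<close>-part to the hyperplane of \<open>a\<close> has as
  kernel the multiples of \<open>lin a\<close>, so that bases of the two ends glue to a basis of the middle term.\<close>

lemma family_basis_glue:
  fixes a v :: "complex ^ 'n::{finite,linorder}"
  assumes av: "pair a v = 1"
    and basis1: "family_basis F1 f1 P1" and basis2: "family_basis F2 f2 P2"
    and P: "superspace.subspace P" "m ` J \<subseteq> P"
    and restr_P: "\<And>g. g \<in> P \<Longrightarrow> restr a v g \<in> P2" and idir_P: "\<And>g. g \<in> P \<Longrightarrow> idir v g \<in> P"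
    and kernel_P: "\<And>g. lin a * g \<in> P \<Longrightarrow> g \<in> P1"
    and J: "J = e1 ` F1 \<union> (e2 ` F2 \<union> e3 ` F2)"
    and inj: "inj_on e1 F1" "inj_on e2 F2" "inj_on e3 F2"
    and disj: "e1 ` F1 \<inter> (e2 ` F2 \<union> e3 ` F2) = {}" "e2 ` F2 \<inter> e3 ` F2 = {}"
    and m1: "\<And>i. i \<in> F1 \<Longrightarrow> m (e1 i) = lin a * f1 i"
    and m2: "\<And>j. j \<in> F2 \<Longrightarrow> restr a v (m (e2 j)) = f2 j"
    and m3: "\<And>j. j \<in> F2 \<Longrightarrow> m (e3 j) = scale (s j) (dlin a * m (e2 j))"
    and s: "\<And>j. j \<in> F2 \<Longrightarrow> s j \<noteq> 0"
  shows "family_basis J m P"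
proof -
  interpret restr: Vector_Spaces.linear scale scale "restr a v"
    by (rule restr_linear[OF av])
  have fin: "finite F1" "finite F2"
    using basis1 basis2 by (auto simp: family_basis_def)
  have a: "a \<noteq> 0" using av by (auto simp: pair_def)
  have ind1: "\<forall>i\<in>F1. c i = 0" if "(\<Sum>i\<in>F1. scale (c i) (f1 i)) = 0" for c
    using basis1 that by (auto simp: family_basis_def)
  have ind2: "\<forall>i\<in>F2. c i = 0" if "(\<Sum>i\<in>F2. scale (c i) (f2 i)) = 0" for c
    using basis2 that by (auto simp: family_basis_def)
  have span1: "\<exists>c. g = (\<Sum>i\<in>F1. scale (c i) (f1 i))" if "g \<in> P1" for g
    using basis1 that by (auto simp: family_basis_def)
  have span2: "\<exists>c. g = (\<Sum>i\<in>F2. scale (c i) (f2 i))" if "g \<in> P2" for g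
    using basis2 that by (auto simp: family_basis_def)
  have sum_J: "(\<Sum>x\<in>J. scale (c x) (m x)) =
      lin a * (\<Sum>i\<in>F1. scale (c (e1 i)) (f1 i)) + (\<Sum>j\<in>F2. scale (c (e2 j)) (m (e2 j)))
      + dlin a * (\<Sum>j\<in>F2. scale (c (e3 j) * s j) (m (e2 j)))" for c
  proof -
    have "(\<Sum>x\<in>J. scale (c x) (m x)) = (\<Sum>i\<in>F1. scale (c (e1 i)) (m (e1 i)))
        + ((\<Sum>j\<in>F2. scale (c (e2 j)) (m (e2 j))) + (\<Sum>j\<in>F2. scale (c (e3 j)) (m (e3 j))))"
      using fin disj inj unfolding J by (simp add: sum.union_disjoint sum.reindex)
    also have "(\<Sum>i\<in>F1. scale (c (e1 i)) (m (e1 i))) = lin a * (\<Sum>i\<in>F1. scale (c (e1 i)) (f1 i))"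
      by (simp add: sum_distrib_left m1)
    also have "(\<Sum>j\<in>F2. scale (c (e3 j)) (m (e3 j))) = dlin a * (\<Sum>j\<in>F2. scale (c (e3 j) * s j) (m (e2 j)))"
      by (simp add: sum_distrib_left m3)
    finally show ?thesis by (simp add: add.assoc)
  qed
  have restr_sum: "restr a v (\<Sum>j\<in>F2. scale (c j) (m (e2 j))) = (\<Sum>j\<in>F2. scale (c j) (f2 j))" for c
    by (simp add: restr.sum restr.scale m2)
  have ind: "\<forall>x\<in>J. c x = 0" if c: "(\<Sum>x\<in>J. scale (c x) (m x)) = 0" for c
  \<comment> \<open>The coefficients vanish in the order \<open>e2\<close>, \<open>e3\<close>,
    \<open>e1\<close>: restriction kills multiples of \<open>a\<close> and \<open>da\<close>,
    contraction along \<open>v\<close> then isolates the \<open>da\<close>-part, and finally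
    \<open>lin a\<close> cancels.\<close>
  proof -
    let ?s1 = "\<Sum>i\<in>F1. scale (c (e1 i)) (f1 i)"
    let ?s2 = "\<Sum>j\<in>F2. scale (c (e2 j)) (m (e2 j))"
    let ?s3 = "\<Sum>j\<in>F2. scale (c (e3 j) * s j) (m (e2 j))"
    have eq: "lin a * ?s1 + ?s2 + dlin a * ?s3 = 0"
      using c unfolding sum_J .
    have "restr a v (lin a * ?s1 + ?s2 + dlin a * ?s3) = restr a v ?s2"
      by (simp only: restr.add restr_lin_self[OF av] restr_dlin_self[OF av]) simp
    then have "(\<Sum>j\<in>F2. scale (c (e2 j)) (f2 j)) = 0"
      unfolding eq restr.zero restr_sum ..
    then have c2: "\<forall>j\<in>F2. c (e2 j) = 0" by (rule ind2)
    then have "?s2 = 0" by simp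
    then have eq': "lin a * ?s1 + dlin a * ?s3 = 0" using eq by simp
    have "restr a v (idir v (lin a * ?s1 + dlin a * ?s3)) = restr a v ?s3"
      by (simp only: idir.add restr.add restr_idir_lin[OF av] restr_idir_dlin[OF av]) simp
    then have "(\<Sum>j\<in>F2. scale (c (e3 j) * s j) (f2 j)) = 0"
      unfolding eq' idir.zero restr.zero restr_sum ..
    then have c3': "\<forall>j\<in>F2. c (e3 j) * s j = 0" by (rule ind2)
    then have c3: "\<forall>j\<in>F2. c (e3 j) = 0" using s by auto
    have "?s3 = 0" using c3' by (intro sum.neutral) simp
    then have "lin a * ?s1 = 0" using eq' by simp
    then have "?s1 = 0" by (rule lin_mult_cancel[OF a])
    then have "\<forall>i\<in>F1. c (e1 i) = 0" by (rule ind1)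
    then show ?thesis using c2 c3 unfolding J by auto
  qed
  have span: "\<exists>c. g = (\<Sum>x\<in>J. scale (c x) (m x))" if g: "g \<in> P" for g
  proof -
    have e2_P: "(\<Sum>j\<in>F2. scale (c j) (m (e2 j))) \<in> P" for c
      using P(2) unfolding J
      by (intro superspace.subspace_sum[OF P(1)] superspace.subspace_scale[OF P(1)]) auto
    obtain c2 where c2: "restr a v g = (\<Sum>j\<in>F2. scale (c2 j) (f2 j))"
      using span2[OF restr_P[OF g]] by blast
    \<comment> \<open>Subtracting lifts makes the restriction zero; subtracting \<open>da\<close>
      times further lifts does the same for the restricted \<open>da\<close>-part. What is left lies
      in the kernel and is a multiple of \<open>a\<close>.\<close>
    define g' where "g' = g - (\<Sum>j\<in>F2. scale (c2 j) (m (e2 j)))"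
    have g': "g' \<in> P" "restr a v g' = 0"
      using g e2_P by (simp_all add: g'_def superspace.subspace_diff[OF P(1)] restr.diff restr_sum c2)
    obtain c3 where c3: "restr a v (idir v g') = (\<Sum>j\<in>F2. scale (c3 j) (f2 j))"
      using span2[OF restr_P[OF idir_P[OF g'(1)]]] by blast
    define w where "w = (\<Sum>j\<in>F2. scale (c3 j) (m (e2 j)))"
    have "dlin a * w = (\<Sum>j\<in>F2. scale (c3 j / s j) (m (e3 j)))"
      unfolding w_def sum_distrib_left using s by (intro sum.cong refl) (simp add: m3)
    also have "\<dots> \<in> P"
      using P(2) unfolding J
      by (intro superspace.subspace_sum[OF P(1)] superspace.subspace_scale[OF P(1)]) auto
    finally have "g' - dlin a * w \<in> P"
      by (rule superspace.subspace_diff[OF P(1) g'(1)])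
    moreover obtain f where f: "g' - dlin a * w = lin a * f"
    proof (rule restr_kernel[OF av])
      show "restr a v (g' - dlin a * w) = 0"
        by (simp add: restr.diff g' restr_dlin_self[OF av])
      show "restr a v (idir v (g' - dlin a * w)) = 0"
        by (simp add: idir.diff restr.diff restr_idir_dlin[OF av] c3 w_def restr_sum)
    qed
    ultimately obtain c1 where c1: "f = (\<Sum>i\<in>F1. scale (c1 i) (f1 i))"
      using span1[OF kernel_P] by metis
    \<comment> \<open>Division by \<open>s\<close> compensates for the factor with which
      \<open>m (e3 j)\<close> differs from \<open>dlin a * m (e2 j)\<close>.\<close>
    define c where "c x = (if x \<in> e1 ` F1 then c1 (inv_into F1 e1 x)
      else if x \<in> e2 ` F2 then c2 (inv_into F2 e2 x)
      else c3 (inv_into F2 e3 x) / s (inv_into F2 e3 x))" for x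
    have c_e: "\<And>i. i \<in> F1 \<Longrightarrow> c (e1 i) = c1 i" "\<And>j. j \<in> F2 \<Longrightarrow> c (e2 j) = c2 j"
      "\<And>j. j \<in> F2 \<Longrightarrow> c (e3 j) = c3 j / s j"
      using disj inj by (auto simp: c_def inv_into_f_f disjoint_iff)
    have "g = lin a * f + (\<Sum>j\<in>F2. scale (c2 j) (m (e2 j))) + dlin a * w"
      using f by (simp add: g'_def algebra_simps)
    also have "\<dots> = (\<Sum>x\<in>J. scale (c x) (m x))"
      unfolding sum_J c1 w_def using s by (simp add: c_e cong: sum.cong)
    finally show ?thesis by blast
  qed
  show ?thesis
    unfolding family_basis_def using fin P(2) ind span by (auto simp: J)
qed


section \<open>The monomial basis\<close>

definition monomial_index ::
    "'h::linorder set \<Rightarrow> ('h \<Rightarrow> complex ^ 'n::finite) \<Rightarrow> ('h set \<times> 'h set \<times> 'h set \<times> 'h set) set" where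
  "monomial_index A \<alpha> = {(B, I, S, T). basis A \<alpha> B \<and> I \<subseteq> IP A \<alpha> B \<and>
     S \<subseteq> IA A \<alpha> B \<and> T \<subseteq> IA A \<alpha> B \<and> S \<inter> T = {}}"

fun monomial ::
    "'h::linorder set \<Rightarrow> ('h \<Rightarrow> complex ^ 'n::{finite,linorder}) \<Rightarrow> 'h set \<times> 'h set \<times> 'h set \<times> 'h set \<Rightarrow> 'n superspace" where
  "monomial A \<alpha> (B, I, S, T) = x_prod \<alpha> (EP A \<alpha> B) * d_prod \<alpha> I * x_prod \<alpha> S * d_prod \<alpha> T"

lemma M_set_eq: "M_set A \<alpha> = monomial A \<alpha> ` monomial_index A \<alpha>"
proof (intro equalityI subsetI)
  fix f assume "f \<in> M_set A \<alpha>"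
  then obtain B I S T where "(B, I, S, T) \<in> monomial_index A \<alpha>" "f = monomial A \<alpha> (B, I, S, T)"
    unfolding M_set_def monomial_index_def by auto
  then show "f \<in> monomial A \<alpha> ` monomial_index A \<alpha>" by (simp only: imageI)
next
  fix f assume "f \<in> monomial A \<alpha> ` monomial_index A \<alpha>"
  then obtain x where x: "x \<in> monomial_index A \<alpha>" "f = monomial A \<alpha> x" by blast
  obtain B I S T where "x = (B, I, S, T)" by (cases x)
  then show "f \<in> M_set A \<alpha>"
    using x unfolding M_set_def monomial_index_def by auto
qed

lemma monomial_in_ext_space:
  assumes "finite A" "x \<in> monomial_index A \<alpha>"
  shows "monomial A \<alpha> x \<in> ext_space A \<alpha>"
proof -
  obtain B I S T where x: "x = (B, I, S, T)" by (cases x)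
  have "EP A \<alpha> B \<subseteq> A - B" "IP A \<alpha> B \<subseteq> B" "IA A \<alpha> B \<subseteq> B" "IA A \<alpha> B \<inter> IP A \<alpha> B = {}" "B \<subseteq> A"
    using assms(2) by (auto simp: EP_def IA_def IP_def x monomial_index_def basis_def)
  then show ?thesis
    using assms(2) unfolding x monomial.simps monomial_index_def
    by (intro product_in_ext_space[OF assms(1)]) auto
qed

lemma monomial_index_subset:
  assumes "(B, I, S, T) \<in> monomial_index A \<alpha>"
  shows "B \<subseteq> A" "I \<subseteq> A" "S \<subseteq> A" "T \<subseteq> A"
  using assms by (auto simp: monomial_index_def basis_def IA_def IP_def)

lemma d_prod_dlin_mult:
  "d_prod \<alpha> X * (dlin a * g) = scale ((-1) ^ card X) (dlin a * (d_prod \<alpha> X * g))"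
proof (cases "finite X")
  case True
  have "(\<Prod>h\<leftarrow>xs. dlin (\<alpha> h)) * (dlin a * g) =
      scale ((-1) ^ length xs) (dlin a * ((\<Prod>h\<leftarrow>xs. dlin (\<alpha> h)) * g))" for xs
    by (induction xs) (simp_all add: mult.assoc dlin_left_anticommute[of _ a])
  from this[of "sorted_list_of_set X"] show ?thesis
    using True by (simp add: d_prod_def)
next
  case False
  then show ?thesis by (simp add: d_prod_def)
qed

text \<open>The largest index comes last in the sorted product; moving its differential to the front
  passes \<open>card X\<close> others.\<close>

lemma d_prod_insert_max:
  assumes "finite X" "\<And>k. k \<in> X \<Longrightarrow> k < h"
  shows "d_prod \<alpha> (insert h X) = scale ((-1) ^ card X) (dlin (\<alpha> h) * d_prod \<alpha> X)"
proof -
  have "h \<notin> X" using assms(2) by blast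
  have "insort h xs = xs @ [h]" if "\<forall>k\<in>set xs. k < h" for xs
    using that by (induction xs) auto
  then have "d_prod \<alpha> (insert h X) = d_prod \<alpha> X * (dlin (\<alpha> h) * 1)"
    using assms \<open>h \<notin> X\<close> by (simp add: d_prod_def)
  then show ?thesis unfolding d_prod_dlin_mult by simp
qed

context
  fixes A :: "'h::linorder set" and h :: 'h and \<alpha> :: "'h \<Rightarrow> complex ^ 'n::{finite,linorder}"
  assumes fin: "finite A" and less_h: "\<forall>k\<in>A. k < h"
begin

text \<open>A zero form changes neither the index set, nor the monomials, nor any line rank.\<close>

lemma family_basis_loop:
  assumes "\<alpha> h = 0" "family_basis (monomial_index A \<alpha>) (monomial A \<alpha>) (ext_space A \<alpha>)"
  shows "family_basis (monomial_index (insert h A) \<alpha>) (monomial (insert h A) \<alpha>) (ext_space (insert h A) \<alpha>)"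
proof -
  note loop = loop_activities[where A = A and h = h and \<alpha> = \<alpha>, OF fin less_h assms(1)]
  have index: "monomial_index (insert h A) \<alpha> = monomial_index A \<alpha>"
    using loop by (auto simp: monomial_index_def IP_def)
  have monomial: "monomial (insert h A) \<alpha> x = monomial A \<alpha> x" if "x \<in> monomial_index A \<alpha>" for x
    using that loop(2) by (cases x) (simp add: monomial_index_def)
  have "pair (0 :: complex ^ 'n::{finite,linorder}) l = 0" for l by (simp add: pair_def)
  then have "line_rank (insert h A) \<alpha> l = line_rank A \<alpha> l" for l
    unfolding line_rank_def using assms(1) by (intro arg_cong[where f = card]) auto
  then have "ext_space (insert h A) \<alpha> = ext_space A \<alpha>"
    by (simp add: ext_space_def)
  then show ?thesis
    using assms(2) monomial unfolding family_basis_def index by (simp cong: sum.cong image_cong)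
qed

context
  fixes v
  assumes v: "pair (\<alpha> h) v = 1"
begin

abbreviation (input) "\<beta> \<equiv> \<lambda>k. proj_form (\<alpha> h) v (\<alpha> k)"

text \<open>Adding \<open>h\<close> to \<open>B\<close> and keeping \<open>I\<close>,
  \<open>S\<close>, \<open>T\<close> lifts a monomial of the contraction: the passive elements stay
  the same, and each factor restricts to its projected form.\<close>

lemma restr_monomial:
  assumes "(B, I, S, T) \<in> monomial_index A \<beta>"
  shows "restr (\<alpha> h) v (monomial (insert h A) \<alpha> (insert h B, I, S, T)) = monomial A \<beta> (B, I, S, T)"
proof -
  have B: "basis A \<beta> B" using assms by (simp add: monomial_index_def)
  have EP: "EP (insert h A) \<alpha> (insert h B) = EP A \<beta> B"
    by (rule contract_activities(1)[OF fin less_h v B])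
  have "finite (EP A \<beta> B)" "finite S"
    using fin monomial_index_subset[OF assms] by (auto simp: EP_def intro: finite_subset)
  \<comment> \<open>The trailing 1 brings the last product into the shape that the multiplication
    rule for \<open>restr\<close> expects.\<close>
  moreover have "restr (\<alpha> h) v (d_prod \<alpha> T * 1) = d_prod \<beta> T * 1"
    unfolding restr_d_prod_mult[OF v] restr_one[OF v] ..
  ultimately show ?thesis
    by (simp add: EP mult.assoc restr_x_prod_mult[OF v] restr_d_prod_mult[OF v])
qed

text \<open>The gluing lemma with everything filled in that does not depend on whether
  \<open>h\<close> is a coloop. The lift \<open>e2\<close> is common to both cases;
  \<open>e1\<close> and \<open>e3\<close> say where \<open>h\<close> goes to contribute
  \<open>\<alpha> h\<close> and \<open>d\<alpha> h\<close>.\<close>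

lemma family_basis_insert:
  fixes e1 e2 e3
  assumes basis: "family_basis (monomial_index A \<alpha>) (monomial A \<alpha>) (ext_space A \<alpha>)"
    "family_basis (monomial_index A \<beta>) (monomial A \<beta>) (ext_space A \<beta>)"
    and e2: "e2 = (\<lambda>(B, I, S, T). (insert h B, I, S, T))"
    and J: "monomial_index (insert h A) \<alpha> = e1 ` monomial_index A \<alpha> \<union>
      (e2 ` monomial_index A \<beta> \<union> e3 ` monomial_index A \<beta>)"
    and inj: "inj_on e1 (monomial_index A \<alpha>)" "inj_on e3 (monomial_index A \<beta>)"
    and disj: "e1 ` monomial_index A \<alpha> \<inter> (e2 ` monomial_index A \<beta> \<union> e3 ` monomial_index A \<beta>) = {}"
      "e2 ` monomial_index A \<beta> \<inter> e3 ` monomial_index A \<beta> = {}"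
    and m1: "\<And>x. x \<in> monomial_index A \<alpha> \<Longrightarrow> monomial (insert h A) \<alpha> (e1 x) = lin (\<alpha> h) * monomial A \<alpha> x"
    and m3: "\<And>x. x \<in> monomial_index A \<beta> \<Longrightarrow> monomial (insert h A) \<alpha> (e3 x) =
      scale (s x) (dlin (\<alpha> h) * monomial (insert h A) \<alpha> (e2 x))"
    and s: "\<And>x. s x \<noteq> 0"
  shows "family_basis (monomial_index (insert h A) \<alpha>) (monomial (insert h A) \<alpha>) (ext_space (insert h A) \<alpha>)"
proof (rule family_basis_glue[OF v basis _ _ _ _ _ J inj(1) _ inj(2) disj m1 _ m3 s])
  have h: "h \<notin> A" using less_h by blast
  have ne: "\<alpha> h \<noteq> 0" using v by (auto simp: pair_def)
  show "superspace.subspace (ext_space (insert h A) \<alpha>)" by (rule ext_space_subspace)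
  show "monomial (insert h A) \<alpha> ` monomial_index (insert h A) \<alpha> \<subseteq> ext_space (insert h A) \<alpha>"
    using monomial_in_ext_space[of "insert h A"] fin by blast
  show "restr (\<alpha> h) v g \<in> ext_space A \<beta>" if "g \<in> ext_space (insert h A) \<alpha>" for g
    by (rule restr_in_ext_space[OF v fin h refl that])
  show "idir v g \<in> ext_space (insert h A) \<alpha>" if "g \<in> ext_space (insert h A) \<alpha>" for g
    by (rule ext_space_idir[OF that])
  show "g \<in> ext_space A \<alpha>" if "lin (\<alpha> h) * g \<in> ext_space (insert h A) \<alpha>" for g
    using that lin_mult_in_ext_space_iff[of A h \<alpha> g] fin h ne by simp
  show "inj_on e2 (monomial_index A \<beta>)"
  proof (rule inj_onI)
    fix x y assume xy: "x \<in> monomial_index A \<beta>" "y \<in> monomial_index A \<beta>" "e2 x = e2 y"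
    obtain B I S T B' I' S' T' where [simp]: "x = (B, I, S, T)" "y = (B', I', S', T')"
      by (cases x, cases y)
    have "h \<notin> B" "h \<notin> B'"
      using xy h monomial_index_subset(1)[of B I S T A \<beta>] monomial_index_subset(1)[of B' I' S' T' A \<beta>]
      by auto
    then show "x = y" using xy(3) by (auto simp: e2 insert_ident)
  qed
  show "restr (\<alpha> h) v (monomial (insert h A) \<alpha> (e2 x)) = monomial A \<beta> x" if "x \<in> monomial_index A \<beta>" for x
    using that restr_monomial by (cases x) (simp add: e2)
qed

lemma family_basis_nonloop:
  assumes basis: "family_basis (monomial_index A \<alpha>) (monomial A \<alpha>) (ext_space A \<alpha>)"
    "family_basis (monomial_index A \<beta>) (monomial A \<beta>) (ext_space A \<beta>)"
  shows "family_basis (monomial_index (insert h A) \<alpha>) (monomial (insert h A) \<alpha>) (ext_space (insert h A) \<alpha>)"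
proof -
  have h: "h \<notin> A" using less_h by blast
  have ne: "\<alpha> h \<noteq> 0" using v by (auto simp: pair_def)
  define e2 :: "'h set \<times> 'h set \<times> 'h set \<times> 'h set \<Rightarrow> 'h set \<times> 'h set \<times> 'h set \<times> 'h set"
    where "e2 = (\<lambda>(B, I, S, T). (insert h B, I, S, T))"
  note contr = contract_activities[where A = A and h = h and \<alpha> = \<alpha>, OF fin less_h v]
  note basis_contr = basis_contract[where A = A and h = h and \<alpha> = \<alpha>, OF fin less_h v]
  note sub = monomial_index_subset
  have notin: "h \<notin> B" "h \<notin> I" "h \<notin> S" "h \<notin> T" if "(B, I, S, T) \<in> monomial_index A \<gamma>"
    for B I S T and \<gamma> :: "'h \<Rightarrow> complex ^ 'n::{finite,linorder}"
    using sub[OF that] h by auto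
  have ins: "insert h X = insert h Y \<longleftrightarrow> X = Y" if "X \<subseteq> A" "Y \<subseteq> A" for X Y
    using that h by (intro insert_ident) auto
  show ?thesis
  proof (cases "\<alpha> h \<in> vec.span (\<alpha> ` A)")
    case True
    \<comment> \<open>Not a coloop: bases avoiding \<open>h\<close> have it externally passive,
      which supplies the factor \<open>\<alpha> h\<close>, so \<open>e1\<close> is the identity. For
      bases containing \<open>h\<close> it is internally passive and may enter
      \<open>I\<close>.\<close>
    define e3 :: "'h set \<times> 'h set \<times> 'h set \<times> 'h set \<Rightarrow> 'h set \<times> 'h set \<times> 'h set \<times> 'h set"
      where "e3 = (\<lambda>(B, I, S, T). (insert h B, insert h I, S, T))"
    note del = delete_activities[where A = A and h = h and \<alpha> = \<alpha>, OF fin less_h True ne]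
    note basis_del = basis_delete[where A = A and h = h and \<alpha> = \<alpha>, OF fin less_h True]
    have IA_contr: "IA (insert h A) \<alpha> (insert h B) = IA A \<beta> B"
      and IP_contr: "IP (insert h A) \<alpha> (insert h B) = insert h (IP A \<beta> B)" if "basis A \<beta> B" for B
    proof -
      show "IA (insert h A) \<alpha> (insert h B) = IA A \<beta> B" using contr(2)[OF that] True by simp
      moreover have "h \<notin> IA A \<beta> B" using that h by (auto simp: IA_def basis_def)
      ultimately show "IP (insert h A) \<alpha> (insert h B) = insert h (IP A \<beta> B)"
        by (auto simp: IP_def)
    qed
    show ?thesis
    \<comment> \<open>The sign comes from moving \<open>d\<alpha> h\<close> from the end of the
      product over \<open>insert h I\<close> to its front.\<close>
    proof (rule family_basis_insert[where ?e1.0 = "\<lambda>x. x" and ?e3.0 = e3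
          and s = "\<lambda>(B, I, S, T). (-1) ^ card I", OF basis e2_def])
      show "monomial_index (insert h A) \<alpha> = (\<lambda>x. x) ` monomial_index A \<alpha> \<union>
          (e2 ` monomial_index A \<beta> \<union> e3 ` monomial_index A \<beta>)"
      proof (intro equalityI subsetI)
        fix x assume x: "x \<in> monomial_index (insert h A) \<alpha>"
        obtain B I S T where [simp]: "x = (B, I, S, T)" by (cases x)
        show "x \<in> (\<lambda>x. x) ` monomial_index A \<alpha> \<union> (e2 ` monomial_index A \<beta> \<union> e3 ` monomial_index A \<beta>)"
        proof (cases "h \<in> B")
          case False
          then have "basis A \<alpha> B" using x basis_del[of B] by (simp add: monomial_index_def)
          then show ?thesis using x del(2)[of B] by (simp add: monomial_index_def IP_def)
        next
          case hB: True
          define C where "C = B - {h}"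
          have B: "B = insert h C" "h \<notin> C" using hB by (auto simp: C_def)
          have "C \<subseteq> A" using x B by (auto simp: monomial_index_def basis_def)
          then have C: "basis A \<beta> C" using x B basis_contr[of C] by (simp add: monomial_index_def)
          show ?thesis
          proof (cases "h \<in> I")
            case False
            then have "(C, I, S, T) \<in> monomial_index A \<beta>"
              using x C IA_contr[OF C] IP_contr[OF C] by (auto simp: monomial_index_def B)
            then have "e2 (C, I, S, T) \<in> e2 ` monomial_index A \<beta>" by (rule imageI)
            then show ?thesis by (simp add: e2_def B)
          next
            case True
            then have "(C, I - {h}, S, T) \<in> monomial_index A \<beta>"
              using x C IA_contr[OF C] IP_contr[OF C] by (auto simp: monomial_index_def B)
            then have "e3 (C, I - {h}, S, T) \<in> e3 ` monomial_index A \<beta>" by (rule imageI)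
            then show ?thesis using True by (simp add: e3_def B insert_absorb)
          qed
        qed
      next
        fix x assume "x \<in> (\<lambda>x. x) ` monomial_index A \<alpha> \<union> (e2 ` monomial_index A \<beta> \<union> e3 ` monomial_index A \<beta>)"
        then consider "x \<in> monomial_index A \<alpha>" | y where "y \<in> monomial_index A \<beta>" "x = e2 y \<or> x = e3 y"
          by auto
        then show "x \<in> monomial_index (insert h A) \<alpha>"
        proof cases
          case 1
          obtain B I S T where [simp]: "x = (B, I, S, T)" by (cases x)
          have "h \<notin> B" using sub(1)[of B I S T A \<alpha>] 1 h by auto
          then show ?thesis using 1 del(2)[of B] basis_del[of B] by (simp add: monomial_index_def IP_def)
        next
          case 2
          obtain B I S T where y: "y = (B, I, S, T)" by (cases y)
          have B: "basis A \<beta> B" "B \<subseteq> A" using 2 y sub(1)[of B I S T A \<beta>] by (auto simp: monomial_index_def)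
          show ?thesis
            using 2 IA_contr[OF B(1)] IP_contr[OF B(1)] basis_contr[OF B(2)]
            by (auto simp: y e2_def e3_def monomial_index_def)
        qed
      qed
      show "inj_on (\<lambda>x. x) (monomial_index A \<alpha>)" by simp
      show "inj_on e3 (monomial_index A \<beta>)"
      proof (rule inj_onI)
        fix x y assume xy: "x \<in> monomial_index A \<beta>" "y \<in> monomial_index A \<beta>" "e3 x = e3 y"
        obtain B I S T B' I' S' T' where [simp]: "x = (B, I, S, T)" "y = (B', I', S', T')"
          by (cases x, cases y)
        have "insert h B = insert h B'" "insert h I = insert h I'" "S = S'" "T = T'"
          using xy(3) by (simp_all add: e3_def)
        moreover have "B \<subseteq> A" "B' \<subseteq> A" "I \<subseteq> A" "I' \<subseteq> A"
          using xy(1,2) sub[of B I S T A \<beta>] sub[of B' I' S' T' A \<beta>] by simp_all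
        ultimately show "x = y" using ins[of B B'] ins[of I I'] by simp
      qed
      show "(\<lambda>x. x) ` monomial_index A \<alpha> \<inter> (e2 ` monomial_index A \<beta> \<union> e3 ` monomial_index A \<beta>) = {}"
        by (auto simp: e2_def e3_def dest: notin)
      show "e2 ` monomial_index A \<beta> \<inter> e3 ` monomial_index A \<beta> = {}"
        by (auto simp: e2_def e3_def dest: notin)
      show "monomial (insert h A) \<alpha> x = lin (\<alpha> h) * monomial A \<alpha> x" if "x \<in> monomial_index A \<alpha>" for x
      proof -
        obtain B I S T where [simp]: "x = (B, I, S, T)" by (cases x)
        have "EP (insert h A) \<alpha> B = insert h (EP A \<alpha> B)"
          using del(1)[of B] that by (simp add: monomial_index_def)
        moreover have "finite (EP A \<alpha> B)" "h \<notin> EP A \<alpha> B" using fin h by (auto simp: EP_def)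
        ultimately show ?thesis by (simp add: x_prod_insert mult.assoc)
      qed
      show "monomial (insert h A) \<alpha> (e3 x) = scale (case x of (B, I, S, T) \<Rightarrow> (-1) ^ card I)
          (dlin (\<alpha> h) * monomial (insert h A) \<alpha> (e2 x))" if "x \<in> monomial_index A \<beta>" for x
      proof -
        obtain B I S T where [simp]: "x = (B, I, S, T)" by (cases x)
        have "I \<subseteq> A" using that sub(2)[of B I S T A \<beta>] by simp
        then have "d_prod \<alpha> (insert h I) = scale ((-1) ^ card I) (dlin (\<alpha> h) * d_prod \<alpha> I)"
          using less_h fin by (intro d_prod_insert_max) (auto intro: finite_subset)
        then show ?thesis
          by (simp add: e2_def e3_def mult.assoc x_prod_def of_mpoly_left_commute[of "dlin (\<alpha> h)"])
      qed
    qed (simp split: prod.split)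
  next
    case False
    \<comment> \<open>A coloop lies in every basis and is internally active: \<open>h\<close> in
      \<open>S\<close> gives the factor \<open>\<alpha> h\<close>, \<open>h\<close> in
      \<open>T\<close> the factor \<open>d\<alpha> h\<close>.\<close>
    define e1 :: "'h set \<times> 'h set \<times> 'h set \<times> 'h set \<Rightarrow> 'h set \<times> 'h set \<times> 'h set \<times> 'h set"
      where "e1 = (\<lambda>(B, I, S, T). (insert h B, I, insert h S, T))"
    define e3 :: "'h set \<times> 'h set \<times> 'h set \<times> 'h set \<Rightarrow> 'h set \<times> 'h set \<times> 'h set \<times> 'h set"
      where "e3 = (\<lambda>(B, I, S, T). (insert h B, I, S, insert h T))"
    note coloop = coloop_activities[where A = A and h = h and \<alpha> = \<alpha>, OF fin less_h False]
    note basis_co = basis_coloop[where A = A and h = h and \<alpha> = \<alpha>, OF fin less_h False]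
    note mem_co = coloop_mem_basis[where A = A and h = h and \<alpha> = \<alpha>, OF fin less_h False]
    have IA_contr: "IA (insert h A) \<alpha> (insert h B) = insert h (IA A \<beta> B)"
      and IP_contr: "IP (insert h A) \<alpha> (insert h B) = IP A \<beta> B" if "basis A \<beta> B" for B
    proof -
      show "IA (insert h A) \<alpha> (insert h B) = insert h (IA A \<beta> B)" using contr(2)[OF that] False by simp
      moreover have "h \<notin> B" using that h by (auto simp: basis_def)
      ultimately show "IP (insert h A) \<alpha> (insert h B) = IP A \<beta> B"
        by (auto simp: IP_def)
    qed
    have IA_co: "IA (insert h A) \<alpha> (insert h B) = insert h (IA A \<alpha> B)"
      and IP_co: "IP (insert h A) \<alpha> (insert h B) = IP A \<alpha> B" if "basis A \<alpha> B" for B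
    proof -
      show "IA (insert h A) \<alpha> (insert h B) = insert h (IA A \<alpha> B)" by (rule coloop(2)[OF that])
      moreover have "h \<notin> B" using that h by (auto simp: basis_def)
      ultimately show "IP (insert h A) \<alpha> (insert h B) = IP A \<alpha> B"
        by (auto simp: IP_def)
    qed
    show ?thesis
    \<comment> \<open>Here \<open>d\<alpha> h\<close> has to pass the differentials of
      \<open>T\<close> and of \<open>I\<close>.\<close>
    proof (rule family_basis_insert[where ?e1.0 = e1 and ?e3.0 = e3
          and s = "\<lambda>(B, I, S, T). (-1) ^ (card I + card T)", OF basis e2_def])
      show "monomial_index (insert h A) \<alpha> = e1 ` monomial_index A \<alpha> \<union>
          (e2 ` monomial_index A \<beta> \<union> e3 ` monomial_index A \<beta>)"
      proof (intro equalityI subsetI)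
        fix x assume x: "x \<in> monomial_index (insert h A) \<alpha>"
        obtain B I S T where [simp]: "x = (B, I, S, T)" by (cases x)
        have hB: "h \<in> B" using x mem_co[of B] by (simp add: monomial_index_def)
        define C where "C = B - {h}"
        have B: "B = insert h C" "h \<notin> C" using hB by (auto simp: C_def)
        have CA: "C \<subseteq> A" using x B by (auto simp: monomial_index_def basis_def)
        \<comment> \<open>For a coloop, \<open>C\<close> is a basis of the deletion and of the
          contraction alike; the position of \<open>h\<close> decides which index set it is used
          in.\<close>
        then have C: "basis A \<beta> C" "basis A \<alpha> C"
          using x B basis_contr[of C] basis_co[of C] by (simp_all add: monomial_index_def)
        consider "h \<in> S" "h \<notin> T" | "h \<notin> S" "h \<notin> T" | "h \<notin> S" "h \<in> T"
          using x by (auto simp: monomial_index_def)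
        then show "x \<in> e1 ` monomial_index A \<alpha> \<union> (e2 ` monomial_index A \<beta> \<union> e3 ` monomial_index A \<beta>)"
        proof cases
          case 1
          then have "(C, I, S - {h}, T) \<in> monomial_index A \<alpha>"
            using x C IA_co[OF C(2)] IP_co[OF C(2)] by (auto simp: monomial_index_def B)
          then have "e1 (C, I, S - {h}, T) \<in> e1 ` monomial_index A \<alpha>" by (rule imageI)
          then show ?thesis using 1 by (simp add: e1_def B insert_absorb)
        next
          case 2
          then have "(C, I, S, T) \<in> monomial_index A \<beta>"
            using x C IA_contr[OF C(1)] IP_contr[OF C(1)] by (auto simp: monomial_index_def B)
          then have "e2 (C, I, S, T) \<in> e2 ` monomial_index A \<beta>" by (rule imageI)
          then show ?thesis by (simp add: e2_def B)
        next
          case 3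
          then have "(C, I, S, T - {h}) \<in> monomial_index A \<beta>"
            using x C IA_contr[OF C(1)] IP_contr[OF C(1)] by (auto simp: monomial_index_def B)
          then have "e3 (C, I, S, T - {h}) \<in> e3 ` monomial_index A \<beta>" by (rule imageI)
          then show ?thesis using 3 by (simp add: e3_def B insert_absorb)
        qed
      next
        fix x assume "x \<in> e1 ` monomial_index A \<alpha> \<union> (e2 ` monomial_index A \<beta> \<union> e3 ` monomial_index A \<beta>)"
        then consider y where "y \<in> monomial_index A \<alpha>" "x = e1 y"
          | y where "y \<in> monomial_index A \<beta>" "x = e2 y \<or> x = e3 y"
          by auto
        then show "x \<in> monomial_index (insert h A) \<alpha>"
        proof cases
          case 1
          obtain B I S T where y: "y = (B, I, S, T)" by (cases y)
          have B: "basis A \<alpha> B" "B \<subseteq> A" "h \<notin> T"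
            using 1 y h sub(1,4)[of B I S T A \<alpha>] by (auto simp: monomial_index_def)
          show ?thesis
            using 1 B(3) IA_co[OF B(1)] IP_co[OF B(1)] basis_co[OF B(2)]
            by (auto simp: y e1_def monomial_index_def)
        next
          case 2
          obtain B I S T where y: "y = (B, I, S, T)" by (cases y)
          have B: "basis A \<beta> B" "B \<subseteq> A" "h \<notin> S"
            using 2 y h sub(1,3)[of B I S T A \<beta>] by (auto simp: monomial_index_def)
          show ?thesis
            using 2 B(3) IA_contr[OF B(1)] IP_contr[OF B(1)] basis_contr[OF B(2)]
            by (auto simp: y e2_def e3_def monomial_index_def)
        qed
      qed
      show "inj_on e1 (monomial_index A \<alpha>)"
      proof (rule inj_onI)
        fix x y assume xy: "x \<in> monomial_index A \<alpha>" "y \<in> monomial_index A \<alpha>" "e1 x = e1 y"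
        obtain B I S T B' I' S' T' where [simp]: "x = (B, I, S, T)" "y = (B', I', S', T')"
          by (cases x, cases y)
        have "insert h B = insert h B'" "insert h S = insert h S'" "I = I'" "T = T'"
          using xy(3) by (simp_all add: e1_def)
        moreover have "B \<subseteq> A" "B' \<subseteq> A" "S \<subseteq> A" "S' \<subseteq> A"
          using xy(1,2) sub[of B I S T A \<alpha>] sub[of B' I' S' T' A \<alpha>] by simp_all
        ultimately show "x = y" using ins[of B B'] ins[of S S'] by simp
      qed
      show "inj_on e3 (monomial_index A \<beta>)"
      proof (rule inj_onI)
        fix x y assume xy: "x \<in> monomial_index A \<beta>" "y \<in> monomial_index A \<beta>" "e3 x = e3 y"
        obtain B I S T B' I' S' T' where [simp]: "x = (B, I, S, T)" "y = (B', I', S', T')"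
          by (cases x, cases y)
        have "insert h B = insert h B'" "insert h T = insert h T'" "I = I'" "S = S'"
          using xy(3) by (simp_all add: e3_def)
        moreover have "B \<subseteq> A" "B' \<subseteq> A" "T \<subseteq> A" "T' \<subseteq> A"
          using xy(1,2) sub[of B I S T A \<beta>] sub[of B' I' S' T' A \<beta>] by simp_all
        ultimately show "x = y" using ins[of B B'] ins[of T T'] by simp
      qed
      show "e1 ` monomial_index A \<alpha> \<inter> (e2 ` monomial_index A \<beta> \<union> e3 ` monomial_index A \<beta>) = {}"
        by (auto simp: e1_def e2_def e3_def dest: notin)
      show "e2 ` monomial_index A \<beta> \<inter> e3 ` monomial_index A \<beta> = {}"
        by (auto simp: e2_def e3_def dest: notin)
      show "monomial (insert h A) \<alpha> (e1 x) = lin (\<alpha> h) * monomial A \<alpha> x" if "x \<in> monomial_index A \<alpha>" for x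
      proof -
        obtain B I S T where [simp]: "x = (B, I, S, T)" by (cases x)
        have "EP (insert h A) \<alpha> (insert h B) = EP A \<alpha> B"
          using coloop(1)[of B] that by (simp add: monomial_index_def)
        moreover have "S \<subseteq> A" using that sub(3)[of B I S T A \<alpha>] by simp
        then have "finite S" "h \<notin> S" using fin h by (auto intro: finite_subset)
        ultimately show ?thesis
          by (simp add: e1_def x_prod_insert mult.assoc of_mpoly_left_commute[of _ "lin_form (\<alpha> h)"])
      qed
      show "monomial (insert h A) \<alpha> (e3 x) = scale (case x of (B, I, S, T) \<Rightarrow> (-1) ^ (card I + card T))
          (dlin (\<alpha> h) * monomial (insert h A) \<alpha> (e2 x))" if "x \<in> monomial_index A \<beta>" for x
      proof -
        obtain B I S T where [simp]: "x = (B, I, S, T)" by (cases x)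
        have "T \<subseteq> A" using that sub(4)[of B I S T A \<beta>] by simp
        then have "d_prod \<alpha> (insert h T) = scale ((-1) ^ card T) (dlin (\<alpha> h) * d_prod \<alpha> T)"
          using less_h fin by (intro d_prod_insert_max) (auto intro: finite_subset)
        then show ?thesis
          by (simp add: e2_def e3_def mult.assoc x_prod_def power_add mult.commute
              of_mpoly_left_commute[of "dlin (\<alpha> h)", symmetric] d_prod_dlin_mult)
      qed
    qed (simp split: prod.split)
  qed
qed

end

end

text \<open>The forms are generalised because the step uses the hypothesis for
  \<open>\<alpha>\<close> and for its projection. Adding elements in increasing order makes the new
  \<open>h\<close> maximal every time.\<close>

lemma family_basis_monomials:
  fixes A :: "'h::linorder set" and \<alpha> :: "'h \<Rightarrow> complex ^ 'n::{finite,linorder}"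
  assumes "finite A"
  shows "family_basis (monomial_index A \<alpha>) (monomial A \<alpha>) (ext_space A \<alpha>)"
  using assms
proof (induction A arbitrary: \<alpha> rule: finite_linorder_max_induct)
  case empty
  have index: "monomial_index {} \<alpha> = {({}, {}, {}, {})}"
    by (auto simp: monomial_index_def basis_def IP_def IA_def vec.independent_empty)
  have monomial: "monomial {} \<alpha> ({}, {}, {}, {}) = 1"
    by (simp add: EP_def x_prod_empty d_prod_def)
  have "\<exists>c. g = scale (c ({} :: 'h set, {} :: 'h set, {} :: 'h set, {} :: 'h set)) 1" if "g \<in> ext_space {} \<alpha>" for g
  proof -
    \<comment> \<open>All ranks are 0, so first derivatives and contractions vanish. Contractions
      remove every coefficient with a \<open>theta\<close>, derivatives every nonconstant monomial,
      and \<open>g\<close> is a scalar.\<close>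
    have g: "ddir l g = 0" "idir l g = 0" for l
      using that by (auto simp: ext_space_def line_rank_def)
    have "coeff g S = 0" if "i \<in> S" for i S
    proof -
      have "coeff (contract i g) (S - {i}) = 0"
        by (simp add: contract_eq_idir g)
      then have "(-1) ^ card {j \<in> S - {i}. j < i} * coeff g S = 0"
        using that by (simp add: contract_def insert_absorb)
      then show ?thesis
        by (cases "even (card {j \<in> S - {i}. j < i})") simp_all
    qed
    then have theta_free: "coeff g S = 0" if "S \<noteq> {}" for S using that by blast
    define p where "p = coeff g {}"
    have "Poly_Mapping.lookup p m = 0" if "m \<noteq> 0" for m
    proof -
      have "\<not> (\<forall>k. Poly_Mapping.lookup m k = Poly_Mapping.lookup 0 k)"
        using that poly_mapping_eqI[of m 0] by blast
      then obtain i where i: "Poly_Mapping.lookup m i \<noteq> 0" by auto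
      then have m: "m - unit_exp i + unit_exp i = m"
        by (intro poly_mapping_eqI) (auto simp: lookup_add lookup_minus lookup_single when_def)
      have "pdiff i p = coeff (x_diff i g) {}" by (simp add: p_def x_diff_def)
      also have "\<dots> = 0" by (simp add: x_diff_eq_ddir g)
      finally have "Poly_Mapping.lookup (pdiff i p) (m - unit_exp i) = 0" by simp
      then show ?thesis unfolding lookup_pdiff m by (simp del: of_nat_Suc)
    qed
    then have "p = Poly_Mapping.single 0 (Poly_Mapping.lookup p 0)"
      by (intro poly_mapping_eqI) (auto simp: lookup_single when_def)
    then have "g = scale (Poly_Mapping.lookup p 0) 1"
      using theta_free by (intro superspace_eqI) (auto simp: p_def)
    then show ?thesis by (intro exI[of _ "\<lambda>_. Poly_Mapping.lookup p 0"])
  qed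
  then show ?case
    by (simp add: family_basis_def index monomial one_in_ext_space del: monomial.simps)
next
  case (insert h A)
  show ?case
  proof (cases "\<alpha> h = 0")
    case True
    show ?thesis
      using family_basis_loop[of A h \<alpha>] insert True by blast
  next
    case False
    then obtain v where "pair (\<alpha> h) v = 1" by (rule pair_eq_1_exists)
    then show ?thesis
      using family_basis_nonloop[of A h \<alpha> v] insert by blast
  qed
qed


theorem theorem1p2:
  fixes A :: "'h::linorder set"
    and hyp :: "'h \<Rightarrow> (complex ^ 'n::{finite,linorder}) set"
    and \<alpha> :: "'h \<Rightarrow> complex ^ 'n::{finite,linorder}"
  assumes "finite A"
    and "\<And>h. h \<in> A \<Longrightarrow> linear_hyperplane (hyp h)"
    and "\<And>h. h \<in> A \<Longrightarrow> zero_set (\<alpha> h) = hyp h"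
  shows "superspace.independent (M_set A \<alpha>) \<and>
    superspace.span (M_set A \<alpha>) = inverse_system (arrangement_ideal A hyp)"
proof -
  have "superspace.independent (M_set A \<alpha>) \<and> superspace.span (M_set A \<alpha>) = ext_space A \<alpha>"
    unfolding M_set_eq
    by (rule family_basis_imp_basis[OF family_basis_monomials[OF assms(1)] ext_space_subspace])
  then show ?thesis
    by (simp add: inverse_system_eq_ext_space[OF assms(3)])
qed

end
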